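(* Let $(X,\mathscr{A},\mu)$ be a $\sigma$-finite measure space and let $\phi$ be a nonsingular transformation of $X$ such that the composition operator $C_\phi$ is densely defined in $L^2(\mu)$. Suppose that there exist a measurable space $(T,\Sigma)$, an $\mathscr{A}$-measurable family $P\colon X\times\Sigma\to[0,1]$ of probability measures and a $\Sigma$-measurable function $\zeta\colon T\to[0,\infty]$ satisfying one of the following two conditions, which are equivalent under these hypotheses: (i) $\mathsf{h}_\phi(x)\,\big(\mathsf{E}(P(\cdot,\sigma))\circ\phi^{-1}\big)(x)=\int_\sigma \zeta(t)\,P(x,\mathrm{d}t)$ for $\mu$-a.e. $x\in X$, for every $\sigma\in\Sigma$; (ii) $\mathsf{E}(P(\cdot,\sigma))(x)=\dfrac{\int_\sigma \zeta(t)\,P(\phi(x),\mathrm{d}t)}{\mathsf{h}_\phi(\phi(x))}$ for $\mu$-a.e. $x\in X$, for every $\sigma\in\Sigma$, and $C_\phi$ is injective. Then $C_\phi$ is subnormal. Moreover, let $\rho$ be the unique measure on the $\sigma$-algebra $\mathscr{A}\otimes\Sigma$ generated by $\{\Delta\times\sigma:\Delta\in\mathscr{A},\sigma\in\Sigma\}$ such that $\rho(\Delta\times\sigma)=\int_\Delta P(x,\sigma)\,\mu(\mathrm{d}x)$ for $\Delta\in\mathscr{A}$, $\sigma\in\Sigma$, and let $\Phi(x,t)=(\phi(x),t)$ for $(x,t)\in X\times T$. Then $\Phi$ is a nonsingular transformation of $(X\times T,\mathscr{A}\otimes\Sigma,\rho)$ and $C_\Phi$ (in $L^2(\rho)$)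 is a quasinormal extension of $C_\phi$, where $L^2(\mu)$ is identified with a subspace of $L^2(\rho)$ via the isometric embedding $(Uf)(x,t)=f(x)$ (so that $UC_\phi=C_\Phi U$).
   Context: Conventions: $0\cdot\infty=\infty\cdot 0=0$, $1/0=\infty$, $0/0=1$. For a $\sigma$-finite measure space $(X,\mathscr{A},\mu)$, a map $\phi\colon X\to X$ is a nonsingular transformation if $\phi^{-1}(\Delta)\in\mathscr{A}$ for all $\Delta\in\mathscr{A}$ and $\mu(\phi^{-1}(\Delta))=0$ whenever $\mu(\Delta)=0$. The composition operator $C_\phi$ in $L^2(\mu)$ is defined by $\mathcal{D}(C_\phi)=\{f\in L^2(\mu): f\circ\phi\in L^2(\mu)\}$, $C_\phi f=f\circ\phi$. $\mathsf{h}_\phi\colon X\to[0,\infty]$ is the Radon–Nikodym derivative of $\Delta\mapsto\mu(\phi^{-1}(\Delta))$ with respect to $\mu$. When $\mathsf{h}_\phi<\infty$ a.e. $[\mu]$ (which holds when $C_\phi$ is densely defined), $\mu$ restricted to $\phi^{-1}(\mathscr{A})=\{\phi^{-1}(\Delta):\Delta\in\mathscr{A}\}$ is $\sigma$-finite and, for every $\mathscr{A}$-measurable $f\colon X\to[0,\infty]$, the conditional expectation $\mathsf{E}(f)$ is the (a.e. unique) $\phi^{-1}(\mathscr{A})$-measurable function $X\to[0,\infty]$ with $\int_X (g\circ\phi) f\,\mathrm{d}\mu=\int_X (g\circ\phi)\mathsf{E}(f)\,\mathrm{d}\mu$ for all $\mathscr{A}$-measurable $g\colon X\to[0,\infty]$;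 $\mathsf{E}(f)\circ\phi^{-1}$ denotes the (a.e. unique) $\mathscr{A}$-measurable $g\colon X\to[0,\infty]$ with $g=0$ a.e. on $\{\mathsf{h}_\phi=0\}$ and $\mathsf{E}(f)=g\circ\phi$ a.e. $[\mu]$. An $\mathscr{A}$-measurable family of probability measures $P\colon X\times\Sigma\to[0,1]$ means: $P(x,\cdot)$ is a probability measure for each $x\in X$ and $P(\cdot,\sigma)$ is $\mathscr{A}$-measurable for each $\sigma\in\Sigma$. A densely defined operator $S$ in a Hilbert space $\mathcal{H}$ is subnormal if there exist a Hilbert space $\mathcal{K}\supseteq\mathcal{H}$ (isometric embedding) and a normal operator $N$ in $\mathcal{K}$ with $\mathcal{D}(S)\subseteq\mathcal{D}(N)$ and $Sf=Nf$ for $f\in\mathcal{D}(S)$. A closed densely defined operator $A$ with polar decomposition $A=U|A|$ is quasinormal if $U|A|\subseteq|A|U$. *)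

theory Defs
  imports "HOL-Probability.Probability"
begin

record 'v hilbert =
  hcarrier :: "'v set"
  hadd :: "'v \<Rightarrow> 'v \<Rightarrow> 'v"
  hscale :: "complex \<Rightarrow> 'v \<Rightarrow> 'v"
  hzero :: 'v
  hinner :: "'v \<Rightarrow> 'v \<Rightarrow> complex"

definition hnorm :: "'v hilbert \<Rightarrow> 'v \<Rightarrow> real" where
  "hnorm H x = sqrt (Re (hinner H x x))"

definition hdiff :: "'v hilbert \<Rightarrow> 'v \<Rightarrow> 'v \<Rightarrow> 'v" where
  "hdiff H x y = hadd H x (hscale H (-1) y)"

definition hconv :: "'v hilbert \<Rightarrow> (nat \<Rightarrow> 'v) \<Rightarrow> 'v \<Rightarrow> bool" where
  "hconv H s x \<longleftrightarrow> (\<lambda>n. hnorm H (hdiff H (s n) x)) \<longlonglongrightarrow> 0"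

definition is_hilbert :: "'v hilbert \<Rightarrow> bool" where
  "is_hilbert H \<longleftrightarrow>
     hzero H \<in> hcarrier H \<and>
     (\<forall>x\<in>hcarrier H. \<forall>y\<in>hcarrier H. hadd H x y \<in> hcarrier H) \<and>
     (\<forall>a. \<forall>x\<in>hcarrier H. hscale H a x \<in> hcarrier H) \<and>
     (\<forall>x\<in>hcarrier H. \<forall>y\<in>hcarrier H. \<forall>z\<in>hcarrier H.
        hadd H (hadd H x y) z = hadd H x (hadd H y z)) \<and>
     (\<forall>x\<in>hcarrier H. \<forall>y\<in>hcarrier H. hadd H x y = hadd H y x) \<and>
     (\<forall>x\<in>hcarrier H. hadd H x (hzero H) = x) \<and>
     (\<forall>x\<in>hcarrier H. hadd H x (hscale H (-1) x) = hzero H) \<and>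
     (\<forall>x\<in>hcarrier H. hscale H 1 x = x) \<and>
     (\<forall>a b. \<forall>x\<in>hcarrier H. hscale H a (hscale H b x) = hscale H (a * b) x) \<and>
     (\<forall>a b. \<forall>x\<in>hcarrier H. hscale H (a + b) x = hadd H (hscale H a x) (hscale H b x)) \<and>
     (\<forall>a. \<forall>x\<in>hcarrier H. \<forall>y\<in>hcarrier H.
        hscale H a (hadd H x y) = hadd H (hscale H a x) (hscale H a y)) \<and>
     (\<forall>x\<in>hcarrier H. \<forall>y\<in>hcarrier H. \<forall>z\<in>hcarrier H.
        hinner H (hadd H x y) z = hinner H x z + hinner H y z) \<and>
     (\<forall>a. \<forall>x\<in>hcarrier H. \<forall>y\<in>hcarrier H. hinner H (hscale H a x) y = a * hinner H x y) \<and>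
     (\<forall>x\<in>hcarrier H. \<forall>y\<in>hcarrier H. hinner H y x = cnj (hinner H x y)) \<and>
     (\<forall>x\<in>hcarrier H. 0 \<le> Re (hinner H x x)) \<and>
     (\<forall>x\<in>hcarrier H. hinner H x x = 0 \<longrightarrow> x = hzero H) \<and>
     (\<forall>s. (\<forall>n. s n \<in> hcarrier H) \<and>
          (\<forall>e>0. \<exists>N. \<forall>m\<ge>N. \<forall>n\<ge>N. hnorm H (hdiff H (s m) (s n)) < e)
          \<longrightarrow> (\<exists>x\<in>hcarrier H. hconv H s x))"

text \<open>An operator in H: a pair (domain, action); the action only matters on the domain.\<close>
type_synonym 'v lop = "'v set \<times> ('v \<Rightarrow> 'v)"

abbreviation odom :: "'v lop \<Rightarrow> 'v set" where "odom A \<equiv> fst A"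
abbreviation oapp :: "'v lop \<Rightarrow> 'v \<Rightarrow> 'v" where "oapp A \<equiv> snd A"

definition is_operator :: "'v hilbert \<Rightarrow> 'v lop \<Rightarrow> bool" where
  "is_operator H A \<longleftrightarrow>
     odom A \<subseteq> hcarrier H \<and> hzero H \<in> odom A \<and>
     (\<forall>f\<in>odom A. \<forall>g\<in>odom A. hadd H f g \<in> odom A) \<and>
     (\<forall>a. \<forall>f\<in>odom A. hscale H a f \<in> odom A) \<and>
     (\<forall>f\<in>odom A. oapp A f \<in> hcarrier H) \<and>
     (\<forall>f\<in>odom A. \<forall>g\<in>odom A. oapp A (hadd H f g) = hadd H (oapp A f) (oapp A g)) \<and>
     (\<forall>a. \<forall>f\<in>odom A. oapp A (hscale H a f) = hscale H a (oapp A f))"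

definition hdense :: "'v hilbert \<Rightarrow> 'v set \<Rightarrow> bool" where
  "hdense H S \<longleftrightarrow> S \<subseteq> hcarrier H \<and>
     (\<forall>x\<in>hcarrier H. \<forall>e>0. \<exists>y\<in>S. hnorm H (hdiff H x y) < e)"

definition densely_defined :: "'v hilbert \<Rightarrow> 'v lop \<Rightarrow> bool" where
  "densely_defined H A \<longleftrightarrow> is_operator H A \<and> hdense H (odom A)"

definition hclosed :: "'v hilbert \<Rightarrow> 'v lop \<Rightarrow> bool" where
  "hclosed H A \<longleftrightarrow>
     (\<forall>s x y. (\<forall>n. s n \<in> odom A) \<and> x \<in> hcarrier H \<and> y \<in> hcarrier H \<and>
        hconv H s x \<and> hconv H (\<lambda>n. oapp A (s n)) y \<longrightarrow> x \<in> odom A \<and> oapp A x = y)"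

definition hadjoint :: "'v hilbert \<Rightarrow> 'v lop \<Rightarrow> 'v lop" where
  "hadjoint H A =
     ({g\<in>hcarrier H. \<exists>h\<in>hcarrier H. \<forall>f\<in>odom A. hinner H (oapp A f) g = hinner H f h},
      \<lambda>g. THE h. h \<in> hcarrier H \<and> (\<forall>f\<in>odom A. hinner H (oapp A f) g = hinner H f h))"

definition op_comp :: "'v lop \<Rightarrow> 'v lop \<Rightarrow> 'v lop" where
  "op_comp A B = ({f\<in>odom B. oapp B f \<in> odom A}, \<lambda>f. oapp A (oapp B f))"

definition op_eq :: "'v lop \<Rightarrow> 'v lop \<Rightarrow> bool" where
  "op_eq A B \<longleftrightarrow> odom A = odom B \<and> (\<forall>f\<in>odom A. oapp A f = oapp B f)"

definition op_sub :: "'v lop \<Rightarrow> 'v lop \<Rightarrow> bool" where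
  "op_sub A B \<longleftrightarrow> odom A \<subseteq> odom B \<and> (\<forall>f\<in>odom A. oapp B f = oapp A f)"

definition hnormal :: "'v hilbert \<Rightarrow> 'v lop \<Rightarrow> bool" where
  "hnormal H N \<longleftrightarrow> densely_defined H N \<and> hclosed H N \<and>
     op_eq (op_comp (hadjoint H N) N) (op_comp N (hadjoint H N))"

definition hselfadjoint :: "'v hilbert \<Rightarrow> 'v lop \<Rightarrow> bool" where
  "hselfadjoint H A \<longleftrightarrow> densely_defined H A \<and> op_eq (hadjoint H A) A"

definition hpositive :: "'v hilbert \<Rightarrow> 'v lop \<Rightarrow> bool" where
  "hpositive H A \<longleftrightarrow> (\<forall>f\<in>odom A. 0 \<le> Re (hinner H (oapp A f) f))"

text \<open>The modulus |A| = (A*A)^(1/2): the unique positive selfadjoint B with B B = A* A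
  (normalised to be zero off its domain, so that it is unique as a pair).\<close>
definition hmodulus :: "'v hilbert \<Rightarrow> 'v lop \<Rightarrow> 'v lop" where
  "hmodulus H A = (THE B. hselfadjoint H B \<and> hpositive H B \<and>
      op_eq (op_comp B B) (op_comp (hadjoint H A) A) \<and>
      (\<forall>f. f \<notin> odom B \<longrightarrow> oapp B f = hzero H))"

definition hkernel :: "'v hilbert \<Rightarrow> 'v lop \<Rightarrow> 'v set" where
  "hkernel H A = {f\<in>odom A. oapp A f = hzero H}"

definition hpartial_isometry :: "'v hilbert \<Rightarrow> 'v lop \<Rightarrow> bool" where
  "hpartial_isometry H U \<longleftrightarrow> is_operator H U \<and> odom U = hcarrier H \<and>
     (\<forall>f\<in>hcarrier H. (\<forall>g\<in>hkernel H U. hinner H f g = 0) \<longrightarrow>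
        hnorm H (oapp U f) = hnorm H f)"

definition hquasinormal :: "'v hilbert \<Rightarrow> 'v lop \<Rightarrow> bool" where
  "hquasinormal H A \<longleftrightarrow> densely_defined H A \<and> hclosed H A \<and>
     (\<exists>U. hpartial_isometry H U \<and> hkernel H U = hkernel H A \<and>
        op_eq A (op_comp U (hmodulus H A)) \<and>
        op_sub (op_comp U (hmodulus H A)) (op_comp (hmodulus H A) U))"

definition hiso_embed :: "'v hilbert \<Rightarrow> 'w hilbert \<Rightarrow> ('v \<Rightarrow> 'w) \<Rightarrow> bool" where
  "hiso_embed H K V \<longleftrightarrow>
     (\<forall>x\<in>hcarrier H. V x \<in> hcarrier K) \<and>
     (\<forall>x\<in>hcarrier H. \<forall>y\<in>hcarrier H. V (hadd H x y) = hadd K (V x) (V y)) \<and>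
     (\<forall>a. \<forall>x\<in>hcarrier H. V (hscale H a x) = hscale K a (V x)) \<and>
     (\<forall>x\<in>hcarrier H. \<forall>y\<in>hcarrier H. hinner K (V x) (V y) = hinner H x y)"

definition hsubnormal :: "'k itself \<Rightarrow> 'v hilbert \<Rightarrow> 'v lop \<Rightarrow> bool" where
  "hsubnormal _ H S \<longleftrightarrow> densely_defined H S \<and>
     (\<exists>(K::'k hilbert) V N. is_hilbert K \<and> hiso_embed H K V \<and> hnormal K N \<and>
        V ` odom S \<subseteq> odom N \<and> (\<forall>f\<in>odom S. oapp N (V f) = V (oapp S f)))"

definition l2class :: "'a measure \<Rightarrow> ('a \<Rightarrow> complex) \<Rightarrow> ('a \<Rightarrow> complex) set" where
  "l2class M f = {g \<in> borel_measurable M. AE x in M. g x = f x}"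

definition l2rep :: "('a \<Rightarrow> complex) set \<Rightarrow> 'a \<Rightarrow> complex" where
  "l2rep c = (SOME f. f \<in> c)"

definition L2 :: "'a measure \<Rightarrow> ('a \<Rightarrow> complex) set hilbert" where
  "L2 M = \<lparr> hcarrier = {l2class M f | f. f \<in> borel_measurable M \<and>
                 (\<integral>\<^sup>+ x. ennreal ((cmod (f x))\<^sup>2) \<partial>M) < \<infinity>},
            hadd = (\<lambda>c d. l2class M (\<lambda>x. l2rep c x + l2rep d x)),
            hscale = (\<lambda>a c. l2class M (\<lambda>x. a * l2rep c x)),
            hzero = l2class M (\<lambda>x. 0),
            hinner = (\<lambda>c d. \<integral> x. l2rep c x * cnj (l2rep d x) \<partial>M) \<rparr>"

definition nonsingular :: "'a measure \<Rightarrow> ('a \<Rightarrow> 'a) \<Rightarrow> bool" where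
  "nonsingular M \<phi> \<longleftrightarrow> \<phi> \<in> measurable M M \<and>
     (\<forall>\<Delta>\<in>sets M. emeasure M \<Delta> = 0 \<longrightarrow> emeasure M (\<phi> -` \<Delta> \<inter> space M) = 0)"

definition comp_op :: "'a measure \<Rightarrow> ('a \<Rightarrow> 'a) \<Rightarrow> ('a \<Rightarrow> complex) set lop" where
  "comp_op M \<phi> =
     ({c \<in> hcarrier (L2 M). l2class M (\<lambda>x. l2rep c (\<phi> x)) \<in> hcarrier (L2 M)},
      \<lambda>c. l2class M (\<lambda>x. l2rep c (\<phi> x)))"

definition hphi :: "'a measure \<Rightarrow> ('a \<Rightarrow> 'a) \<Rightarrow> 'a \<Rightarrow> ennreal" where
  "hphi M \<phi> = RN_deriv M (distr M M \<phi>)"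

definition cond_exp_phi :: "'a measure \<Rightarrow> ('a \<Rightarrow> 'a) \<Rightarrow> ('a \<Rightarrow> ennreal) \<Rightarrow> 'a \<Rightarrow> ennreal" where
  "cond_exp_phi M \<phi> f = (SOME e. e \<in> borel_measurable (vimage_algebra (space M) \<phi> M) \<and>
     (\<forall>g\<in>borel_measurable M. (\<integral>\<^sup>+ x. g (\<phi> x) * f x \<partial>M) = (\<integral>\<^sup>+ x. g (\<phi> x) * e x \<partial>M)))"

definition cond_exp_inv :: "'a measure \<Rightarrow> ('a \<Rightarrow> 'a) \<Rightarrow> ('a \<Rightarrow> ennreal) \<Rightarrow> 'a \<Rightarrow> ennreal" where
  "cond_exp_inv M \<phi> f = (SOME g. g \<in> borel_measurable M \<and>
     (AE x in M. hphi M \<phi> x = 0 \<longrightarrow> g x = 0) \<and>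
     (AE x in M. cond_exp_phi M \<phi> f x = g (\<phi> x)))"

text \<open>Division on [0,\<infinity>] with the conventions 1/0 = \<infinity>, 0/0 = 1.\<close>
definition ediv :: "ennreal \<Rightarrow> ennreal \<Rightarrow> ennreal" where
  "ediv a b = (if a = 0 \<and> b = 0 then 1 else a / b)"

definition prob_family :: "'a measure \<Rightarrow> 't measure \<Rightarrow> ('a \<Rightarrow> 't measure) \<Rightarrow> bool" where
  "prob_family M T P \<longleftrightarrow>
     (\<forall>x\<in>space M. prob_space (P x) \<and> sets (P x) = sets T) \<and>
     (\<forall>\<sigma>\<in>sets T. (\<lambda>x. emeasure (P x) \<sigma>) \<in> borel_measurable M)"

definition cond_i :: "'a measure \<Rightarrow> ('a \<Rightarrow> 'a) \<Rightarrow> 't measure \<Rightarrow> ('a \<Rightarrow> 't measure)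
    \<Rightarrow> ('t \<Rightarrow> ennreal) \<Rightarrow> bool" where
  "cond_i M \<phi> T P \<zeta> \<longleftrightarrow> (\<forall>\<sigma>\<in>sets T. AE x in M.
     hphi M \<phi> x * cond_exp_inv M \<phi> (\<lambda>y. emeasure (P y) \<sigma>) x = (\<integral>\<^sup>+ t\<in>\<sigma>. \<zeta> t \<partial>(P x)))"

definition cond_ii :: "'a measure \<Rightarrow> ('a \<Rightarrow> 'a) \<Rightarrow> 't measure \<Rightarrow> ('a \<Rightarrow> 't measure)
    \<Rightarrow> ('t \<Rightarrow> ennreal) \<Rightarrow> bool" where
  "cond_ii M \<phi> T P \<zeta> \<longleftrightarrow> (\<forall>\<sigma>\<in>sets T. AE x in M.
     cond_exp_phi M \<phi> (\<lambda>y. emeasure (P y) \<sigma>) x =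
       ediv (\<integral>\<^sup>+ t\<in>\<sigma>. \<zeta> t \<partial>(P (\<phi> x))) (hphi M \<phi> (\<phi> x)))
   \<and> inj_on (oapp (comp_op M \<phi>)) (odom (comp_op M \<phi>))"

definition rho_prop :: "'a measure \<Rightarrow> 't measure \<Rightarrow> ('a \<Rightarrow> 't measure) \<Rightarrow> ('a \<times> 't) measure \<Rightarrow> bool" where
  "rho_prop M T P \<rho> \<longleftrightarrow> sets \<rho> = sets (M \<Otimes>\<^sub>M T) \<and>
     (\<forall>\<Delta>\<in>sets M. \<forall>\<sigma>\<in>sets T. emeasure \<rho> (\<Delta> \<times> \<sigma>) = (\<integral>\<^sup>+ x\<in>\<Delta>. emeasure (P x) \<sigma> \<partial>M))"

definition embedU :: "('a \<times> 't) measure \<Rightarrow> ('a \<Rightarrow> complex) set \<Rightarrow> ('a \<times> 't \<Rightarrow> complex) set" where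
  "embedU \<rho> c = l2class \<rho> (\<lambda>(x, t). l2rep c x)"

end

theory Submission
  imports Defs
begin

text \<open>Condition (i) says that the pushforward of $\rho$ under $\Phi$ is $\zeta(t)\,d\rho$, and it forces
  $0 < \zeta < \infty$ almost everywhere with respect to $\rho$. As $\zeta$ does not depend on the
  first coordinate, it is $\Phi$-invariant; hence the modulus of $C_\Phi$ is multiplication by
  $\sqrt{\zeta}$ and $C_\Phi = VS$ with $S = |C_\Phi|$ and the isometry
  $Vf = (f \circ \Phi)/\sqrt{\zeta}$, which commutes with $S$. Thus $C_\Phi$ is quasinormal, and the
  Halmos dilation of $V$ turns $S \oplus S$ into a normal extension on $L^2(\rho) \oplus L^2(\rho)$.\<close>

section \<open>Operators in abstract Hilbert spaces\<close>

text \<open>The modulus is defined as the unique positive selfadjoint square root of A*A.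
  Recognising multiplication by sqrt \<zeta> as the modulus therefore requires uniqueness among all
  positive square roots, not only among multiplication operators; a competing root is controlled
  through the resolvent (1 + \<zeta>)^(-1), which is itself a bounded multiplication operator. Two
  further obstacles shape the proof. The statement fixes the type of the vectors of the extension
  space to sets of functions on X x T, so two copies of L2(\<rho>) have to be coded injectively into
  that one type. And E(f) and its factor through \<phi> are arbitrary choices, which mean something
  only once existence is known; existence rests on h < \<infinity> a.e., and this has to be
  extracted from the density of the domain of the composition operator.\<close>

locale hilb =
  fixes H :: "'v hilbert"
  assumes hilb: "is_hilbert H"
begin

lemma
  zero_closed [simp]: "hzero H \<in> hcarrier H" and
  add_closed_ax: "\<forall>x\<in>hcarrier H. \<forall>y\<in>hcarrier H. hadd H x y \<in> hcarrier H" and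
  scale_closed_ax: "\<forall>a. \<forall>x\<in>hcarrier H. hscale H a x \<in> hcarrier H" and
  add_assoc_ax: "\<forall>x\<in>hcarrier H. \<forall>y\<in>hcarrier H. \<forall>z\<in>hcarrier H.
     hadd H (hadd H x y) z = hadd H x (hadd H y z)" and
  add_commute_ax: "\<forall>x\<in>hcarrier H. \<forall>y\<in>hcarrier H. hadd H x y = hadd H y x" and
  add_zero_ax: "\<forall>x\<in>hcarrier H. hadd H x (hzero H) = x" and
  add_neg_ax: "\<forall>x\<in>hcarrier H. hadd H x (hscale H (-1) x) = hzero H" and
  inner_add_ax: "\<forall>x\<in>hcarrier H. \<forall>y\<in>hcarrier H. \<forall>z\<in>hcarrier H.
     hinner H (hadd H x y) z = hinner H x z + hinner H y z" and
  inner_scale_ax: "\<forall>a. \<forall>x\<in>hcarrier H. \<forall>y\<in>hcarrier H. hinner H (hscale H a x) y = a * hinner H x y" and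
  inner_commute_ax: "\<forall>x\<in>hcarrier H. \<forall>y\<in>hcarrier H. hinner H y x = cnj (hinner H x y)" and
  inner_ge_0_ax: "\<forall>x\<in>hcarrier H. 0 \<le> Re (hinner H x x)" and
  inner_eq_0_ax: "\<forall>x\<in>hcarrier H. hinner H x x = 0 \<longrightarrow> x = hzero H" and
  complete_ax: "\<forall>s. (\<forall>n. s n \<in> hcarrier H) \<and>
      (\<forall>e>0. \<exists>N. \<forall>m\<ge>N. \<forall>n\<ge>N. hnorm H (hdiff H (s m) (s n)) < e)
      \<longrightarrow> (\<exists>x\<in>hcarrier H. hconv H s x)"
  using hilb unfolding is_hilbert_def by - (elim conjE, assumption)+

lemmas add_closed [simp] = add_closed_ax[rule_format]
  and scale_closed [simp] = scale_closed_ax[rule_format]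
  and add_assoc = add_assoc_ax[rule_format]
  and add_commute = add_commute_ax[rule_format]
  and add_zero = add_zero_ax[rule_format]
  and add_neg = add_neg_ax[rule_format]
  and inner_add_left [simp] = inner_add_ax[rule_format]
  and inner_scale_left [simp] = inner_scale_ax[rule_format]
  and inner_commute = inner_commute_ax[rule_format]
  and inner_ge_0 = inner_ge_0_ax[rule_format]
  and inner_eq_0 = inner_eq_0_ax[rule_format]

lemma complete:
  assumes "\<And>n. s n \<in> hcarrier H"
    and "\<And>e. e > 0 \<Longrightarrow> \<exists>N. \<forall>m\<ge>N. \<forall>n\<ge>N. hnorm H (hdiff H (s m) (s n)) < e"
  shows "\<exists>x\<in>hcarrier H. hconv H s x"
  using complete_ax assms by blast

lemma diff_closed [simp]: "x \<in> hcarrier H \<Longrightarrow> y \<in> hcarrier H \<Longrightarrow> hdiff H x y \<in> hcarrier H"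
  by (simp add: hdiff_def)

lemma inner_add_right [simp]: "x \<in> hcarrier H \<Longrightarrow> y \<in> hcarrier H \<Longrightarrow> z \<in> hcarrier H \<Longrightarrow>
    hinner H z (hadd H x y) = hinner H z x + hinner H z y"
  by (metis inner_commute inner_add_left add_closed complex_cnj_add)

lemma inner_scale_right [simp]: "x \<in> hcarrier H \<Longrightarrow> y \<in> hcarrier H \<Longrightarrow>
    hinner H x (hscale H a y) = cnj a * hinner H x y"
  by (metis inner_commute inner_scale_left scale_closed complex_cnj_mult)

lemma inner_diff_left [simp]: "x \<in> hcarrier H \<Longrightarrow> y \<in> hcarrier H \<Longrightarrow> z \<in> hcarrier H \<Longrightarrow>
    hinner H (hdiff H x y) z = hinner H x z - hinner H y z"
  by (simp add: hdiff_def)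

lemma inner_diff_right [simp]: "x \<in> hcarrier H \<Longrightarrow> y \<in> hcarrier H \<Longrightarrow> z \<in> hcarrier H \<Longrightarrow>
    hinner H z (hdiff H x y) = hinner H z x - hinner H z y"
  by (simp add: hdiff_def)

lemma inner_zero_left [simp]: "x \<in> hcarrier H \<Longrightarrow> hinner H (hzero H) x = 0"
  using add_neg[of x] inner_diff_left[of x x x] by (simp add: hdiff_def)

lemma inner_zero_right [simp]: "x \<in> hcarrier H \<Longrightarrow> hinner H x (hzero H) = 0"
  using add_neg[of x] inner_diff_right[of x x x] by (simp add: hdiff_def)

lemma diff_eq_zero: 
  assumes "x \<in> hcarrier H" "y \<in> hcarrier H" "hdiff H x y = hzero H" shows "x = y"
proof -
  have "x = hadd H x (hadd H (hscale H (-1) y) y)"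
    using assms by (simp add: add_neg add_zero add_commute[of _ y])
  also have "\<dots> = hadd H (hdiff H x y) y"
    using assms(1,2) by (simp add: add_assoc hdiff_def)
  also have "\<dots> = y"
    using assms by (simp add: add_commute[of _ y] add_zero)
  finally show ?thesis .
qed

text \<open>The difference is orthogonal to itself. Vector identities thereby become scalar
  identities that simplification can close, and several vector space laws are recovered in this way
  below.\<close>

lemma inner_ext:
  assumes "x \<in> hcarrier H" "y \<in> hcarrier H"
    and "\<And>z. z \<in> hcarrier H \<Longrightarrow> hinner H x z = hinner H y z"
  shows "x = y"
proof (rule diff_eq_zero[OF assms(1,2)], rule inner_eq_0)
  show "hdiff H x y \<in> hcarrier H" using assms(1,2) by simp
  then show "hinner H (hdiff H x y) (hdiff H x y) = 0"
    using assms(3)[of "hdiff H x y"] assms(1,2) by (subst inner_diff_left) simp_all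
qed

lemma scale_one: "x \<in> hcarrier H \<Longrightarrow> hscale H 1 x = x"
  by (rule inner_ext) simp_all

lemma scale_scale: "x \<in> hcarrier H \<Longrightarrow> hscale H a (hscale H b x) = hscale H (a * b) x"
  by (rule inner_ext) simp_all

lemma scale_add_left: "x \<in> hcarrier H \<Longrightarrow>
    hscale H (a + b) x = hadd H (hscale H a x) (hscale H b x)"
  by (rule inner_ext) (simp_all add: distrib_right)

lemma scale_add_right: "x \<in> hcarrier H \<Longrightarrow> y \<in> hcarrier H \<Longrightarrow>
    hscale H a (hadd H x y) = hadd H (hscale H a x) (hscale H a y)"
  by (rule inner_ext) (simp_all add: distrib_left)

lemma Im_inner_self [simp]: "x \<in> hcarrier H \<Longrightarrow> Im (hinner H x x) = 0"
  using arg_cong[OF inner_commute[of x x], of Im] by simp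

lemma norm_ge_0 [simp]: "x \<in> hcarrier H \<Longrightarrow> 0 \<le> hnorm H x"
  by (simp add: hnorm_def inner_ge_0)

lemma norm_sq: "x \<in> hcarrier H \<Longrightarrow> (hnorm H x)\<^sup>2 = Re (hinner H x x)"
  by (simp add: hnorm_def inner_ge_0)

lemma inner_self: "x \<in> hcarrier H \<Longrightarrow> hinner H x x = of_real ((hnorm H x)\<^sup>2)"
  by (simp add: norm_sq complex_eq_iff)

lemma norm_eq_0: "x \<in> hcarrier H \<Longrightarrow> hnorm H x = 0 \<longleftrightarrow> x = hzero H"
  using inner_self[of x] inner_eq_0[of x] by (auto simp: hnorm_def)

lemma cauchy_schwarz:
  assumes "x \<in> hcarrier H" "y \<in> hcarrier H"
  shows "cmod (hinner H x y) \<le> hnorm H x * hnorm H y"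
proof (cases "hnorm H y = 0")
  case True
  then show ?thesis using assms by (simp add: norm_eq_0)
next
  case False
  define n where "n = (hnorm H y)\<^sup>2"
  have n: "n > 0" using False by (simp add: n_def)
  \<comment> \<open>Coefficient of the orthogonal projection of x onto the line spanned by
    y.\<close>
  define a where "a = hinner H x y / of_real n"
  have yy: "hinner H y y = of_real n" using assms by (simp add: inner_self n_def)
  have yx: "hinner H y x = cnj (hinner H x y)" using assms inner_commute by blast
  have "0 \<le> Re (hinner H (hdiff H x (hscale H a y)) (hdiff H x (hscale H a y)))"
    using assms by (intro inner_ge_0) simp
  also have "hinner H (hdiff H x (hscale H a y)) (hdiff H x (hscale H a y))
      = hinner H x x - cnj a * hinner H x y - a * cnj (hinner H x y) + a * cnj a * of_real n"
    using assms by (simp add: yy yx algebra_simps)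
  also have "\<dots> = hinner H x x - hinner H x y * cnj (hinner H x y) / of_real n"
    using n by (simp add: a_def field_simps)
  also have "Re \<dots> = (hnorm H x)\<^sup>2 - (cmod (hinner H x y))\<^sup>2 / n"
    using assms by (simp add: norm_sq flip: complex_norm_square of_real_power)
  finally have "(cmod (hinner H x y))\<^sup>2 \<le> (hnorm H x)\<^sup>2 * (hnorm H y)\<^sup>2"
    using n by (simp add: field_simps n_def)
  then show ?thesis
    using assms by (metis norm_ge_0 mult_nonneg_nonneg power_mult_distrib power2_le_imp_le)
qed

lemma conv_inner:
  assumes "\<And>n. s n \<in> hcarrier H" "x \<in> hcarrier H" "y \<in> hcarrier H" "hconv H s x"
  shows "(\<lambda>n. hinner H (s n) y) \<longlonglongrightarrow> hinner H x y"
proof -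
  have "(\<lambda>n. hinner H (s n) y - hinner H x y) \<longlonglongrightarrow> 0"
  proof (rule Lim_null_comparison)
    show "\<forall>\<^sub>F n in sequentially. norm (hinner H (s n) y - hinner H x y)
        \<le> hnorm H (hdiff H (s n) x) * hnorm H y"
      using assms cauchy_schwarz[of "hdiff H (s _) x" y] by simp
    show "(\<lambda>n. hnorm H (hdiff H (s n) x) * hnorm H y) \<longlonglongrightarrow> 0"
      using assms(4) unfolding hconv_def by (rule tendsto_mult_left_zero)
  qed
  then show ?thesis by (simp add: LIM_zero_iff)
qed

lemma conv_inner_right:
  assumes "\<And>n. s n \<in> hcarrier H" "x \<in> hcarrier H" "y \<in> hcarrier H" "hconv H s x"
  shows "(\<lambda>n. hinner H y (s n)) \<longlonglongrightarrow> hinner H y x"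
  using tendsto_cnj[OF conv_inner[OF assms]] assms by (simp add: inner_commute[symmetric])

text \<open>The difference x = h - h' is orthogonal to D. An approximant y in D with ||x - y|| <
  ||x|| would give ||x||^2 = <x - y, x> < ||x||^2 by Cauchy-Schwarz.\<close>

lemma dense_inner_ext:
  assumes D: "hdense H D" and h: "h \<in> hcarrier H" "h' \<in> hcarrier H"
    and eq: "\<And>f. f \<in> D \<Longrightarrow> hinner H f h = hinner H f h'"
  shows "h = h'"
proof -
  let ?x = "hdiff H h h'"
  have x: "?x \<in> hcarrier H" using h by simp
  have "hnorm H ?x = 0"
  proof (rule ccontr)
    assume "hnorm H ?x \<noteq> 0"
    then have pos: "hnorm H ?x > 0" using norm_ge_0[OF x] by linarith
    then obtain y where y: "y \<in> D" "hnorm H (hdiff H ?x y) < hnorm H ?x"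
      using D x unfolding hdense_def by blast
    have yH: "y \<in> hcarrier H" using y D unfolding hdense_def by auto
    have "hinner H y ?x = 0" using eq[OF y(1)] h yH by simp
    then have "hinner H ?x ?x = hinner H (hdiff H ?x y) ?x" using x yH by simp
    then have "(hnorm H ?x)\<^sup>2 \<le> hnorm H (hdiff H ?x y) * hnorm H ?x"
      using cauchy_schwarz[of "hdiff H ?x y" ?x] x yH inner_self[OF x]
      by (metis abs_power2 diff_closed norm_of_real)
    then show False using y(2) pos by (simp add: power2_eq_square)
  qed
  then show ?thesis using x h by (auto simp: norm_eq_0 intro: diff_eq_zero)
qed

section \<open>Adjoints and selfadjoint operators\<close>

text \<open>Density of the domain makes h unique, so the definite description in
  \<open>hadjoint\<close> denotes it.\<close>

lemma adjoint_value:
  assumes "hdense H (odom A)" "g \<in> hcarrier H" "h \<in> hcarrier H"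
    and "\<And>f. f \<in> odom A \<Longrightarrow> hinner H (oapp A f) g = hinner H f h"
  shows "g \<in> odom (hadjoint H A)" "oapp (hadjoint H A) g = h"
proof -
  show "g \<in> odom (hadjoint H A)" using assms by (auto simp: hadjoint_def)
  have "(THE h. h \<in> hcarrier H \<and> (\<forall>f\<in>odom A. hinner H (oapp A f) g = hinner H f h)) = h"
    using assms by (intro the_equality) (auto intro!: dense_inner_ext[OF assms(1)])
  then show "oapp (hadjoint H A) g = h" by (simp add: hadjoint_def)
qed

lemma adjointE:
  assumes "hdense H (odom A)" "g \<in> odom (hadjoint H A)"
  shows "g \<in> hcarrier H" "oapp (hadjoint H A) g \<in> hcarrier H"
    "f \<in> odom A \<Longrightarrow> hinner H (oapp A f) g = hinner H f (oapp (hadjoint H A) g)"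
proof -
  obtain h where h: "g \<in> hcarrier H" "h \<in> hcarrier H"
      "\<And>f. f \<in> odom A \<Longrightarrow> hinner H (oapp A f) g = hinner H f h"
    using assms(2) by (auto simp: hadjoint_def)
  have "oapp (hadjoint H A) g = h" using adjoint_value[OF assms(1) h] by blast
  with h show "g \<in> hcarrier H" "oapp (hadjoint H A) g \<in> hcarrier H"
    "f \<in> odom A \<Longrightarrow> hinner H (oapp A f) g = hinner H f (oapp (hadjoint H A) g)"
    by simp_all
qed

text \<open>Eliminates the definite description: the weak equation tested on the whole domain is
  equivalent to g being in the domain with value h. Membership in a domain is later always obtained
  through this direction.\<close>

lemma selfadjoint_iff:
  "hselfadjoint H A \<longleftrightarrow> densely_defined H A \<and> (\<forall>g\<in>hcarrier H. \<forall>h\<in>hcarrier H.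
     (\<forall>f\<in>odom A. hinner H (oapp A f) g = hinner H f h) \<longleftrightarrow> g \<in> odom A \<and> oapp A g = h)"
  (is "_ \<longleftrightarrow> _ \<and> ?R")
proof (cases "densely_defined H A")
  case True
  then have D: "hdense H (odom A)" and op: "is_operator H A" by (auto simp: densely_defined_def)
  have "op_eq (hadjoint H A) A \<longleftrightarrow> ?R"
  proof
    assume eq: "op_eq (hadjoint H A) A"
    show ?R
    proof (rule ballI, rule ballI, rule iffI)
      fix g h assume gh: "g \<in> hcarrier H" "h \<in> hcarrier H"
        and "\<forall>f\<in>odom A. hinner H (oapp A f) g = hinner H f h"
      then show "g \<in> odom A \<and> oapp A g = h"
        using adjoint_value[OF D gh] eq by (auto simp: op_eq_def)
    next
      fix g h assume "g \<in> hcarrier H" "h \<in> hcarrier H" "g \<in> odom A \<and> oapp A g = h"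
      then show "\<forall>f\<in>odom A. hinner H (oapp A f) g = hinner H f h"
        using adjointE(3)[OF D, of g] eq by (auto simp: op_eq_def)
    qed
  next
    assume R: ?R
    have "g \<in> odom A \<and> oapp (hadjoint H A) g = oapp A g" if "g \<in> odom (hadjoint H A)" for g
      using adjointE[OF D that] R by metis
    moreover have "g \<in> odom (hadjoint H A)" if "g \<in> odom A" for g
      using adjoint_value[OF D, of g "oapp A g"] that R op unfolding is_operator_def by blast
    ultimately show "op_eq (hadjoint H A) A" unfolding op_eq_def by blast
  qed
  then show ?thesis using True by (auto simp: hselfadjoint_def)
qed (auto simp: hselfadjoint_def)

lemma selfadjoint_sym:
  assumes "hselfadjoint H A" "f \<in> odom A" "g \<in> odom A"
  shows "hinner H (oapp A f) g = hinner H f (oapp A g)"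
  using assms unfolding selfadjoint_iff densely_defined_def is_operator_def by blast

text \<open>The identity <Af, s n> = <f, A(s n)> passes to the limit for each fixed f, and the
  resulting weak equation puts x into the domain.\<close>

lemma selfadjoint_closed:
  assumes A: "hselfadjoint H A"
  shows "hclosed H A"
  unfolding hclosed_def
proof (intro allI impI, elim conjE)
  fix s x y assume s: "\<forall>n. s n \<in> odom A" and x: "x \<in> hcarrier H" and y: "y \<in> hcarrier H"
    and sx: "hconv H s x" and sy: "hconv H (\<lambda>n. oapp A (s n)) y"
  have op: "is_operator H A" using A by (simp add: selfadjoint_iff densely_defined_def)
  then have sub: "\<And>f. f \<in> odom A \<Longrightarrow> f \<in> hcarrier H \<and> oapp A f \<in> hcarrier H"
    by (auto simp: is_operator_def)
  have "hinner H (oapp A f) x = hinner H f y" if f: "f \<in> odom A" for f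
  proof (rule LIMSEQ_unique)
    show "(\<lambda>n. hinner H (oapp A f) (s n)) \<longlonglongrightarrow> hinner H (oapp A f) x"
      using s sub f x sx by (intro conv_inner_right) auto
    have "(\<lambda>n. hinner H f (oapp A (s n))) \<longlonglongrightarrow> hinner H f y"
      using s sub f y sy by (intro conv_inner_right) auto
    then show "(\<lambda>n. hinner H (oapp A f) (s n)) \<longlonglongrightarrow> hinner H f y"
      using selfadjoint_sym[OF A f] s by simp
  qed
  then show "x \<in> odom A \<and> oapp A x = y" using A x y unfolding selfadjoint_iff by blast
qed

end

section \<open>Everywhere defined linear maps and the adjoint of an isometry\<close>

definition hlin :: "'v hilbert \<Rightarrow> ('v \<Rightarrow> 'v) \<Rightarrow> bool" where
  "hlin H V \<longleftrightarrow> (\<forall>x\<in>hcarrier H. V x \<in> hcarrier H) \<and>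
     (\<forall>x\<in>hcarrier H. \<forall>y\<in>hcarrier H. V (hadd H x y) = hadd H (V x) (V y)) \<and>
     (\<forall>a. \<forall>x\<in>hcarrier H. V (hscale H a x) = hscale H a (V x))"

lemma hlinD:
  assumes "hlin H V" "x \<in> hcarrier H"
  shows "V x \<in> hcarrier H" "y \<in> hcarrier H \<Longrightarrow> V (hadd H x y) = hadd H (V x) (V y)"
    "V (hscale H a x) = hscale H a (V x)"
  using assms by (auto simp: hlin_def)

context hilb
begin

text \<open>The value at \<^term>\<open>g\<close> of the adjoint minimises $\|g - Vf\|$; minimising sequences are Cauchy by
  the parallelogram law.\<close>
lemma isometry_adjoint_exists:
  assumes V: "hlin H V" and iso: "\<And>x y. x \<in> hcarrier H \<Longrightarrow> y \<in> hcarrier H \<Longrightarrow>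
      hinner H (V x) (V y) = hinner H x y"
    and g: "g \<in> hcarrier H"
  shows "\<exists>f\<in>hcarrier H. \<forall>k\<in>hcarrier H. hinner H (V k) g = hinner H k f"
proof -
  note [simp] = hlinD[OF V] iso
  define q where "q f = (hnorm H (hdiff H g (V f)))\<^sup>2" for f
  have q: "of_real (q f) = hinner H g g - hinner H (V f) g - hinner H g (V f) + hinner H f f"
    if "f \<in> hcarrier H" for f
    using that g by (simp add: q_def inner_self[symmetric] del: of_real_power)
  define d where "d = Inf (q ` hcarrier H)"
  have bdd: "bdd_below (q ` hcarrier H)" by (rule bdd_belowI[of _ 0]) (auto simp: q_def)
  have dle: "d \<le> q f" if "f \<in> hcarrier H" for f
    unfolding d_def using that bdd by (intro cInf_lower) auto
  have "\<exists>f\<in>hcarrier H. q f < d + 1 / Suc n" for n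
  proof -
    have "Inf (q ` hcarrier H) < d + 1 / Suc n" by (simp add: d_def)
    then show ?thesis using cInf_lessD[of "q ` hcarrier H"] zero_closed by blast
  qed
  then obtain s where s: "\<And>n. s n \<in> hcarrier H" "\<And>n. q (s n) < d + 1 / Suc n" by metis
  \<comment> \<open>The midpoint of g - Va and g - Vb is g - V((a + b)/2), and their difference has
    norm ||a - b|| because V is isometric.\<close>
  have par: "(hnorm H (hdiff H a b))\<^sup>2 = 2 * q a + 2 * q b - 4 * q (hscale H (1/2) (hadd H a b))"
    if [simp]: "a \<in> hcarrier H" "b \<in> hcarrier H" for a b
  proof -
    have "complex_of_real ((hnorm H (hdiff H a b))\<^sup>2)
        = 2 * of_real (q a) + 2 * of_real (q b) - 4 * of_real (q (hscale H (1/2) (hadd H a b)))"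
      using g by (simp add: q inner_self[symmetric] del: of_real_power) (simp add: field_simps)
    then have "complex_of_real ((hnorm H (hdiff H a b))\<^sup>2)
        = of_real (2 * q a + 2 * q b - 4 * q (hscale H (1/2) (hadd H a b)))" by simp
    then show ?thesis using of_real_eq_iff by blast
  qed
  have "\<exists>N. \<forall>m\<ge>N. \<forall>n\<ge>N. hnorm H (hdiff H (s m) (s n)) < e" if e: "e > 0" for e
  proof -
    \<comment> \<open>Both values of q exceed d by less than 1/(N + 1) and the midpoint value is at
      least d, so the parallelogram law bounds the squared distance by 4/(N + 1).\<close>
    obtain N where N: "1 / Suc N < e\<^sup>2 / 4" using e by (meson nat_approx_posE zero_less_divide_iff zero_less_power zero_less_numeral)
    have "hnorm H (hdiff H (s m) (s n)) < e" if "m \<ge> N" "n \<ge> N" for m n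
    proof -
      have "1 / Suc m \<le> 1 / Suc N" "1 / Suc n \<le> 1 / Suc N" using that by (auto simp: field_simps)
      moreover have "d \<le> q (hscale H (1/2) (hadd H (s m) (s n)))" using s by (intro dle) simp
      ultimately have "(hnorm H (hdiff H (s m) (s n)))\<^sup>2 < e\<^sup>2"
        using par[OF s(1)[of m] s(1)[of n]] s(2)[of m] s(2)[of n] N by linarith
      then show ?thesis using e by (simp add: power_less_imp_less_base)
    qed
    then show ?thesis by blast
  qed
  then obtain f where f: "f \<in> hcarrier H" "hconv H s f" using complete[of s] s(1) by blast
  have "hinner H (V k) g = hinner H k f" if k: "k \<in> hcarrier H" for k
  proof -
    define z where "z = hinner H (V k) g - hinner H k f"
    define K where "K = (hnorm H k)\<^sup>2"
    have K: "K \<ge> 0" by (simp add: K_def)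
    \<comment> \<open>First variation: replacing s n by s n + a k cannot bring q below its infimum
      d, while q (s n) is within 1/(n + 1) of d.\<close>
    have le: "2 * Re (a * z) \<le> (cmod a)\<^sup>2 * K" for a
    proof (rule LIMSEQ_le)
      have "(\<lambda>n. hinner H (V k) g - hinner H k (s n)) \<longlonglongrightarrow> z" unfolding z_def
        using f k s by (intro tendsto_intros conv_inner_right) auto
      then show "(\<lambda>n. 2 * Re (a * (hinner H (V k) g - hinner H k (s n)))) \<longlonglongrightarrow> 2 * Re (a * z)"
        by (intro tendsto_intros)
      have "(\<lambda>n. 1 / Suc n + (cmod a)\<^sup>2 * K) \<longlonglongrightarrow> 0 + (cmod a)\<^sup>2 * K"
        by (intro tendsto_intros LIMSEQ_Suc[OF lim_1_over_n])
      then show "(\<lambda>n. 1 / Suc n + (cmod a)\<^sup>2 * K) \<longlonglongrightarrow> (cmod a)\<^sup>2 * K" by simp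
      have "2 * Re (a * (hinner H (V k) g - hinner H k (s n))) \<le> 1 / Suc n + (cmod a)\<^sup>2 * K" for n
      proof -
        let ?p = "hadd H (s n) (hscale H a k)"
        have [simp]: "s n \<in> hcarrier H" by (rule s)
        have c: "hinner H g (V k) = cnj (hinner H (V k) g)"  "hinner H (s n) k = cnj (hinner H k (s n))"
          by - (rule inner_commute; simp add: k g)+
        let ?c = "a * (hinner H (V k) g - hinner H k (s n))"
        have "complex_of_real (q ?p) = of_real (q (s n)) - ?c - cnj ?c + of_real ((cmod a)\<^sup>2 * K)"
          using k g by (simp add: q c K_def complex_norm_square inner_self[symmetric] del: of_real_power)
            (simp add: algebra_simps inner_self del: of_real_power)
        then have "q ?p = q (s n) - 2 * Re ?c + (cmod a)\<^sup>2 * K"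
          by (simp add: complex_eq_iff algebra_simps)
        moreover have "d \<le> q ?p" using k s by (intro dle) simp
        ultimately show ?thesis using s(2)[of n] by linarith
      qed
      then show "\<exists>N. \<forall>n\<ge>N. 2 * Re (a * (hinner H (V k) g - hinner H k (s n))) \<le> 1 / Suc n + (cmod a)\<^sup>2 * K"
        by blast
    qed
    have "z = 0"
    proof (rule ccontr)
      assume "z \<noteq> 0"
      then have zp: "(cmod z)\<^sup>2 > 0" by simp
      \<comment> \<open>For a = t * cnj z the bound reads 2 t |z|^2 \<le> t^2 |z|^2 K. The choice of
        t makes t K \<le> 1, which is contradictory unless z = 0.\<close>
      define t where "t = 1 / (1 + K)"
      have t: "t > 0" "t * K \<le> 1" using K by (auto simp: t_def field_simps)
      have "of_real t * cnj z * z = of_real (t * (cmod z)\<^sup>2)"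
        by (simp add: complex_norm_square del: of_real_power)
      then have re: "Re (of_real t * cnj z * z) = t * (cmod z)\<^sup>2" by (metis Re_complex_of_real)
      have "(cmod (of_real t * cnj z))\<^sup>2 = t\<^sup>2 * (cmod z)\<^sup>2"
        by (simp add: norm_mult power_mult_distrib)
      then have "2 * (t * (cmod z)\<^sup>2) \<le> t * (cmod z)\<^sup>2 * (t * K)"
        using le[of "of_real t * cnj z"] unfolding re by (simp only: power2_eq_square mult_ac)
      also have "\<dots> \<le> t * (cmod z)\<^sup>2 * 1" using t by (intro mult_left_mono) auto
      finally show False using t zp by simp
    qed
    then show ?thesis by (simp add: z_def)
  qed
  then show ?thesis using f by blast
qed

end

section \<open>Normal and quasinormal operators from commuting factors\<close>

context hilb
begin

text \<open>Since W' is both inverse and adjoint of W and commutes with S, the adjoint of W S is W'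
  S on the same domain, and both products of the two reduce to S S.\<close>

lemma unitary_selfadjoint_normal:
  assumes S: "hselfadjoint H S" and W: "hlin H W"
    and W': "\<And>x. x \<in> hcarrier H \<Longrightarrow> W' x \<in> hcarrier H"
    and inv: "\<And>x. x \<in> hcarrier H \<Longrightarrow> W (W' x) = x" "\<And>x. x \<in> hcarrier H \<Longrightarrow> W' (W x) = x"
    and adj: "\<And>x y. x \<in> hcarrier H \<Longrightarrow> y \<in> hcarrier H \<Longrightarrow> hinner H (W x) y = hinner H x (W' y)"
    and comm: "\<And>f. f \<in> odom S \<Longrightarrow> W f \<in> odom S \<and> oapp S (W f) = W (oapp S f)"
    and comm': "\<And>f. f \<in> odom S \<Longrightarrow> W' f \<in> odom S \<and> oapp S (W' f) = W' (oapp S f)"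
  shows "hnormal H (odom S, \<lambda>f. W (oapp S f))" (is "hnormal H ?N")
proof -
  have dd: "densely_defined H S" and D: "hdense H (odom S)" and op: "is_operator H S"
    using S by (auto simp: selfadjoint_iff densely_defined_def)
  have sub: "\<And>f. f \<in> odom S \<Longrightarrow> f \<in> hcarrier H" "\<And>f. f \<in> odom S \<Longrightarrow> oapp S f \<in> hcarrier H"
    using op by (auto simp: is_operator_def)
  have opN: "is_operator H ?N" using op W by (auto simp: is_operator_def hlin_def)
  have WC: "W x \<in> hcarrier H" if "x \<in> hcarrier H" for x using W that by (simp add: hlin_def)
  have normW': "hnorm H (hdiff H x (W' y)) = hnorm H (hdiff H (W x) y)"
    if [simp]: "x \<in> hcarrier H" "y \<in> hcarrier H" for x y
  proof -
    have [simp]: "hinner H (W' y) x = hinner H y (W x)"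
      using inner_commute[of x "W' y"] inner_commute[of "W x" y] by (simp add: W' WC adj)
    have [simp]: "hinner H (W' y) (W' y) = hinner H y y" 
      using adj[of "W' y" y] by (simp add: W' inv)
    show ?thesis unfolding hnorm_def by (simp add: adj inv W' WC)
  qed
  have cl: "hclosed H ?N"
    unfolding hclosed_def
  proof (intro allI impI, elim conjE)
    fix s x y assume s: "\<forall>n. s n \<in> odom ?N" and x: "x \<in> hcarrier H" and y: "y \<in> hcarrier H"
      and sx: "hconv H s x" and sy: "hconv H (\<lambda>n. oapp ?N (s n)) y"
    have "hconv H (\<lambda>n. oapp S (s n)) (W' y)"
      using sy s sub y by (simp add: hconv_def normW')
    then have "x \<in> odom S \<and> oapp S x = W' y"
      using selfadjoint_closed[OF S, unfolded hclosed_def, rule_format, of s x "W' y"] s x W'[OF y] sx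
      by simp
    then show "x \<in> odom ?N \<and> oapp ?N x = y" using inv y by simp
  qed
  have adjN: "g \<in> odom (hadjoint H ?N) \<longleftrightarrow> g \<in> odom S" for g
  proof
    assume g: "g \<in> odom (hadjoint H ?N)"
    note E = adjointE[OF _ this, simplified, OF D]
    have "\<forall>f\<in>odom S. hinner H (oapp S f) (W' g) = hinner H f (oapp (hadjoint H ?N) g)"
      using E sub by (simp add: adj[symmetric])
    then have "W' g \<in> odom S" using S E W' unfolding selfadjoint_iff by blast
    then show "g \<in> odom S" using comm[of "W' g"] inv(1)[OF E(1)] by simp
  next
    assume g: "g \<in> odom S"
    show "g \<in> odom (hadjoint H ?N)"
      using g D sub W' comm' selfadjoint_sym[OF S]
      by (intro adjoint_value(1)[of _ _ "W' (oapp S g)"]) (auto simp: adj)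
  qed
  have adjN_app: "oapp (hadjoint H ?N) g = W' (oapp S g)" if "g \<in> odom S" for g
    using that D sub W' comm' selfadjoint_sym[OF S]
    by (intro adjoint_value(2)) (auto simp: adj)
  \<comment> \<open>This matches the domains of the two products: each is the domain of S S.\<close>
  have *: "W (oapp S f) \<in> odom S \<longleftrightarrow> oapp S f \<in> odom S"
      "W' (oapp S f) \<in> odom S \<longleftrightarrow> oapp S f \<in> odom S" if "f \<in> odom S" for f
    using comm comm' inv sub(2)[OF that] by metis+
  have "op_eq (op_comp (hadjoint H ?N) ?N) (op_comp ?N (hadjoint H ?N))"
    unfolding op_eq_def op_comp_def
    by (auto simp: adjN adjN_app * comm comm' inv sub)
  then show ?thesis using cl opN D by (simp add: hnormal_def densely_defined_def)
qed

text \<open>With $A = VS$ for an isometry \<^term>\<open>V\<close>, the forms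
  \<^term>\<open>hinner H (oapp A f) (oapp A g)\<close> and \<^term>\<open>hinner H (oapp S f) (oapp S g)\<close> agree, and they
  alone determine $A^*A = S^2$.\<close>
lemma quasinormalI:
  assumes S: "hselfadjoint H S" "hpositive H S" and off: "\<And>f. f \<notin> odom S \<Longrightarrow> oapp S f = hzero H"
    and unique: "\<And>B. hselfadjoint H B \<Longrightarrow> hpositive H B \<Longrightarrow>
        op_eq (op_comp B B) (op_comp S S) \<Longrightarrow> (\<And>f. f \<notin> odom B \<Longrightarrow> oapp B f = hzero H) \<Longrightarrow> B = S"
    and inj: "\<And>f. f \<in> odom S \<Longrightarrow> oapp S f = hzero H \<Longrightarrow> f = hzero H"
    and V: "hlin H V" and iso: "\<And>x y. x \<in> hcarrier H \<Longrightarrow> y \<in> hcarrier H \<Longrightarrow>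
        hinner H (V x) (V y) = hinner H x y"
    and comm: "\<And>f. f \<in> odom S \<Longrightarrow> V f \<in> odom S \<and> oapp S (V f) = V (oapp S f)"
    and A: "odom A = odom S" "\<And>f. f \<in> odom S \<Longrightarrow> oapp A f = V (oapp S f)"
  shows "hquasinormal H A"
proof -
  have D: "hdense H (odom S)" and op: "is_operator H S"
    using S by (auto simp: selfadjoint_iff densely_defined_def)
  have sub: "\<And>f. f \<in> odom S \<Longrightarrow> f \<in> hcarrier H" "\<And>f. f \<in> odom S \<Longrightarrow> oapp S f \<in> hcarrier H"
    using op by (auto simp: is_operator_def)
  have VC: "V x \<in> hcarrier H" if "x \<in> hcarrier H" for x using V that by (simp add: hlin_def)
  have opA: "is_operator H A" using op V by (auto simp: is_operator_def hlin_def A)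
  have normV: "hnorm H (hdiff H (V x) (V y)) = hnorm H (hdiff H x y)"
    if "x \<in> hcarrier H" "y \<in> hcarrier H" for x y
    using that unfolding hnorm_def by (simp add: iso VC)
  have V0: "f = hzero H" if "f \<in> hcarrier H" "V f = hzero H" for f
    using iso[of f f] that VC[of f] by (intro inner_eq_0) auto
  have V00: "V (hzero H) = hzero H"
    using iso[of "hzero H" "hzero H"] VC[of "hzero H"] by (intro inner_eq_0) auto
  have S00: "hzero H \<in> odom S \<and> oapp S (hzero H) = hzero H"
  proof -
    have "hzero H \<in> odom S" using op by (simp add: is_operator_def)
    moreover have "hscale H 0 (hzero H) = hzero H" by (rule inner_ext) auto
    moreover have "hscale H 0 x = hzero H" if "x \<in> hcarrier H" for x
      using that by (intro inner_ext) auto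
    ultimately show ?thesis using op sub unfolding is_operator_def by metis
  qed
  have cl: "hclosed H A"
    unfolding hclosed_def
  proof (intro allI impI, elim conjE)
    fix s x y assume s: "\<forall>n. s n \<in> odom A" and x: "x \<in> hcarrier H" and y: "y \<in> hcarrier H"
      and sx: "hconv H s x" and sy: "hconv H (\<lambda>n. oapp A (s n)) y"
    have sS: "s n \<in> odom S" for n using s A by simp
    obtain z where z: "z \<in> hcarrier H" "hconv H (\<lambda>n. oapp S (s n)) z"
    proof -
      have "\<exists>N. \<forall>m\<ge>N. \<forall>n\<ge>N. hnorm H (hdiff H (oapp S (s m)) (oapp S (s n))) < e" if "e > 0" for e
      proof -
        \<comment> \<open>Parallelogram law for a - y and b - y with the square of their sum
          dropped. It takes the place of the triangle inequality: A (s n) converges, hence is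
          Cauchy, and by isometry so is S (s n).\<close>
        have par: "(hnorm H (hdiff H a b))\<^sup>2 \<le> 2 * (hnorm H (hdiff H a y))\<^sup>2 + 2 * (hnorm H (hdiff H b y))\<^sup>2"
          if [simp]: "a \<in> hcarrier H" "b \<in> hcarrier H" for a b
        proof -
          have "0 \<le> Re (hinner H (hadd H (hdiff H a y) (hdiff H b y)) (hadd H (hdiff H a y) (hdiff H b y)))"
            using y by (intro inner_ge_0) simp
          then show ?thesis using y by (simp add: norm_sq)
        qed
        have "\<forall>\<^sub>F n in sequentially. hnorm H (hdiff H (oapp A (s n)) y) < e / 2"
          using sy that unfolding hconv_def by (intro order_tendstoD(2)[of _ 0]) auto
        then obtain N where N: "\<And>n. n \<ge> N \<Longrightarrow> hnorm H (hdiff H (oapp A (s n)) y) < e / 2"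
          by (auto simp: eventually_sequentially)
        have "hnorm H (hdiff H (oapp S (s m)) (oapp S (s n))) < e" if "m \<ge> N" "n \<ge> N" for m n
        proof -
          have c: "oapp A (s i) \<in> hcarrier H" for i using s opA by (auto simp: is_operator_def)
          have "(hnorm H (hdiff H (oapp A (s i)) y))\<^sup>2 < (e/2)\<^sup>2" if "i \<ge> N" for i
            using N[OF that] c y by (intro power_strict_mono) auto
          from this[OF that(1)] this[OF that(2)] par[OF c[of m] c[of n]]
          have "(hnorm H (hdiff H (oapp A (s m)) (oapp A (s n))))\<^sup>2 < e\<^sup>2"
            by (simp add: power_divide)
          then have "hnorm H (hdiff H (oapp A (s m)) (oapp A (s n))) < e"
            using \<open>e > 0\<close> by (simp add: power_less_imp_less_base)
          then show ?thesis using sS sub by (simp add: A normV)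
        qed
        then show ?thesis by blast
      qed
      then show ?thesis using complete[of "\<lambda>n. oapp S (s n)"] sub sS that by blast
    qed
    have xS: "x \<in> odom S \<and> oapp S x = z"
      using selfadjoint_closed[OF S(1)] sS x z sx unfolding hclosed_def by blast
    have Vz: "hconv H (\<lambda>n. oapp A (s n)) (V z)"
      using z sS sub by (simp add: hconv_def A normV)
    have "hinner H (V z) w = hinner H y w" if "w \<in> hcarrier H" for w
      by (rule LIMSEQ_unique[OF conv_inner[OF _ _ _ Vz] conv_inner[OF _ _ _ sy]])
        (use that y z VC sS sub in \<open>simp_all add: A\<close>)
    then have "V z = y" by (rule inner_ext[OF VC[OF z(1)] y])
    then show "x \<in> odom A \<and> oapp A x = y" using xS A by simp
  qed
  have AA: "f \<in> odom A \<and> oapp A f \<in> odom (hadjoint H A) \<longleftrightarrow> f \<in> odom S \<and> oapp S f \<in> odom S" for f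
  proof (cases "f \<in> odom S")
    case True
    have "oapp A f \<in> odom (hadjoint H A) \<longleftrightarrow> (\<exists>h\<in>hcarrier H. \<forall>k\<in>odom S. hinner H (oapp S k) (oapp S f) = hinner H k h)"
      using True sub VC by (simp add: hadjoint_def A iso)
    also have "\<dots> \<longleftrightarrow> oapp S f \<in> odom S"
      using S(1) sub True unfolding selfadjoint_iff by blast
    finally show ?thesis using True A by simp
  qed (simp add: A)
  have AA_app: "oapp (hadjoint H A) (oapp A f) = oapp S (oapp S f)"
    if "f \<in> odom S" "oapp S f \<in> odom S" for f
    using D that sub VC selfadjoint_sym[OF S(1)]
    by (intro adjoint_value(2)) (auto simp: A iso)
  have eqA: "op_eq (op_comp S S) (op_comp (hadjoint H A) A)"
    using AA AA_app by (auto simp: op_eq_def op_comp_def)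
  have mod: "hmodulus H A = S"
    unfolding hmodulus_def
  proof (rule the_equality)
    show "hselfadjoint H S \<and> hpositive H S \<and> op_eq (op_comp S S) (op_comp (hadjoint H A) A) \<and>
        (\<forall>f. f \<notin> odom S \<longrightarrow> oapp S f = hzero H)" using S off eqA by auto
    fix B assume B: "hselfadjoint H B \<and> hpositive H B \<and> op_eq (op_comp B B) (op_comp (hadjoint H A) A) \<and>
        (\<forall>f. f \<notin> odom B \<longrightarrow> oapp B f = hzero H)"
    then have "op_eq (op_comp B B) (op_comp S S)" using eqA by (auto simp: op_eq_def)
    then show "B = S" using B unique by blast
  qed
  \<comment> \<open>S is injective and V isometric, so both kernels are trivial and V on the whole
    space is the partial isometry of the polar decomposition.\<close>
  define U where "U = (hcarrier H, V)"
  have "hpartial_isometry H U"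
    using V by (auto simp: hpartial_isometry_def U_def is_operator_def hlin_def hnorm_def iso)
  moreover have "hkernel H U = hkernel H A"
  proof -
    have "hkernel H U = {hzero H}" using V0 V00 unfolding hkernel_def U_def by auto
    moreover have "hkernel H A = {hzero H}"
    proof (rule equalityI)
      have "f = hzero H" if "f \<in> hkernel H A" for f
        using that V0[of "oapp S f"] inj[of f] sub(2)[of f] unfolding hkernel_def A(1) by (auto simp: A)
      then show "hkernel H A \<subseteq> {hzero H}" by (simp only: subset_iff singleton_iff) (rule allI, rule impI)
      show "{hzero H} \<subseteq> hkernel H A" using S00 V00 unfolding hkernel_def by (simp add: A)
    qed
    ultimately show ?thesis by (rule trans[OF _ sym])
  qed
  moreover have "op_eq A (op_comp U (hmodulus H A))"
    using sub by (auto simp: op_eq_def op_comp_def mod U_def A)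
  moreover have "op_sub (op_comp U (hmodulus H A)) (op_comp (hmodulus H A) U)"
    using sub comm by (auto simp: op_sub_def op_comp_def mod U_def)
  ultimately show ?thesis
    using cl opA D unfolding hquasinormal_def densely_defined_def A(1) by blast
qed

end

section \<open>Direct sums and the unitary dilation of an isometry\<close>

text \<open>The sum is carried by the image of an injection j instead of a product type, so that it
  can be placed in a prescribed type of vectors.\<close>

definition hsum :: "'v hilbert \<Rightarrow> ('v \<times> 'v \<Rightarrow> 'k) \<Rightarrow> 'k hilbert" where
  "hsum H j = (let p = inv_into (hcarrier H \<times> hcarrier H) j in
     \<lparr> hcarrier = j ` (hcarrier H \<times> hcarrier H),
       hadd = (\<lambda>x y. j (hadd H (fst (p x)) (fst (p y)), hadd H (snd (p x)) (snd (p y)))),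
       hscale = (\<lambda>a x. j (hscale H a (fst (p x)), hscale H a (snd (p x)))),
       hzero = j (hzero H, hzero H),
       hinner = (\<lambda>x y. hinner H (fst (p x)) (fst (p y)) + hinner H (snd (p x)) (snd (p y))) \<rparr>)"

locale hilb_sum = hilb H for H :: "'v hilbert" +
  fixes j :: "'v \<times> 'v \<Rightarrow> 'k"
  assumes inj: "inj_on j (hcarrier H \<times> hcarrier H)"
begin

abbreviation "K \<equiv> hsum H j"
abbreviation "p \<equiv> inv_into (hcarrier H \<times> hcarrier H) j"

lemma p_j [simp]: "a \<in> hcarrier H \<Longrightarrow> b \<in> hcarrier H \<Longrightarrow> p (j (a, b)) = (a, b)"
  using inj by (intro inv_into_f_f) auto

lemma sum_carrier: "hcarrier K = j ` (hcarrier H \<times> hcarrier H)"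
  and sum_zero [simp]: "hzero K = j (hzero H, hzero H)"
  by (simp_all add: hsum_def Let_def)

lemma sum_j_carrier [simp]: "a \<in> hcarrier H \<Longrightarrow> b \<in> hcarrier H \<Longrightarrow> j (a, b) \<in> hcarrier K"
  by (simp add: sum_carrier)

lemma sum_j_eq: "a \<in> hcarrier H \<Longrightarrow> b \<in> hcarrier H \<Longrightarrow> c \<in> hcarrier H \<Longrightarrow> d \<in> hcarrier H \<Longrightarrow>
    j (a, b) = j (c, d) \<longleftrightarrow> a = c \<and> b = d"
  using inj by (auto simp: inj_on_def)

context
  fixes a b assumes [simp]: "a \<in> hcarrier H" "b \<in> hcarrier H"
begin

lemma sum_scale [simp]: "hscale K z (j (a, b)) = j (hscale H z a, hscale H z b)"
  by (simp add: hsum_def Let_def)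

context
  fixes c d assumes [simp]: "c \<in> hcarrier H" "d \<in> hcarrier H"
begin

lemma sum_add [simp]: "hadd K (j (a, b)) (j (c, d)) = j (hadd H a c, hadd H b d)"
  by (simp add: hsum_def Let_def)

lemma sum_inner [simp]: "hinner K (j (a, b)) (j (c, d)) = hinner H a c + hinner H b d"
  by (simp add: hsum_def Let_def)

end

lemma sum_norm: "hnorm K (j (a, b)) = sqrt ((hnorm H a)\<^sup>2 + (hnorm H b)\<^sup>2)"
  by (simp add: hnorm_def[of K] norm_sq)

end

lemma sum_diff [simp]:
  "a \<in> hcarrier H \<Longrightarrow> b \<in> hcarrier H \<Longrightarrow> c \<in> hcarrier H \<Longrightarrow> d \<in> hcarrier H \<Longrightarrow>
    hdiff K (j (a, b)) (j (c, d)) = j (hdiff H a c, hdiff H b d)"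
  by (simp add: hdiff_def)

lemma sum_hilbert: "is_hilbert K"
proof -
  have comp: "\<exists>x\<in>hcarrier K. hconv K s x" if s: "\<forall>n. s n \<in> hcarrier K"
     and cau: "\<forall>e>0. \<exists>N. \<forall>m\<ge>N. \<forall>n\<ge>N. hnorm K (hdiff K (s m) (s n)) < e" for s
  proof -
    have "\<exists>ab. fst ab \<in> hcarrier H \<and> snd ab \<in> hcarrier H \<and> s n = j ab" for n
    proof -
      have "s n \<in> j ` (hcarrier H \<times> hcarrier H)" using s sum_carrier by simp
      then obtain a b where "a \<in> hcarrier H" "b \<in> hcarrier H" "s n = j (a, b)" by auto
      then show ?thesis by (intro exI[of _ "(a, b)"]) simp
    qed
    then obtain ab where ab: "\<And>n. fst (ab n) \<in> hcarrier H \<and> snd (ab n) \<in> hcarrier H \<and> s n = j (ab n)"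
      by metis
    define a b where "a n = fst (ab n)" and "b n = snd (ab n)" for n
    have [simp]: "a n \<in> hcarrier H" "b n \<in> hcarrier H" for n using ab by (auto simp: a_def b_def)
    have sn: "s n = j (a n, b n)" for n using ab by (simp add: a_def b_def)
    have le: "hnorm H (hdiff H (a m) (a n)) \<le> hnorm K (hdiff K (s m) (s n))"
      "hnorm H (hdiff H (b m) (b n)) \<le> hnorm K (hdiff K (s m) (s n))" for m n
      by (auto simp: sn sum_norm intro!: real_le_rsqrt)
    have ca: "\<exists>N. \<forall>m\<ge>N. \<forall>n\<ge>N. hnorm H (hdiff H (a m) (a n)) < e"
      "\<exists>N. \<forall>m\<ge>N. \<forall>n\<ge>N. hnorm H (hdiff H (b m) (b n)) < e" if "e > 0" for e
      using cau that le order.strict_trans1 by meson+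
    obtain x where x: "x \<in> hcarrier H" "hconv H a x" using complete[of a] ca(1) by auto
    obtain y where y: "y \<in> hcarrier H" "hconv H b y" using complete[of b] ca(2) by auto
    have "(\<lambda>n. sqrt ((hnorm H (hdiff H (a n) x))\<^sup>2 + (hnorm H (hdiff H (b n) y))\<^sup>2)) \<longlonglongrightarrow> sqrt (0\<^sup>2 + 0\<^sup>2)"
      using x y unfolding hconv_def by (intro tendsto_intros)
    then have "hconv K s (j (x, y))"
      using x y by (simp add: hconv_def sn sum_norm)
    then show ?thesis using x y by (intro bexI[of _ "j (x, y)"]) auto
  qed
  have scale0: "x = hzero H \<and> y = hzero H" 
    if "x \<in> hcarrier H" "y \<in> hcarrier H" "hinner H x x + hinner H y y = 0" for x y
  proof -
    have "(hnorm H x)\<^sup>2 + (hnorm H y)\<^sup>2 = 0"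
      using that(3) unfolding inner_self[OF that(1)] inner_self[OF that(2)]
      by (simp only: of_real_add[symmetric] of_real_eq_0_iff)
    then show ?thesis using that norm_eq_0 by (auto simp: add_nonneg_eq_0_iff)
  qed
  have neg: "hadd H x (hscale H (-1) x) = hzero H" if "x \<in> hcarrier H" for x
    using that by (rule add_neg)
  show ?thesis
    unfolding is_hilbert_def
    using comp
    apply (intro conjI)
    apply (simp_all add: sum_carrier)
    apply (auto simp: add_assoc add_zero neg scale_one scale_scale scale_add_left
        scale_add_right inner_ge_0 algebra_simps sum_j_eq dest: scale0
        intro: add_commute)
    subgoal for x y x' y' using inner_commute[of x x'] inner_commute[of y y'] by simp
    done
qed

sublocale sum: hilb K
  by (unfold_locales) (rule sum_hilbert)

text \<open>The normal operator is $W(S \oplus S)$, where $W$ is the Halmos dilation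
  $(f, g) \mapsto (Vf + (1 - VV^*)g, V^*g)$, a unitary operator commuting with $S \oplus S$.\<close>
lemma isometry_selfadjoint_normal_extension:
  assumes S: "hselfadjoint H S" and V: "hlin H V"
    and iso: "\<And>x y. x \<in> hcarrier H \<Longrightarrow> y \<in> hcarrier H \<Longrightarrow> hinner H (V x) (V y) = hinner H x y"
    and comm: "\<And>f. f \<in> odom S \<Longrightarrow> V f \<in> odom S \<and> oapp S (V f) = V (oapp S f)"
  shows "\<exists>N. hnormal K N \<and> (\<forall>f\<in>odom S. j (f, hzero H) \<in> odom N \<and>
           oapp N (j (f, hzero H)) = j (V (oapp S f), hzero H))"
proof -
  have D: "hdense H (odom S)" and op: "is_operator H S"
    using S by (auto simp: selfadjoint_iff densely_defined_def)
  have sub [simp]: "\<And>f. f \<in> odom S \<Longrightarrow> f \<in> hcarrier H" "\<And>f. f \<in> odom S \<Longrightarrow> oapp S f \<in> hcarrier H"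
    and S_add: "\<And>f g. f \<in> odom S \<Longrightarrow> g \<in> odom S \<Longrightarrow> hadd H f g \<in> odom S \<and> oapp S (hadd H f g) = hadd H (oapp S f) (oapp S g)"
    and S_scale: "\<And>a f. f \<in> odom S \<Longrightarrow> hscale H a f \<in> odom S \<and> oapp S (hscale H a f) = hscale H a (oapp S f)"
    and zS [simp]: "hzero H \<in> odom S"
    using op by (auto simp: is_operator_def)
  have Sz [simp]: "oapp S (hzero H) = hzero H"
    using selfadjoint_sym[OF S zS] by (intro dense_inner_ext[OF D]) (auto simp: inner_commute[of "oapp S (hzero H)"])
  obtain V' where V': "\<And>g. g \<in> hcarrier H \<Longrightarrow> V' g \<in> hcarrier H"
     "\<And>g k. g \<in> hcarrier H \<Longrightarrow> k \<in> hcarrier H \<Longrightarrow> hinner H (V k) g = hinner H k (V' g)"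
    using isometry_adjoint_exists[OF V iso] by metis
  note VC = hlinD(1)[OF V]
  have V'2: "hinner H (V' g) k = hinner H g (V k)" if "g \<in> hcarrier H" "k \<in> hcarrier H" for g k
    using that V' VC by (metis inner_commute)
  have [simp]: "V' (V x) = x" if "x \<in> hcarrier H" for x
    using that by (intro inner_ext) (simp_all add: iso V'(1) V'2 VC)
  note [simp] = V' V'2 VC
  \<comment> \<open>Taking adjoints in SV = VS: <Sk, V'f> = <VSk, f> = <SVk, f> = <k, V'Sf>.
    Selfadjointness reads this weak equation as membership of V'f in the domain of S together with
    the value.\<close>
  have comm': "V' f \<in> odom S \<and> oapp S (V' f) = V' (oapp S f)" if f: "f \<in> odom S" for f
  proof -
    have "hinner H (oapp S k) (V' f) = hinner H k (V' (oapp S f))" if k: "k \<in> odom S" for k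
    proof -
      have "hinner H (oapp S k) (V' f) = hinner H (oapp S (V k)) f"
        using f k comm[OF k] by simp
      also have "\<dots> = hinner H k (V' (oapp S f))"
        using selfadjoint_sym[OF S _ f, of "V k"] f k comm[OF k] by simp
      finally show ?thesis .
    qed
    then show ?thesis
      using S f unfolding selfadjoint_iff by (metis sub V'(1))
  qed
  define W where "W x = (let (f, g) = p x in j (hadd H (V f) (hdiff H g (V (V' g))), V' g))" for x
  \<comment> \<open>Transposed block matrix of W. The identities V'V = 1 and (1 - VV')V = 0 make it
    the inverse of W, and the symmetry of 1 - VV' makes it the adjoint.\<close>
  define W' where "W' x = (let (f, g) = p x in j (V' f, hadd H (hdiff H f (V (V' f))) (V g)))" for x
  have W [simp]: "W (j (f, g)) = j (hadd H (V f) (hdiff H g (V (V' g))), V' g)"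
    and W' [simp]: "W' (j (f, g)) = j (V' f, hadd H (hdiff H f (V (V' f))) (V g))"
    if "f \<in> hcarrier H" "g \<in> hcarrier H" for f g
    using that by (simp_all add: W_def W'_def)
  define S2 where "S2 = (j ` (odom S \<times> odom S), \<lambda>x. j (oapp S (fst (p x)), oapp S (snd (p x))))"
  have S2_dom: "odom S2 = j ` (odom S \<times> odom S)" by (simp add: S2_def)
  have S2_j: "j (f, g) \<in> odom S2 \<longleftrightarrow> f \<in> odom S \<and> g \<in> odom S" if "f \<in> hcarrier H" "g \<in> hcarrier H" for f g
    using that by (auto simp: S2_dom sum_j_eq)
  have S2_app [simp]: "oapp S2 (j (f, g)) = j (oapp S f, oapp S g)" if "f \<in> odom S" "g \<in> odom S" for f g
    using that by (simp add: S2_def)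
  have opS2: "is_operator K S2"
    unfolding is_operator_def S2_dom sum_carrier by (auto simp: S_add S_scale)
  have denS2: "hdense K (odom S2)"
    unfolding hdense_def
  proof (intro conjI ballI allI impI)
    show "odom S2 \<subseteq> hcarrier K" by (auto simp: S2_dom)
    fix x and e :: real assume "x \<in> hcarrier K" and e: "e > 0"
    then obtain a b where x: "x = j (a, b)" and [simp]: "a \<in> hcarrier H" "b \<in> hcarrier H"
      by (auto simp: sum_carrier)
    obtain c where c: "c \<in> odom S" "hnorm H (hdiff H a c) < e / 2"
      using D e unfolding hdense_def by (meson \<open>a \<in> hcarrier H\<close> half_gt_zero)
    obtain d where d: "d \<in> odom S" "hnorm H (hdiff H b d) < e / 2"
      using D e unfolding hdense_def by (meson \<open>b \<in> hcarrier H\<close> half_gt_zero)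
    have "hnorm K (hdiff K x (j (c, d))) \<le> hnorm H (hdiff H a c) + hnorm H (hdiff H b d)"
      using c d by (simp add: x sum_norm sqrt_sum_squares_le_sum)
    also have "\<dots> < e" using c d by simp
    finally show "\<exists>y\<in>odom S2. hnorm K (hdiff K x y) < e" using c d by (auto simp: S2_dom)
  qed
  have saS2: "hselfadjoint K S2"
    unfolding sum.selfadjoint_iff
  proof (intro conjI)
    show "densely_defined K S2" using opS2 denS2 by (simp add: densely_defined_def)
    show "\<forall>g\<in>hcarrier K. \<forall>h\<in>hcarrier K.
        (\<forall>f\<in>odom S2. hinner K (oapp S2 f) g = hinner K f h) = (g \<in> odom S2 \<and> oapp S2 g = h)"
    proof (rule ballI, rule ballI)
      fix g h assume "g \<in> hcarrier K" "h \<in> hcarrier K"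
      then obtain a b c d where g: "g = j (a, b)" and h: "h = j (c, d)"
        and C [simp]: "a \<in> hcarrier H" "b \<in> hcarrier H" "c \<in> hcarrier H" "d \<in> hcarrier H"
        by (auto simp: sum_carrier)
      have "(\<forall>f\<in>odom S2. hinner K (oapp S2 f) g = hinner K f h) \<longleftrightarrow>
          (\<forall>x\<in>odom S. \<forall>y\<in>odom S. hinner H (oapp S x) a + hinner H (oapp S y) b = hinner H x c + hinner H y d)"
        by (simp add: S2_dom g h)
      also have "\<dots> \<longleftrightarrow> (\<forall>x\<in>odom S. hinner H (oapp S x) a = hinner H x c) \<and>
          (\<forall>y\<in>odom S. hinner H (oapp S y) b = hinner H y d)" (is "?l \<longleftrightarrow> ?r")
      proof
        assume l: ?l
        \<comment> \<open>Zero lies in the domain and S maps it to zero, so setting x or y to zero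
          separates the two components.\<close>
        show ?r using bspec[OF bspec[OF l zS]] l[rule_format, OF _ zS] by simp
      qed simp
      also have "\<dots> \<longleftrightarrow> (a \<in> odom S \<and> oapp S a = c) \<and> (b \<in> odom S \<and> oapp S b = d)"
        using S C unfolding selfadjoint_iff by presburger
      also have "\<dots> \<longleftrightarrow> g \<in> odom S2 \<and> oapp S2 g = h"
        by (auto simp: g h S2_j sum_j_eq)
      finally show "(\<forall>f\<in>odom S2. hinner K (oapp S2 f) g = hinner K f h) = (g \<in> odom S2 \<and> oapp S2 g = h)" .
    qed
  qed
  have dS: "hdiff H f g \<in> odom S \<and> oapp S (hdiff H f g) = hdiff H (oapp S f) (oapp S g)"
    if "f \<in> odom S" "g \<in> odom S" for f g
    using that S_add S_scale by (simp add: hdiff_def)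
  have "hnormal K (odom S2, \<lambda>f. W (oapp S2 f))"
  proof (rule sum.unitary_selfadjoint_normal[where W' = W'])
    show "hselfadjoint K S2" by (rule saS2)
    show "hlin K W"
      unfolding hlin_def sum_carrier
      by (auto simp: sum_j_eq algebra_simps intro!: inner_ext)
    show "W' x \<in> hcarrier K" if "x \<in> hcarrier K" for x
      using that by (auto simp: sum_carrier)
    show "W (W' x) = x" "W' (W x) = x" if "x \<in> hcarrier K" for x
      using that by (auto simp: sum_carrier sum_j_eq algebra_simps intro!: inner_ext)
    show "hinner K (W x) y = hinner K x (W' y)" if "x \<in> hcarrier K" "y \<in> hcarrier K" for x y
      using that by (auto simp: sum_carrier algebra_simps)
    show "W f \<in> odom S2 \<and> oapp S2 (W f) = W (oapp S2 f)" if "f \<in> odom S2" for f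
      using that by (auto simp: S2_dom[of] comm comm' S_add dS sum_j_eq)
    show "W' f \<in> odom S2 \<and> oapp S2 (W' f) = W' (oapp S2 f)" if "f \<in> odom S2" for f
      using that by (auto simp: S2_dom comm comm' S_add dS sum_j_eq)
  qed
  moreover have "V' (hzero H) = hzero H" "V (hzero H) = hzero H"
    by (rule inner_ext; simp)+
  moreover have "hdiff H (hzero H) (hzero H) = hzero H" "\<And>x. x \<in> hcarrier H \<Longrightarrow> hadd H x (hzero H) = x"
    by (rule inner_ext; simp)+
  ultimately show ?thesis
    by (intro exI[of _ "(odom S2, \<lambda>f. W (oapp S2 f))"]) (auto simp: S2_j)
qed

end

section \<open>The space of square integrable functions\<close>

lemma borel_measurable_cnj [measurable (raw)]:
  "f \<in> borel_measurable M \<Longrightarrow> (\<lambda>x. cnj (f x)) \<in> borel_measurable M"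
  by (rule measurable_compose[OF _ borel_measurable_continuous_onI]) (auto intro: continuous_intros)

definition sqi :: "'a measure \<Rightarrow> ('a \<Rightarrow> complex) \<Rightarrow> bool" where
  "sqi M f \<longleftrightarrow> f \<in> borel_measurable M \<and> (\<integral>\<^sup>+ x. ennreal ((cmod (f x))\<^sup>2) \<partial>M) < \<infinity>"

lemma sqi_iff: "sqi M f \<longleftrightarrow> f \<in> borel_measurable M \<and> integrable M (\<lambda>x. (cmod (f x))\<^sup>2)"
  by (auto simp: sqi_def integrable_iff_bounded)

lemma sqi_measurable [measurable_dest]: "sqi M f \<Longrightarrow> f \<in> borel_measurable M"
  by (simp add: sqi_def)

lemma sqi_bound:
  assumes "sqi M g" "f \<in> borel_measurable M" "AE x in M. cmod (f x) \<le> C * cmod (g x)"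
  shows "sqi M f"
proof -
  have "integrable M (\<lambda>x. C\<^sup>2 * (cmod (g x))\<^sup>2)" using assms(1) by (simp add: sqi_iff)
  then have "integrable M (\<lambda>x. (cmod (f x))\<^sup>2)"
  proof (rule Bochner_Integration.integrable_bound)
    show "AE x in M. norm ((cmod (f x))\<^sup>2) \<le> norm (C\<^sup>2 * (cmod (g x))\<^sup>2)"
      using assms(3)
    proof eventually_elim
      fix x assume "cmod (f x) \<le> C * cmod (g x)"
      then have "(cmod (f x))\<^sup>2 \<le> (C * cmod (g x))\<^sup>2" by (intro power_mono) auto
      then show "norm ((cmod (f x))\<^sup>2) \<le> norm (C\<^sup>2 * (cmod (g x))\<^sup>2)"
        by (simp add: power_mult_distrib)
    qed
  qed (use assms(2) in measurable)
  then show ?thesis using assms(2) by (simp add: sqi_iff)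
qed

lemma sqi_cong_AE: "sqi M g \<Longrightarrow> f \<in> borel_measurable M \<Longrightarrow> AE x in M. f x = g x \<Longrightarrow> sqi M f"
  by (rule sqi_bound[of M g f 1]) auto

lemma sqi_zero [simp]: "sqi M (\<lambda>x. 0)"
  by (simp add: sqi_def)

lemma sqi_scale [simp]: "sqi M f \<Longrightarrow> sqi M (\<lambda>x. a * f x)"
  by (rule sqi_bound[of M f _ "cmod a"]) (auto simp: norm_mult intro: sqi_measurable)

lemma sqi_add [simp]:
  assumes f: "sqi M f" and g: "sqi M g" shows "sqi M (\<lambda>x. f x + g x)"
proof -
  note [measurable] = f[THEN sqi_measurable] g[THEN sqi_measurable]
  have "integrable M (\<lambda>x. 2 * (cmod (f x))\<^sup>2 + 2 * (cmod (g x))\<^sup>2)"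
    using f g by (simp add: sqi_iff)
  then have "integrable M (\<lambda>x. (cmod (f x + g x))\<^sup>2)"
  proof (rule Bochner_Integration.integrable_bound)
    have "(cmod (f x + g x))\<^sup>2 \<le> 2 * (cmod (f x))\<^sup>2 + 2 * (cmod (g x))\<^sup>2" for x
    proof -
      have "(cmod (f x + g x))\<^sup>2 \<le> (cmod (f x) + cmod (g x))\<^sup>2"
        by (intro power_mono norm_triangle_ineq) simp
      also have "\<dots> \<le> 2 * (cmod (f x))\<^sup>2 + 2 * (cmod (g x))\<^sup>2"
        using sum_squares_ge_zero[of "cmod (f x) - cmod (g x)" 0] by (simp add: power2_eq_square algebra_simps)
      finally show ?thesis .
    qed
    then show "AE x in M. norm ((cmod (f x + g x))\<^sup>2) \<le> norm (2 * (cmod (f x))\<^sup>2 + 2 * (cmod (g x))\<^sup>2)"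
      by simp
  qed measurable
  then show ?thesis by (simp add: sqi_iff)
qed

lemma sqi_uminus [simp]: "sqi M f \<Longrightarrow> sqi M (\<lambda>x. - f x)"
  using sqi_scale[of M f "-1"] by simp

lemma sqi_diff [simp]: "sqi M f \<Longrightarrow> sqi M g \<Longrightarrow> sqi M (\<lambda>x. f x - g x)"
  using sqi_add[of M f "\<lambda>x. - g x"] by simp

lemma sqi_integrable [simp]:
  assumes f: "sqi M f" and g: "sqi M g" shows "integrable M (\<lambda>x. f x * cnj (g x))"
proof -
  note [measurable] = f[THEN sqi_measurable] g[THEN sqi_measurable]
  have "integrable M (\<lambda>x. (cmod (f x))\<^sup>2 + (cmod (g x))\<^sup>2)"
    using f g by (simp add: sqi_iff)
  then show ?thesis
  proof (rule Bochner_Integration.integrable_bound)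
    have "cmod (f x) * cmod (g x) \<le> (cmod (f x))\<^sup>2 + (cmod (g x))\<^sup>2" for x
    proof -
      have "2 * (cmod (f x) * cmod (g x)) \<le> (cmod (f x))\<^sup>2 + (cmod (g x))\<^sup>2"
        using sum_squares_bound[of "cmod (f x)" "cmod (g x)"] by (simp add: mult_ac)
      moreover have "0 \<le> cmod (f x) * cmod (g x)" by simp
      ultimately show ?thesis by linarith
    qed
    then show "AE x in M. norm (f x * cnj (g x)) \<le> norm ((cmod (f x))\<^sup>2 + (cmod (g x))\<^sup>2)"
      by (simp add: norm_mult)
  qed measurable
qed

lemma ennreal_le_suminf: "t k \<le> (\<Sum>k. t k)" for t :: "nat \<Rightarrow> ennreal"
  using sum_le_suminf[of t "{k}"] by simp

text \<open>Along the subsequence \<^term>\<open>r\<close> the integral of the k-th squared increment is at most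
  $8^{-k}$; weighting it with $4^k$ keeps the sum integrable, so the increments are almost
  everywhere $O(2^{-k})$.\<close>
lemma sqi_complete:
  assumes f: "\<And>n::nat. sqi M (f n)"
    and cau: "\<And>e. e > 0 \<Longrightarrow> \<exists>N. \<forall>m\<ge>N. \<forall>n\<ge>N. (\<integral>x. (cmod (f m x - f n x))\<^sup>2 \<partial>M) < e"
  shows "\<exists>g. sqi M g \<and> (\<lambda>n. \<integral>x. (cmod (f n x - g x))\<^sup>2 \<partial>M) \<longlonglongrightarrow> 0"
proof -
  have [measurable]: "f n \<in> borel_measurable M" for n using f by (rule sqi_measurable)
  have nn: "(\<integral>\<^sup>+x. ennreal ((cmod (a x))\<^sup>2) \<partial>M) = ennreal (\<integral>x. (cmod (a x))\<^sup>2 \<partial>M)" if "sqi M a" for a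
    using that by (intro nn_integral_eq_integral) (auto simp: sqi_iff)
  have "\<exists>N. \<forall>m\<ge>N. \<forall>n\<ge>N. (\<integral>x. (cmod (f m x - f n x))\<^sup>2 \<partial>M) < (1/8)^k" for k :: nat
    by (rule cau) simp
  then obtain N where N: "\<And>k m n. m \<ge> N k \<Longrightarrow> n \<ge> N k \<Longrightarrow> (\<integral>x. (cmod (f m x - f n x))\<^sup>2 \<partial>M) < (1/8)^k"
    by metis
  \<comment> \<open>A sum of natural numbers dominates each summand, so r i is beyond all thresholds
    N k with k \<le> i at once.\<close>
  define r where "r k = (\<Sum>i\<le>k. N i)" for k
  have r: "N k \<le> r i" if "k \<le> i" for k i
    unfolding r_def using that by (intro member_le_sum) auto
  have Nnn: "(\<integral>\<^sup>+x. ennreal ((cmod (f m x - f n x))\<^sup>2) \<partial>M) \<le> ennreal ((1/8)^k)" if "m \<ge> N k" "n \<ge> N k" for m n k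
    using N[OF that] f by (simp add: nn ennreal_leI)
  define d where "d k x = cmod (f (r (Suc k)) x - f (r k) x)" for k x
  have [measurable]: "d k \<in> borel_measurable M" for k unfolding d_def by measurable
  have "(\<integral>\<^sup>+x. (\<Sum>k. ennreal (4^k * (d k x)\<^sup>2)) \<partial>M) = (\<Sum>k. (\<integral>\<^sup>+x. ennreal (4^k * (d k x)\<^sup>2) \<partial>M))"
    by (intro nn_integral_suminf) measurable
  also have "\<dots> \<le> (\<Sum>k. ennreal ((1/2)^k))"
  proof (intro suminf_le allI)
    fix k
    have "(\<integral>\<^sup>+x. ennreal (4^k * (d k x)\<^sup>2) \<partial>M) = ennreal (4^k) * (\<integral>\<^sup>+x. ennreal ((d k x)\<^sup>2) \<partial>M)"
      by (subst nn_integral_cmult[symmetric]) (auto simp: ennreal_mult)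
    also have "\<dots> \<le> ennreal (4^k) * ennreal ((1/8)^k)"
      unfolding d_def by (intro mult_left_mono Nnn r) auto
    also have "\<dots> = ennreal ((1/2)^k)"
      by (simp add: ennreal_mult'[symmetric] power_mult_distrib[symmetric])
    finally show "(\<integral>\<^sup>+x. ennreal (4^k * (d k x)\<^sup>2) \<partial>M) \<le> ennreal ((1/2)^k)" .
  qed auto
  also have "\<dots> = ennreal (\<Sum>k. (1/2)^k)"
    by (intro suminf_ennreal2) (auto intro: summable_geometric)
  also have "\<dots> < \<infinity>" by simp
  finally have "AE x in M. (\<Sum>k. ennreal (4^k * (d k x)\<^sup>2)) \<noteq> \<infinity>"
    by (intro nn_integral_PInf_AE) auto
  then have conv: "AE x in M. convergent (\<lambda>k. f (r k) x)"
  proof eventually_elim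
    fix x assume fin: "(\<Sum>k. ennreal (4^k * (d k x)\<^sup>2)) \<noteq> \<infinity>"
    define C where "C = enn2real (\<Sum>k. ennreal (4^k * (d k x)\<^sup>2))"
    have C: "(\<Sum>k. ennreal (4^k * (d k x)\<^sup>2)) = ennreal C" "C \<ge> 0"
      using fin unfolding C_def by (simp_all only: ennreal_enn2real_if infinity_ennreal_def if_False enn2real_nonneg)
    have dk: "d k x \<le> sqrt C * (1/2)^k" for k
    proof -
      have "ennreal (4^k * (d k x)\<^sup>2) \<le> (\<Sum>k. ennreal (4^k * (d k x)\<^sup>2))"
        by (rule ennreal_le_suminf)
      then have "4^k * (d k x)\<^sup>2 \<le> C" using C(2) unfolding C(1) by (simp only: ennreal_le_iff)
      moreover have "((2::real)^k)\<^sup>2 = 4^k" using power_mult[of "2::real" 2 k] by (simp add: power_even_eq)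
      then have "(2^k * d k x)\<^sup>2 = 4^k * (d k x)\<^sup>2" by (simp add: power_mult_distrib)
      ultimately have "2^k * d k x \<le> sqrt C" by (intro real_le_rsqrt) linarith
      then show ?thesis by (simp add: field_simps power_divide)
    qed
    have "summable (\<lambda>k. sqrt C * (1/2)^k)"
      by (intro summable_mult summable_geometric) simp
    then have "summable (\<lambda>k. d k x)"
      by (rule summable_comparison_test'[where N = 0]) (use dk in \<open>simp add: d_def\<close>)
    then have "summable (\<lambda>k. f (r (Suc k)) x - f (r k) x)"
      unfolding d_def by (rule summable_norm_cancel)
    then have "convergent (\<lambda>n. (\<Sum>k<n. f (r (Suc k)) x - f (r k) x))"
      by (simp add: summable_iff_convergent)
    then have "convergent (\<lambda>n. f (r n) x - f (r 0) x)"
      using sum_lessThan_telescope[of "\<lambda>k. f (r k) x"] by simp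
    then have "convergent (\<lambda>n. (f (r n) x - f (r 0) x) + f (r 0) x)"
      by (intro convergent_add convergent_const)
    then show "convergent (\<lambda>k. f (r k) x)" by simp
  qed
  define g where "g x = lim (\<lambda>k. f (r k) x)" for x
  have [measurable]: "g \<in> borel_measurable M" unfolding g_def by measurable
  have lim: "AE x in M. (\<lambda>k. f (r k) x) \<longlonglongrightarrow> g x"
    using conv by eventually_elim (simp add: g_def convergent_LIMSEQ_iff)
  \<comment> \<open>Fatou's lemma along the subsequence bounds the distance to g for every late
    member of the full sequence, so convergence need not be transferred back from the
    subsequence.\<close>
  have fat: "(\<integral>\<^sup>+x. ennreal ((cmod (f n x - g x))\<^sup>2) \<partial>M) \<le> ennreal ((1/8)^k)" if n: "n \<ge> N k" for n k
  proof -
    have "(\<integral>\<^sup>+x. ennreal ((cmod (f n x - g x))\<^sup>2) \<partial>M) = (\<integral>\<^sup>+x. liminf (\<lambda>i. ennreal ((cmod (f n x - f (r i) x))\<^sup>2)) \<partial>M)"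
    proof (rule nn_integral_cong_AE)
      show "AE x in M. ennreal ((cmod (f n x - g x))\<^sup>2) = liminf (\<lambda>i. ennreal ((cmod (f n x - f (r i) x))\<^sup>2))"
        using lim
      proof eventually_elim
        fix x assume "(\<lambda>k. f (r k) x) \<longlonglongrightarrow> g x"
        then have "(\<lambda>i. ennreal ((cmod (f n x - f (r i) x))\<^sup>2)) \<longlonglongrightarrow> ennreal ((cmod (f n x - g x))\<^sup>2)"
          by (intro tendsto_intros tendsto_ennrealI)
        then show "ennreal ((cmod (f n x - g x))\<^sup>2) = liminf (\<lambda>i. ennreal ((cmod (f n x - f (r i) x))\<^sup>2))"
          by (intro lim_imp_Liminf[symmetric]) auto
      qed
    qed
    also have "\<dots> \<le> liminf (\<lambda>i. \<integral>\<^sup>+x. ennreal ((cmod (f n x - f (r i) x))\<^sup>2) \<partial>M)"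
      by (intro nn_integral_liminf) measurable
    also have "\<dots> \<le> ennreal ((1/8)^k)"
    proof -
      have "\<forall>\<^sub>F i in sequentially. (\<integral>\<^sup>+x. ennreal ((cmod (f n x - f (r i) x))\<^sup>2) \<partial>M) \<le> ennreal ((1/8)^k)"
        using eventually_ge_at_top[of k] by eventually_elim (use n r Nnn in auto)
      then have "liminf (\<lambda>i. \<integral>\<^sup>+x. ennreal ((cmod (f n x - f (r i) x))\<^sup>2) \<partial>M) \<le> liminf (\<lambda>i::nat. ennreal ((1/8)^k))"
        by (rule Liminf_mono)
      then show ?thesis by (simp add: Liminf_const)
    qed
    finally show ?thesis .
  qed
  have dg: "sqi M (\<lambda>x. f n x - g x)" if "n \<ge> N k" for n k
    unfolding sqi_def using fat[OF that] by (auto intro: le_less_trans)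
  have "sqi M (\<lambda>x. f (N 0) x - (f (N 0) x - g x))"
    by (intro sqi_diff dg[of 0] f) simp
  then have g: "sqi M g" by simp
  have "(\<lambda>n. \<integral>x. (cmod (f n x - g x))\<^sup>2 \<partial>M) \<longlonglongrightarrow> 0"
  proof (rule LIMSEQ_I)
    fix e :: real assume "e > 0"
    then obtain k where k: "(1/8)^k < e" using real_arch_pow_inv[of e "1/8"] by auto
    have "norm ((\<integral>x. (cmod (f n x - g x))\<^sup>2 \<partial>M) - 0) < e" if "n \<ge> N k" for n
      using fat[OF that] nn[OF dg[OF that]] k by simp
    then show "\<exists>no. \<forall>n\<ge>no. norm ((\<integral>x. (cmod (f n x - g x))\<^sup>2 \<partial>M) - 0) < e" by blast
  qed
  with g show ?thesis by blast
qed

section \<open>Classes modulo equality almost everywhere and the Hilbert space L2\<close>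

lemma l2class_cong: "AE x in M. f x = g x \<Longrightarrow> l2class M f = l2class M g"
  unfolding l2class_def by (auto elim: eventually_elim2)

lemma l2class_eq_iff:
  "f \<in> borel_measurable M \<Longrightarrow> l2class M f = l2class M g \<longleftrightarrow> (AE x in M. f x = g x)"
  using l2class_cong[where M = M and f = f and g = g] by (auto simp: l2class_def)

lemma l2rep_class:
  assumes "f \<in> borel_measurable M"
  shows "l2rep (l2class M f) \<in> borel_measurable M" "AE x in M. l2rep (l2class M f) x = f x"
proof -
  have "l2rep (l2class M f) \<in> l2class M f"
    unfolding l2rep_def by (rule someI[of _ f]) (use assms in \<open>simp add: l2class_def\<close>)
  then show "l2rep (l2class M f) \<in> borel_measurable M" "AE x in M. l2rep (l2class M f) x = f x"
    by (auto simp: l2class_def)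
qed

lemma carrier_L2: "hcarrier (L2 M) = l2class M ` {f. sqi M f}"
  by (auto simp: L2_def sqi_def)

lemma class_carrier [simp]: "sqi M f \<Longrightarrow> l2class M f \<in> hcarrier (L2 M)"
  by (simp add: carrier_L2)

lemma l2rep_carrier:
  assumes "c \<in> hcarrier (L2 M)"
  shows "sqi M (l2rep c)" "l2class M (l2rep c) = c"
proof -
  obtain f where f: "sqi M f" "c = l2class M f" using assms by (auto simp: carrier_L2)
  note rep = l2rep_class[OF sqi_measurable[OF f(1)], folded f(2)]
  show "sqi M (l2rep c)" by (rule sqi_cong_AE[OF f(1) rep])
  show "l2class M (l2rep c) = c" by (rule trans[OF l2class_cong[OF rep(2)] f(2)[symmetric]])
qed

lemma class_carrier_iff:
  assumes "f \<in> borel_measurable M"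
  shows "l2class M f \<in> hcarrier (L2 M) \<longleftrightarrow> sqi M f"
proof
  assume "l2class M f \<in> hcarrier (L2 M)"
  then have "sqi M (l2rep (l2class M f))" by (rule l2rep_carrier)
  then show "sqi M f" by (rule sqi_cong_AE) (use assms l2rep_class[OF assms] in auto)
qed simp

lemma L2_zero: "hzero (L2 M) = l2class M (\<lambda>x. 0)"
  by (simp add: L2_def)

lemma L2_add [simp]: "sqi M f \<Longrightarrow> sqi M g \<Longrightarrow>
    hadd (L2 M) (l2class M f) (l2class M g) = l2class M (\<lambda>x. f x + g x)"
  using l2rep_class(2)[of f M] l2rep_class(2)[of g M]
  by (auto simp: L2_def sqi_measurable intro!: l2class_cong elim: eventually_elim2)

lemma L2_scale [simp]: "sqi M f \<Longrightarrow> hscale (L2 M) a (l2class M f) = l2class M (\<lambda>x. a * f x)"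
  using l2rep_class(2)[of f M]
  by (auto simp: L2_def sqi_measurable intro!: l2class_cong elim: eventually_mono)

lemma L2_diff [simp]: "sqi M f \<Longrightarrow> sqi M g \<Longrightarrow>
    hdiff (L2 M) (l2class M f) (l2class M g) = l2class M (\<lambda>x. f x - g x)"
  by (simp add: hdiff_def)

lemma L2_inner [simp]:
  assumes "sqi M f" "sqi M g"
  shows "hinner (L2 M) (l2class M f) (l2class M g) = (\<integral>x. f x * cnj (g x) \<partial>M)"
proof -
  note [measurable] = assms[THEN sqi_measurable]
  have [measurable]: "l2rep (l2class M f) \<in> borel_measurable M" "l2rep (l2class M g) \<in> borel_measurable M"
    by (simp_all add: l2rep_class)
  have "AE x in M. l2rep (l2class M f) x * cnj (l2rep (l2class M g) x) = f x * cnj (g x)"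
    using l2rep_class(2)[of f M] l2rep_class(2)[of g M] by (auto elim: eventually_elim2)
  then have "(\<integral>x. l2rep (l2class M f) x * cnj (l2rep (l2class M g) x) \<partial>M) = (\<integral>x. f x * cnj (g x) \<partial>M)"
    by (intro integral_cong_AE) measurable
  then show ?thesis by (simp add: L2_def)
qed

lemma L2_norm:
  assumes "sqi M f" shows "hnorm (L2 M) (l2class M f) = sqrt (\<integral>x. (cmod (f x))\<^sup>2 \<partial>M)"
proof -
  have "(\<integral>x. f x * cnj (f x) \<partial>M) = (\<integral>x. complex_of_real ((cmod (f x))\<^sup>2) \<partial>M)"
    by (simp add: complex_norm_square del: of_real_power)
  also have "\<dots> = of_real (\<integral>x. (cmod (f x))\<^sup>2 \<partial>M)" by (rule integral_complex_of_real)
  finally show ?thesis using assms by (simp add: hnorm_def)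
qed

lemma is_hilbert_L2: "is_hilbert (L2 M)"
proof -
  have comp: "\<exists>x\<in>hcarrier (L2 M). hconv (L2 M) s x" if s: "\<forall>n. s n \<in> hcarrier (L2 M)"
     and cau: "\<forall>e>0. \<exists>N. \<forall>m\<ge>N. \<forall>n\<ge>N. hnorm (L2 M) (hdiff (L2 M) (s m) (s n)) < e" for s
  proof -
    define f where "f n = l2rep (s n)" for n
    have f [simp]: "sqi M (f n)" and sf: "s n = l2class M (f n)" for n
      using l2rep_carrier[of "s n" M] s by (auto simp: f_def)
    have "\<exists>N. \<forall>m\<ge>N. \<forall>n\<ge>N. (\<integral>x. (cmod (f m x - f n x))\<^sup>2 \<partial>M) < e" if "e > 0" for e
    proof -
      obtain N where "\<forall>m\<ge>N. \<forall>n\<ge>N. hnorm (L2 M) (hdiff (L2 M) (s m) (s n)) < sqrt e"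
        using cau \<open>e > 0\<close> by (metis real_sqrt_gt_0_iff)
      then show ?thesis by (auto simp: sf L2_norm)
    qed
    from sqi_complete[OF f this] obtain g where g: "sqi M g" 
      and lim: "(\<lambda>n. \<integral>x. (cmod (f n x - g x))\<^sup>2 \<partial>M) \<longlonglongrightarrow> 0" by blast
    have "(\<lambda>n. sqrt (\<integral>x. (cmod (f n x - g x))\<^sup>2 \<partial>M)) \<longlonglongrightarrow> sqrt 0"
      by (intro tendsto_intros lim)
    then have "hconv (L2 M) s (l2class M g)" using g by (simp add: hconv_def sf L2_norm)
    then show ?thesis using g by auto
  qed
  have pos: "AE x in M. f x = 0" if "sqi M f" "(\<integral>x. f x * cnj (f x) \<partial>M) = 0" for f
  proof -
    have "complex_of_real (\<integral>x. (cmod (f x))\<^sup>2 \<partial>M) = (\<integral>x. complex_of_real ((cmod (f x))\<^sup>2) \<partial>M)"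
      by (rule integral_complex_of_real[symmetric])
    also have "\<dots> = 0" using that(2) by (simp add: complex_norm_square del: of_real_power)
    finally have "(\<integral>x. (cmod (f x))\<^sup>2 \<partial>M) = 0" by (simp only: of_real_eq_0_iff)
    then show ?thesis using that(1) integral_nonneg_eq_0_iff_AE[of M "\<lambda>x. (cmod (f x))\<^sup>2"] by (simp add: sqi_iff)
  qed
  have nonneg: "0 \<le> Re (\<integral>x. f x * cnj (f x) \<partial>M)" for f
  proof -
    have "(\<integral>x. f x * cnj (f x) \<partial>M) = (\<integral>x. complex_of_real ((cmod (f x))\<^sup>2) \<partial>M)"
      by (simp add: complex_norm_square del: of_real_power)
    also have "\<dots> = of_real (\<integral>x. (cmod (f x))\<^sup>2 \<partial>M)" by (rule integral_complex_of_real)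
    finally show ?thesis by simp
  qed
  have cc: "(\<integral>x. g x * cnj (f x) \<partial>M) = cnj (\<integral>x. f x * cnj (g x) \<partial>M)" for f g
  proof -
    have "cnj (\<integral>x. f x * cnj (g x) \<partial>M) = (\<integral>x. cnj (f x * cnj (g x)) \<partial>M)"
      by (rule Bochner_Integration.integral_cnj[symmetric])
    then show ?thesis by (simp add: mult.commute)
  qed
  show ?thesis
    unfolding is_hilbert_def
    apply (intro conjI)
    prefer 17 subgoal using comp by blast
    apply (simp_all add: carrier_L2 L2_zero nonneg)
    apply (auto simp: algebra_simps nonneg intro!: l2class_cong pos intro: cc)
    done
qed

section \<open>Multiplication operators\<close>

interpretation L2: hilb "L2 M" for M :: "'a measure"
  by unfold_locales (rule is_hilbert_L2)

text \<open>A total map on classes: the product may fail to be square integrable. Membership of the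
  result in the carrier then serves as the domain condition of the unbounded operator.\<close>

definition mulc :: "'a measure \<Rightarrow> ('a \<Rightarrow> real) \<Rightarrow> ('a \<Rightarrow> complex) set \<Rightarrow> ('a \<Rightarrow> complex) set" where
  "mulc M a c = l2class M (\<lambda>x. of_real (a x) * l2rep c x)"

lemma mulc_class: "f \<in> borel_measurable M \<Longrightarrow> mulc M a (l2class M f) = l2class M (\<lambda>x. of_real (a x) * f x)"
  unfolding mulc_def using l2rep_class(2)[of f M] by (intro l2class_cong) (auto elim: eventually_mono)

lemma l2rep_measurable: "c \<in> hcarrier (L2 M) \<Longrightarrow> l2rep c \<in> borel_measurable M"
  using l2rep_carrier sqi_measurable by blast

lemma mulc_carrier_iff:
  assumes [measurable]: "a \<in> borel_measurable M" and c: "c \<in> hcarrier (L2 M)"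
  shows "mulc M a c \<in> hcarrier (L2 M) \<longleftrightarrow> sqi M (\<lambda>x. of_real (a x) * l2rep c x)"
proof -
  note [measurable] = l2rep_measurable[OF c]
  show ?thesis unfolding mulc_def by (rule class_carrier_iff) measurable
qed

lemma mulc_mulc:
  assumes [measurable]: "b \<in> borel_measurable M" and c: "c \<in> hcarrier (L2 M)"
  shows "mulc M a (mulc M b c) = mulc M (\<lambda>x. a x * b x) c"
proof -
  note [measurable] = l2rep_measurable[OF c]
  show ?thesis unfolding mulc_def[of M b] mulc_def[of M "\<lambda>x. a x * b x"]
    by (subst mulc_class) (measurable, simp add: mult.assoc)
qed

lemma mulc_dominated:
  assumes [measurable]: "a \<in> borel_measurable M" "b \<in> borel_measurable M" and c: "c \<in> hcarrier (L2 M)"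
    and b: "mulc M b c \<in> hcarrier (L2 M)" and le: "\<And>x. \<bar>a x\<bar> \<le> K * \<bar>b x\<bar>"
  shows "mulc M a c \<in> hcarrier (L2 M)"
proof -
  note [measurable] = l2rep_measurable[OF c]
  have "sqi M (\<lambda>x. of_real (b x) * l2rep c x)" using b c by (simp add: mulc_carrier_iff)
  then have "sqi M (\<lambda>x. of_real (a x) * l2rep c x)"
  proof (rule sqi_bound)
    show "AE x in M. cmod (of_real (a x) * l2rep c x) \<le> K * cmod (of_real (b x) * l2rep c x)"
      using mult_right_mono[OF le norm_ge_zero]
      by (intro AE_I2) (simp add: norm_mult mult.assoc[symmetric])
  qed measurable
  then show ?thesis using c by (simp add: mulc_carrier_iff)
qed

lemma mulc_one [simp]: "c \<in> hcarrier (L2 M) \<Longrightarrow> mulc M (\<lambda>x. 1) c = c"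
  by (simp add: mulc_def l2rep_carrier)

lemma mulc_bounded:
  assumes "a \<in> borel_measurable M" "c \<in> hcarrier (L2 M)" "\<And>x. \<bar>a x\<bar> \<le> K"
  shows "mulc M a c \<in> hcarrier (L2 M)"
  by (rule mulc_dominated[of a M "\<lambda>x. 1" c K]) (use assms in auto)

lemma mulc_rep:
  assumes "c \<in> hcarrier (L2 M)"
  obtains f where "sqi M f" "c = l2class M f"
  using assms by (auto simp: carrier_L2)

lemma mulc_add_left:
  assumes [measurable]: "a \<in> borel_measurable M" "b \<in> borel_measurable M" and c: "c \<in> hcarrier (L2 M)"
    and "mulc M a c \<in> hcarrier (L2 M)" "mulc M b c \<in> hcarrier (L2 M)"
  shows "mulc M (\<lambda>x. a x + b x) c = hadd (L2 M) (mulc M a c) (mulc M b c)"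
  using assms by (simp add: mulc_carrier_iff) (simp add: mulc_def distrib_right)

lemma mulc_diff_left:
  assumes [measurable]: "a \<in> borel_measurable M" "b \<in> borel_measurable M" and c: "c \<in> hcarrier (L2 M)"
    and "mulc M a c \<in> hcarrier (L2 M)" "mulc M b c \<in> hcarrier (L2 M)"
  shows "mulc M (\<lambda>x. a x - b x) c = hdiff (L2 M) (mulc M a c) (mulc M b c)"
  using assms by (simp add: mulc_carrier_iff) (simp add: mulc_def left_diff_distrib)

lemma mulc_scale_left:
  assumes "a \<in> borel_measurable M" and c: "c \<in> hcarrier (L2 M)" and "mulc M a c \<in> hcarrier (L2 M)"
  shows "mulc M (\<lambda>x. t * a x) c = hscale (L2 M) (of_real t) (mulc M a c)"
  using assms by (simp add: mulc_carrier_iff) (simp add: mulc_def mult.assoc)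

lemma mulc_add_right:
  assumes a: "a \<in> borel_measurable M" and c: "c \<in> hcarrier (L2 M)" and d: "d \<in> hcarrier (L2 M)"
    and "mulc M a c \<in> hcarrier (L2 M)" "mulc M a d \<in> hcarrier (L2 M)"
  shows "mulc M a (hadd (L2 M) c d) = hadd (L2 M) (mulc M a c) (mulc M a d)"
proof -
  from c obtain f where f: "sqi M f" "c = l2class M f" by (rule mulc_rep)
  from d obtain g where g: "sqi M g" "d = l2class M g" by (rule mulc_rep)
  note [measurable] = a f(1)[THEN sqi_measurable] g(1)[THEN sqi_measurable]
  have "sqi M (\<lambda>x. of_real (a x) * f x)" "sqi M (\<lambda>x. of_real (a x) * g x)"
    using assms(4,5) unfolding f g by (auto simp: mulc_class class_carrier_iff)
  then show ?thesis using f(1) g(1) by (simp add: f(2) g(2) mulc_class distrib_left)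
qed

lemma mulc_scale_right:
  assumes a: "a \<in> borel_measurable M" and c: "c \<in> hcarrier (L2 M)"
    and "mulc M a c \<in> hcarrier (L2 M)"
  shows "mulc M a (hscale (L2 M) t c) = hscale (L2 M) t (mulc M a c)"
proof -
  from c obtain f where f: "sqi M f" "c = l2class M f" by (rule mulc_rep)
  note [measurable] = a f(1)[THEN sqi_measurable]
  have "sqi M (\<lambda>x. of_real (a x) * f x)"
    using assms(3) unfolding f by (auto simp: mulc_class class_carrier_iff)
  then show ?thesis using f(1) by (simp add: f(2) mulc_class mult.left_commute)
qed

lemma mulc_diff_right:
  assumes a: "a \<in> borel_measurable M" and c: "c \<in> hcarrier (L2 M)" and d: "d \<in> hcarrier (L2 M)"
    and "mulc M a c \<in> hcarrier (L2 M)" "mulc M a d \<in> hcarrier (L2 M)"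
  shows "mulc M a (hdiff (L2 M) c d) = hdiff (L2 M) (mulc M a c) (mulc M a d)"
  using assms by (simp add: hdiff_def mulc_add_right mulc_scale_right)

lemma mulc_inner:
  assumes a: "a \<in> borel_measurable M" and c: "c \<in> hcarrier (L2 M)" and d: "d \<in> hcarrier (L2 M)"
    and "mulc M a c \<in> hcarrier (L2 M)" "mulc M a d \<in> hcarrier (L2 M)"
  shows "hinner (L2 M) (mulc M a c) d = hinner (L2 M) c (mulc M a d)"
proof -
  from c obtain f where f: "sqi M f" "c = l2class M f" by (rule mulc_rep)
  from d obtain g where g: "sqi M g" "d = l2class M g" by (rule mulc_rep)
  note [measurable] = a f(1)[THEN sqi_measurable] g(1)[THEN sqi_measurable]
  have "sqi M (\<lambda>x. of_real (a x) * f x)" "sqi M (\<lambda>x. of_real (a x) * g x)"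
    using assms(4,5) unfolding f g by (auto simp: mulc_class class_carrier_iff)
  then show ?thesis using f(1) g(1) by (simp add: f(2) g(2) mulc_class mult_ac)
qed

text \<open>Turns uniform approximation of symbols into strong convergence of the multiplication
  operators.\<close>

lemma mulc_norm_le:
  assumes [measurable]: "a \<in> borel_measurable M" and c: "c \<in> hcarrier (L2 M)" and le: "\<And>x. \<bar>a x\<bar> \<le> K"
  shows "hnorm (L2 M) (mulc M a c) \<le> K * hnorm (L2 M) c"
proof -
  have K: "K \<ge> 0" using le[of undefined] by linarith
  let ?f = "l2rep c"
  have f: "sqi M ?f" "l2class M ?f = c" using l2rep_carrier[OF c] by auto
  have af: "sqi M (\<lambda>x. of_real (a x) * ?f x)" using mulc_bounded[OF assms] c by (simp add: mulc_carrier_iff)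
  have "(\<integral>x. (cmod (of_real (a x) * ?f x))\<^sup>2 \<partial>M) \<le> (\<integral>x. K\<^sup>2 * (cmod (?f x))\<^sup>2 \<partial>M)"
  proof (rule integral_mono)
    fix x
    have "(a x)\<^sup>2 \<le> K\<^sup>2" using le[of x] K by (simp add: abs_le_square_iff[symmetric])
    then show "(cmod (of_real (a x) * ?f x))\<^sup>2 \<le> K\<^sup>2 * (cmod (?f x))\<^sup>2"
      by (simp add: norm_mult power_mult_distrib mult_right_mono)
  qed (use af f in \<open>auto simp: sqi_iff\<close>)
  then have "sqrt (\<integral>x. (cmod (of_real (a x) * ?f x))\<^sup>2 \<partial>M) \<le> sqrt (K\<^sup>2 * (\<integral>x. (cmod (?f x))\<^sup>2 \<partial>M))"
    by simp
  also have "\<dots> = K * sqrt (\<integral>x. (cmod (?f x))\<^sup>2 \<partial>M)" using K by (simp add: real_sqrt_mult)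
  finally show ?thesis using L2_norm[OF af] L2_norm[OF f(1)] f(2) by (simp add: mulc_def)
qed

section \<open>Unbounded multiplication operators and their square roots\<close>

text \<open>The value zero off the domain is the normalisation used in \<open>hmodulus\<close>,
  where operators are compared as pairs.\<close>

definition mop :: "'a measure \<Rightarrow> ('a \<Rightarrow> real) \<Rightarrow> ('a \<Rightarrow> complex) set lop" where
  "mop M u = ({c \<in> hcarrier (L2 M). mulc M u c \<in> hcarrier (L2 M)},
     \<lambda>c. if c \<in> hcarrier (L2 M) \<and> mulc M u c \<in> hcarrier (L2 M) then mulc M u c else hzero (L2 M))"

lemma mop_dom: "c \<in> odom (mop M u) \<longleftrightarrow> c \<in> hcarrier (L2 M) \<and> mulc M u c \<in> hcarrier (L2 M)"
  and mop_app: "c \<in> odom (mop M u) \<Longrightarrow> oapp (mop M u) c = mulc M u c"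
  and mop_off: "c \<notin> odom (mop M u) \<Longrightarrow> oapp (mop M u) c = hzero (L2 M)"
  by (auto simp: mop_def)

lemma mulc_zero [simp]: "mulc M u (hzero (L2 M)) = hzero (L2 M)"
  unfolding L2_zero by (subst mulc_class) auto

text \<open>Cutting off to {|u| \<le> n} makes the symbol bounded and thus moves every vector into
  the domain of multiplication by u. Density and selfadjointness both rest on this.\<close>

lemma truncation_mult:
  fixes u :: "'a \<Rightarrow> real"
  defines "k n x \<equiv> indicator {x. \<bar>u x\<bar> \<le> real n} x :: real"
  assumes [measurable]: "u \<in> borel_measurable M" and c: "c \<in> hcarrier (L2 M)"
  shows "k n \<in> borel_measurable M" "mulc M (k n) c \<in> hcarrier (L2 M)"
    "mulc M (\<lambda>x. u x * k n x) c \<in> hcarrier (L2 M)"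
proof -
  have eq: "k n = (\<lambda>x. if \<bar>u x\<bar> \<le> real n then 1 else 0)" by (auto simp: k_def fun_eq_iff)
  show [measurable]: "k n \<in> borel_measurable M" unfolding eq by measurable
  show "mulc M (k n) c \<in> hcarrier (L2 M)" using c
    by (intro mulc_bounded[where K = 1]) (auto simp: eq)
  show "mulc M (\<lambda>x. u x * k n x) c \<in> hcarrier (L2 M)" using c
    by (intro mulc_bounded[where K = "real n"]) (auto simp: eq)
qed

text \<open>The truncations of c lie in the domain and converge to c by dominated convergence: u is
  finite at each point, so the error vanishes there eventually.\<close>

lemma mop_dense:
  assumes [measurable]: "u \<in> borel_measurable M"
  shows "hdense (L2 M) (odom (mop M u))"
  unfolding hdense_def
proof (intro conjI ballI allI impI)
  show "odom (mop M u) \<subseteq> hcarrier (L2 M)" by (auto simp: mop_dom)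
  fix c and e :: real assume c: "c \<in> hcarrier (L2 M)" and e: "e > 0"
  define k where "k n x = (indicator {x. \<bar>u x\<bar> \<le> real n} x :: real)" for n x
  note k = truncation_mult[OF assms c, folded k_def]
  note [measurable] = k(1) l2rep_measurable[OF c]
  let ?f = "l2rep c"
  have f: "sqi M ?f" "l2class M ?f = c" using l2rep_carrier[OF c] by auto
  have kf: "sqi M (\<lambda>x. of_real (k n x) * ?f x)" for n using k(2) c by (simp add: mulc_carrier_iff)
  have eq: "hnorm (L2 M) (hdiff (L2 M) c (mulc M (k n) c)) = sqrt (\<integral>x. (cmod (?f x - of_real (k n x) * ?f x))\<^sup>2 \<partial>M)" for n
  proof -
    have "hdiff (L2 M) c (mulc M (k n) c) = hdiff (L2 M) (l2class M ?f) (mulc M (k n) c)"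
      by (simp add: f(2))
    also have "\<dots> = l2class M (\<lambda>x. ?f x - of_real (k n x) * ?f x)"
      unfolding mulc_def using f(1) kf by (rule L2_diff)
    finally show ?thesis using L2_norm[OF sqi_diff[OF f(1) kf]] by simp
  qed
  have "(\<lambda>n. \<integral>x. (cmod (?f x - of_real (k n x) * ?f x))\<^sup>2 \<partial>M) \<longlonglongrightarrow> (\<integral>x. 0 \<partial>M)"
  proof (rule integral_dominated_convergence[where w = "\<lambda>x. (cmod (?f x))\<^sup>2"])
    show "integrable M (\<lambda>x. (cmod (?f x))\<^sup>2)" using f by (simp add: sqi_iff)
    show "AE x in M. (\<lambda>n. (cmod (?f x - of_real (k n x) * ?f x))\<^sup>2) \<longlonglongrightarrow> 0"
    proof (intro AE_I2 tendsto_eventually)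
      fix x
      obtain N where "\<bar>u x\<bar> \<le> real N" using real_arch_simple by blast
      then show "\<forall>\<^sub>F n in sequentially. (cmod (?f x - of_real (k n x) * ?f x))\<^sup>2 = 0"
        by (intro eventually_sequentiallyI[of N]) (auto simp: k_def)
    qed
    show "AE x in M. norm ((cmod (?f x - of_real (k n x) * ?f x))\<^sup>2) \<le> (cmod (?f x))\<^sup>2" for n
      by (auto simp: k_def indicator_def)
  qed measurable
  then have "(\<lambda>n. sqrt (\<integral>x. (cmod (?f x - of_real (k n x) * ?f x))\<^sup>2 \<partial>M)) \<longlonglongrightarrow> sqrt (\<integral>x. 0 \<partial>M)"
    by (rule tendsto_real_sqrt)
  then have "(\<lambda>n. hnorm (L2 M) (hdiff (L2 M) c (mulc M (k n) c))) \<longlonglongrightarrow> 0"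
    by (simp add: eq)
  then have "\<forall>\<^sub>F n in sequentially. hnorm (L2 M) (hdiff (L2 M) c (mulc M (k n) c)) < e"
    using e by (rule order_tendstoD(2))
  then obtain n where "hnorm (L2 M) (hdiff (L2 M) c (mulc M (k n) c)) < e"
    by (auto dest: eventually_happens)
  moreover have "mulc M (k n) c \<in> odom (mop M u)"
    using k c by (simp add: mop_dom mulc_mulc)
  ultimately show "\<exists>y\<in>odom (mop M u). hnorm (L2 M) (hdiff (L2 M) c y) < e" by blast
qed

lemma mop_operator:
  assumes "u \<in> borel_measurable M"
  shows "is_operator (L2 M) (mop M u)"
proof -
  have "hadd (L2 M) f g \<in> odom (mop M u) \<and>
      mulc M u (hadd (L2 M) f g) = hadd (L2 M) (mulc M u f) (mulc M u g)"
    if "f \<in> odom (mop M u)" "g \<in> odom (mop M u)" for f g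
    using that assms by (simp add: mop_dom mulc_add_right)
  moreover have "hscale (L2 M) t f \<in> odom (mop M u) \<and>
      mulc M u (hscale (L2 M) t f) = hscale (L2 M) t (mulc M u f)"
    if "f \<in> odom (mop M u)" for t f
    using that assms by (simp add: mop_dom mulc_scale_right)
  ultimately show ?thesis
    unfolding is_operator_def by (auto simp: mop_app) (auto simp: mop_dom)
qed

text \<open>Only the domain inclusion needs an argument. Testing the weak equation with z = k_n (u g
  - h), where k_n is the cut-off, gives <z, z> = 0. Hence u g = h on {|u| \<le> n} for every n, so u
  g is square integrable.\<close>

lemma mop_selfadjoint:
  assumes u: "u \<in> borel_measurable M"
  shows "hselfadjoint (L2 M) (mop M u)"
  unfolding L2.selfadjoint_iff
proof (intro conjI)
  note [measurable] = u
  show "densely_defined (L2 M) (mop M u)"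
    using mop_dense[OF u] mop_operator[OF u] by (simp add: densely_defined_def)
  show "\<forall>g\<in>hcarrier (L2 M). \<forall>h\<in>hcarrier (L2 M).
     (\<forall>f\<in>odom (mop M u). hinner (L2 M) (oapp (mop M u) f) g = hinner (L2 M) f h) =
     (g \<in> odom (mop M u) \<and> oapp (mop M u) g = h)"
  proof (rule ballI, rule ballI, rule iffI)
    fix g h assume g: "g \<in> hcarrier (L2 M)" and h: "h \<in> hcarrier (L2 M)"
      and eq: "\<forall>f\<in>odom (mop M u). hinner (L2 M) (oapp (mop M u) f) g = hinner (L2 M) f h"
    define k where "k n x = (indicator {x. \<bar>u x\<bar> \<le> real n} x :: real)" for n x
    note k = truncation_mult[OF u, folded k_def]
    note [measurable] = k(1)[OF g] l2rep_measurable[OF g] l2rep_measurable[OF h]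
    have kk: "k n x * k n x = k n x" for n x by (simp add: k_def indicator_def)
    have "mulc M (\<lambda>x. u x * k n x) g = mulc M (k n) h" for n
    proof -
      let ?z = "hdiff (L2 M) (mulc M (\<lambda>x. u x * k n x) g) (mulc M (k n) h)"
      have z: "?z \<in> hcarrier (L2 M)" using k(2,3) g h by simp
      \<comment> \<open>z vanishes off {|u| \<le> n} and so equals its own truncation; this places
        it in the domain and makes it an admissible test vector.\<close>
      have kz: "mulc M (k n) ?z = ?z"
        using k g h by (simp add: mulc_diff_right mulc_mulc kk mult.left_commute[of "k n _"])
      have uz: "mulc M u ?z = mulc M (\<lambda>x. u x * k n x) ?z"
        using mulc_mulc[of "k n" M ?z u] z by (simp add: kz)
      have zD: "?z \<in> odom (mop M u)" using z k(3)[OF z] by (simp add: mop_dom uz)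
      have "hinner (L2 M) ?z (mulc M (\<lambda>x. u x * k n x) g) = hinner (L2 M) (mulc M (\<lambda>x. u x * k n x) ?z) g"
        using k(3)[OF z] k(3)[OF g] z g by (intro mulc_inner[symmetric]) auto
      also have "\<dots> = hinner (L2 M) ?z h"
        using bspec[OF eq zD] by (simp only: mop_app[OF zD] uz)
      also have "\<dots> = hinner (L2 M) (mulc M (k n) ?z) h" by (simp only: kz)
      also have "\<dots> = hinner (L2 M) ?z (mulc M (k n) h)"
        using k(2)[OF z] k(2)[OF h] z h by (intro mulc_inner) auto
      finally have "hinner (L2 M) ?z ?z = 0"
        using k(3)[OF g] k(2)[OF h] z by (subst L2.inner_diff_right) auto
      then have "?z = hzero (L2 M)" by (rule L2.inner_eq_0[OF z])
      then show ?thesis by (rule L2.diff_eq_zero[OF k(3)[OF g] k(2)[OF h]])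
    qed
    then have "AE x in M. of_real (u x * k n x) * l2rep g x = of_real (k n x) * l2rep h x" for n
      unfolding mulc_def by (subst (asm) l2class_eq_iff) auto
    then have "AE x in M. \<forall>n. of_real (u x * k n x) * l2rep g x = of_real (k n x) * l2rep h x"
      by (subst AE_all_countable) blast
    then have ae: "AE x in M. of_real (u x) * l2rep g x = l2rep h x"
    proof eventually_elim
      fix x assume *: "\<forall>n. of_real (u x * k n x) * l2rep g x = of_real (k n x) * l2rep h x"
      obtain N where "\<bar>u x\<bar> \<le> real N" using real_arch_simple by blast
      then show "of_real (u x) * l2rep g x = l2rep h x" using *[rule_format, of N] by (simp add: k_def)
    qed
    then have "mulc M u g = h"
      unfolding mulc_def using l2class_cong[OF ae] l2rep_carrier(2)[OF h] by simp
    then show "g \<in> odom (mop M u) \<and> oapp (mop M u) g = h"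
      using g h by (simp add: mop_app mop_dom)
  next
    fix g h assume "g \<in> hcarrier (L2 M)" "h \<in> hcarrier (L2 M)" "g \<in> odom (mop M u) \<and> oapp (mop M u) g = h"
    then show "\<forall>f\<in>odom (mop M u). hinner (L2 M) (oapp (mop M u) f) g = hinner (L2 M) f h"
      by (auto simp: mop_app) (auto simp: mop_dom mulc_inner)
  qed
qed

text \<open>The quadratic form as an integral: it is nonnegative for u \<ge> 0, and its vanishing
  then forces u f = 0 a.e.\<close>

lemma mulc_Re_inner:
  assumes u: "u \<in> borel_measurable M" and "c \<in> odom (mop M u)" 
  shows "Re (hinner (L2 M) (mulc M u c) c) = (\<integral>x. u x * (cmod (l2rep c x))\<^sup>2 \<partial>M)"
    "integrable M (\<lambda>x. u x * (cmod (l2rep c x))\<^sup>2)"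
proof -
  have c: "c \<in> hcarrier (L2 M)" and uc: "sqi M (\<lambda>x. of_real (u x) * l2rep c x)"
    using assms by (auto simp: mop_dom mulc_carrier_iff)
  let ?f = "l2rep c"
  have f: "sqi M ?f" "l2class M ?f = c" using l2rep_carrier[OF c] by auto
  have e: "of_real (u x) * ?f x * cnj (?f x) = complex_of_real (u x * (cmod (?f x))\<^sup>2)" for x
    by (simp add: complex_norm_square mult.assoc del: of_real_power)
  have "hinner (L2 M) (mulc M u c) c = hinner (L2 M) (l2class M (\<lambda>x. of_real (u x) * ?f x)) (l2class M ?f)"
    by (simp add: mulc_def f(2))
  also have "\<dots> = (\<integral>x. of_real (u x) * ?f x * cnj (?f x) \<partial>M)" using uc f by (intro L2_inner)
  also have "\<dots> = of_real (\<integral>x. u x * (cmod (?f x))\<^sup>2 \<partial>M)"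
    unfolding e by (rule integral_complex_of_real)
  finally show "Re (hinner (L2 M) (mulc M u c) c) = (\<integral>x. u x * (cmod (l2rep c x))\<^sup>2 \<partial>M)" by simp
  have "integrable M (\<lambda>x. of_real (u x) * ?f x * cnj (?f x))" using uc f by (intro sqi_integrable)
  then have "integrable M (\<lambda>x. Re (complex_of_real (u x * (cmod (?f x))\<^sup>2)))"
    unfolding e by (rule integrable_Re)
  then show "integrable M (\<lambda>x. u x * (cmod (l2rep c x))\<^sup>2)" by simp
qed

lemma mop_positive:
  assumes "u \<in> borel_measurable M" "\<And>x. u x \<ge> 0"
  shows "hpositive (L2 M) (mop M u)"
  unfolding hpositive_def using assms by (auto simp: mop_app mulc_Re_inner)

text \<open>A positive square root \<^term>\<open>B\<close> of multiplication by $u^2$ commutes with the resolvent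
  multiplication by $r = 1/(1+u^2)$, hence, by the Weierstrass theorem and closedness of
  \<^term>\<open>B\<close>, with multiplication by $w = \sqrt{r(1-r)} = u/(1+u^2)$. For \<^term>\<open>g\<close> in the domain of
  \<^term>\<open>B\<close> and $y = wg - rBg$ this gives $By = -uy$; positivity forces $y = 0$, that is $Bg = ug$.\<close>
lemma mop_sqrt_unique:
  assumes u [measurable]: "u \<in> borel_measurable M" and pos: "\<And>x. u x \<ge> 0"
    and B: "hselfadjoint (L2 M) B" "hpositive (L2 M) B"
    and sq: "op_eq (op_comp B B) (op_comp (mop M u) (mop M u))"
    and off: "\<And>f. f \<notin> odom B \<Longrightarrow> oapp B f = hzero (L2 M)"
  shows "B = mop M u"
proof -
  have opB: "is_operator (L2 M) B" using B by (auto simp: L2.selfadjoint_iff densely_defined_def)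
  have sub [simp]: "\<And>f. f \<in> odom B \<Longrightarrow> f \<in> hcarrier (L2 M)" "\<And>f. f \<in> odom B \<Longrightarrow> oapp B f \<in> hcarrier (L2 M)"
    and B_add: "\<And>f g. f \<in> odom B \<Longrightarrow> g \<in> odom B \<Longrightarrow>
       hadd (L2 M) f g \<in> odom B \<and> oapp B (hadd (L2 M) f g) = hadd (L2 M) (oapp B f) (oapp B g)"
    and B_scale: "\<And>a f. f \<in> odom B \<Longrightarrow>
       hscale (L2 M) a f \<in> odom B \<and> oapp B (hscale (L2 M) a f) = hscale (L2 M) a (oapp B f)"
    using opB by (auto simp: is_operator_def)
  have B_diff: "hdiff (L2 M) f g \<in> odom B \<and> oapp B (hdiff (L2 M) f g) = hdiff (L2 M) (oapp B f) (oapp B g)"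
    if "f \<in> odom B" "g \<in> odom B" for f g
    using that B_add B_scale by (simp add: hdiff_def)
  define h where "h x = (u x)\<^sup>2" for x
  define r where "r x = 1 / (1 + h x)" for x
  define w where "w x = u x / (1 + h x)" for x
  have [measurable]: "h \<in> borel_measurable M" "r \<in> borel_measurable M" "w \<in> borel_measurable M"
    unfolding h_def r_def w_def by measurable
  have h0: "0 \<le> h x" for x by (simp add: h_def)
  have h1: "1 + h x > 0" for x using h0[of x] by simp
  have r01: "0 \<le> r x" "r x \<le> 1" for x using h0[of x] by (auto simp: r_def)
  have hr: "h x * r x = 1 - r x" for x using h1[of x] by (simp add: r_def field_simps)
  \<comment> \<open>From 2u \<le> 1 + u^2. It places the domain of multiplication by u^2 inside that
    of multiplication by u.\<close>
  have u1h: "\<bar>u x\<bar> \<le> 1 * \<bar>1 + h x\<bar>" for x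
  proof -
    have "0 \<le> (u x - 1)\<^sup>2" by simp
    then have "2 * u x \<le> 1 + h x" by (simp add: h_def power2_diff)
    then show ?thesis using pos[of x] h0[of x] by simp
  qed
  have w1: "\<bar>w x\<bar> \<le> 1" for x
    using u1h[of x] h1[of x] by (simp add: w_def abs_mult)
  have r1: "\<bar>r x\<bar> \<le> 1" for x using r01[of x] by simp
  have ur: "u x * r x = w x" for x by (simp add: w_def r_def)
  have uw: "u x * w x = h x * r x" for x by (simp add: w_def r_def h_def power2_eq_square)
  have hrb: "\<bar>h x * r x\<bar> \<le> 1" for x using r01[of x] by (simp add: hr)
  have uu: "mulc M u (mulc M u c) = mulc M h c" if "c \<in> hcarrier (L2 M)" for c
    using that by (simp add: mulc_mulc h_def[abs_def] power2_eq_square)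
  have uC: "mulc M u c \<in> hcarrier (L2 M)" if "c \<in> hcarrier (L2 M)" "mulc M h c \<in> hcarrier (L2 M)" for c
  proof -
    have "mulc M (\<lambda>x. 1 + h x) c \<in> hcarrier (L2 M)"
      using that by (subst mulc_add_left) auto
    then show ?thesis using that u1h by (intro mulc_dominated[of u M "\<lambda>x. 1 + h x" c 1]) auto
  qed
  have comp_uu: "c \<in> odom (op_comp (mop M u) (mop M u)) \<longleftrightarrow>
      c \<in> hcarrier (L2 M) \<and> mulc M u c \<in> hcarrier (L2 M) \<and> mulc M u (mulc M u c) \<in> hcarrier (L2 M)" for c
    by (auto simp: op_comp_def mop_dom mop_app)
  then have dom_uu: "c \<in> odom (op_comp (mop M u) (mop M u)) \<longleftrightarrow> c \<in> hcarrier (L2 M) \<and> mulc M h c \<in> hcarrier (L2 M)" for c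
    using uu uC by metis
  have app_uu: "oapp (op_comp (mop M u) (mop M u)) c = mulc M h c"
    if "c \<in> odom (op_comp (mop M u) (mop M u))" for c
  proof -
    have c: "c \<in> odom (mop M u)" "mulc M u c \<in> odom (mop M u)"
      using that[unfolded comp_uu] by (simp_all add: mop_dom)
    then show ?thesis using uu[of c] by (simp add: op_comp_def mop_app mop_dom)
  qed
  have DD: "c \<in> odom B \<and> oapp B c \<in> odom B \<longleftrightarrow> c \<in> hcarrier (L2 M) \<and> mulc M h c \<in> hcarrier (L2 M)" for c
  proof -
    have "c \<in> odom B \<and> oapp B c \<in> odom B \<longleftrightarrow> c \<in> odom (op_comp B B)" by (simp add: op_comp_def)
    also have "\<dots> \<longleftrightarrow> c \<in> odom (op_comp (mop M u) (mop M u))" using sq by (simp add: op_eq_def)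
    finally show ?thesis using dom_uu by blast
  qed
  have BB: "oapp B (oapp B c) = mulc M h c" if "c \<in> hcarrier (L2 M) \<and> mulc M h c \<in> hcarrier (L2 M)" for c
  proof -
    have "oapp B (oapp B c) = oapp (op_comp B B) c" by (simp add: op_comp_def)
    also have "\<dots> = oapp (op_comp (mop M u) (mop M u)) c"
      using sq that dom_uu[of c] unfolding op_eq_def by blast
    also have "\<dots> = mulc M h c" using that dom_uu app_uu by blast
    finally show ?thesis .
  qed
  have rC: "mulc M r c \<in> hcarrier (L2 M)" "mulc M w c \<in> hcarrier (L2 M)"
    "mulc M (\<lambda>x. h x * r x) c \<in> hcarrier (L2 M)" if "c \<in> hcarrier (L2 M)" for c
    using that r1 w1 hrb by (auto intro!: mulc_bounded[where K = 1])
  have rDD: "mulc M r g \<in> odom B" "oapp B (mulc M r g) \<in> odom B"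
     "oapp B (oapp B (mulc M r g)) = mulc M (\<lambda>x. h x * r x) g" if g: "g \<in> hcarrier (L2 M)" for g
  proof -
    have *: "mulc M r g \<in> hcarrier (L2 M) \<and> mulc M h (mulc M r g) \<in> hcarrier (L2 M)"
      using rC[OF g] g by (simp add: mulc_mulc)
    then show "mulc M r g \<in> odom B" "oapp B (mulc M r g) \<in> odom B" using DD by blast+
    show "oapp B (oapp B (mulc M r g)) = mulc M (\<lambda>x. h x * r x) g"
      using BB[OF *] g by (simp add: mulc_mulc)
  qed
  \<comment> \<open>Bounded symbols commuting with B on its domain. They form an algebra that will
    contain r and the constants, hence all polynomials in r.\<close>
  define Com where "Com a \<longleftrightarrow> a \<in> borel_measurable M \<and> (\<exists>K. \<forall>x. \<bar>a x\<bar> \<le> K) \<and>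
    (\<forall>g\<in>odom B. mulc M a g \<in> odom B \<and> oapp B (mulc M a g) = mulc M a (oapp B g))" for a
  have ComD: "a \<in> borel_measurable M" "g \<in> odom B \<Longrightarrow> mulc M a g \<in> odom B"
     "g \<in> odom B \<Longrightarrow> oapp B (mulc M a g) = mulc M a (oapp B g)"
     "c \<in> hcarrier (L2 M) \<Longrightarrow> mulc M a c \<in> hcarrier (L2 M)" if "Com a" for a g c
    using that mulc_bounded[of a M c] by (auto simp: Com_def)
  have Com_r: "Com r"
    unfolding Com_def
  proof (intro conjI ballI)
    fix g assume g: "g \<in> odom B"
    let ?g = "mulc M r g"
    note gD = rDD[OF sub(1)[OF g]]
    show "?g \<in> odom B" by (rule gD)
    have hrg: "mulc M (\<lambda>x. h x * r x) g = hdiff (L2 M) g ?g"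
      using mulc_diff_left[of "\<lambda>x. 1" M r g] g rC[of g] by (simp add: hr)
    \<comment> \<open>BB(r g) = h r g = g - r g lies again in the domain of B, so B(r g) lies in
      that of BB. There h B(r g) = B(g - r g), that is (1 + h) B(r g) = B g.\<close>
    have "oapp B ?g \<in> odom B \<and> oapp B (oapp B ?g) \<in> odom B"
      unfolding gD(3) hrg using gD(1,2) B_diff[OF g gD(1)] by simp
    then have q: "oapp B ?g \<in> hcarrier (L2 M) \<and> mulc M h (oapp B ?g) \<in> hcarrier (L2 M)"
      using DD by blast
    have "mulc M h (oapp B ?g) = oapp B (hdiff (L2 M) g ?g)"
      using BB[OF q] unfolding gD(3) hrg by simp
    also have "\<dots> = hdiff (L2 M) (oapp B g) (oapp B ?g)"
      using B_diff[OF g gD(1)] by simp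
    finally have e: "mulc M h (oapp B ?g) = hdiff (L2 M) (oapp B g) (oapp B ?g)" .
    have "oapp B g = hadd (L2 M) (oapp B ?g) (mulc M h (oapp B ?g))"
      unfolding e using g gD by (intro L2.inner_ext[where M = M]) auto
    also have "\<dots> = mulc M (\<lambda>x. 1 + h x) (oapp B ?g)"
      using q by (subst mulc_add_left) auto
    finally have "mulc M r (oapp B g) = mulc M r (mulc M (\<lambda>x. 1 + h x) (oapp B ?g))" by simp
    also have "\<dots> = mulc M (\<lambda>x. r x * (1 + h x)) (oapp B ?g)"
      using q by (intro mulc_mulc) auto
    also have "(\<lambda>x. r x * (1 + h x)) = (\<lambda>x. 1)"
      using h1 by (auto simp: r_def fun_eq_iff less_imp_neq[symmetric])
    finally show "oapp B ?g = mulc M r (oapp B g)" using q by simp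
  qed (use r1 in auto)
  have Com_const: "Com (\<lambda>x. t)" for t
  proof -
    have "mulc M (\<lambda>x. t) c = hscale (L2 M) (of_real t) c" if "c \<in> hcarrier (L2 M)" for c
      using mulc_scale_left[of "\<lambda>x. 1" M c t] that by simp
    then show ?thesis unfolding Com_def using B_scale by auto
  qed
  have Com_mult: "Com (\<lambda>x. a x * b x)" if a: "Com a" and b: "Com b" for a b
  proof -
    note [measurable] = ComD(1)[OF a] ComD(1)[OF b]
    obtain K L where "\<And>x. \<bar>a x\<bar> \<le> K" "\<And>x. \<bar>b x\<bar> \<le> L" using a b unfolding Com_def by blast
    then have "\<bar>a x * b x\<bar> \<le> K * L" for x
      unfolding abs_mult by (intro mult_mono) (auto intro: order_trans[OF abs_ge_zero])
    then have "\<exists>K. \<forall>x. \<bar>a x * b x\<bar> \<le> K" by blast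
    moreover have "mulc M (\<lambda>x. a x * b x) c = mulc M a (mulc M b c)" if "c \<in> hcarrier (L2 M)" for c
      using that by (simp add: mulc_mulc)
    ultimately show ?thesis unfolding Com_def using ComD[OF a] ComD[OF b] by auto
  qed
  have Com_add: "Com (\<lambda>x. a x + b x)" if a: "Com a" and b: "Com b" for a b
  proof -
    note [measurable] = ComD(1)[OF a] ComD(1)[OF b]
    obtain K L where KL: "\<And>x. \<bar>a x\<bar> \<le> K" "\<And>x. \<bar>b x\<bar> \<le> L" using a b unfolding Com_def by blast
    have "\<bar>a x + b x\<bar> \<le> K + L" for x
      using KL[of x] by linarith
    then have "\<exists>K. \<forall>x. \<bar>a x + b x\<bar> \<le> K" by blast
    moreover have "mulc M (\<lambda>x. a x + b x) c = hadd (L2 M) (mulc M a c) (mulc M b c)" if "c \<in> hcarrier (L2 M)" for c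
      using that ComD[OF a] ComD[OF b] by (intro mulc_add_left) auto
    ultimately show ?thesis unfolding Com_def using ComD[OF a] ComD[OF b] B_add by auto
  qed
  have Com_poly: "Com (\<lambda>x. p (r x))" if "real_polynomial_function p" for p
    using that
  proof (induction p rule: real_polynomial_function.induct)
    case (linear p)
    \<comment> \<open>A linear function on the real line is multiplication by its value at
      1.\<close>
    have p1: "p y = y * p 1" for y
      using linear_scale[OF bounded_linear.linear[OF linear.hyps], of y 1] by simp
    show ?case by (subst p1) (rule Com_mult[OF Com_r Com_const])
  qed (simp_all add: Com_const Com_add Com_mult)
  have Com_w: "mulc M w g \<in> odom B \<and> oapp B (mulc M w g) = mulc M w (oapp B g)" if g: "g \<in> odom B" for g
  proof -
    have "\<exists>p. real_polynomial_function p \<and> (\<forall>y\<in>{0..1}. \<bar>sqrt (y * (1 - y)) - p y\<bar> < 1 / Suc n)" for n :: nat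
    proof (rule Stone_Weierstrass_real_polynomial_function[of "{0..1::real}" "\<lambda>y. sqrt (y * (1 - y))" "1 / Suc n"])
      show "continuous_on {0..1::real} (\<lambda>y. sqrt (y * (1 - y)))" by (intro continuous_intros)
    qed auto
    then obtain p where p: "\<And>n. real_polynomial_function (p n)"
      "\<And>n y. y \<in> {0..1} \<Longrightarrow> \<bar>sqrt (y * (1 - y)) - p n y\<bar> < 1 / Suc n" by metis
    have rw: "sqrt (r x * (1 - r x)) = w x" for x
    proof -
      have "r x * (1 - r x) = (w x)\<^sup>2" unfolding hr[symmetric]
        by (simp add: r_def w_def h_def power2_eq_square)
      then show ?thesis using pos[of x] h1[of x] by (simp add: w_def)
    qed
    have le: "\<bar>p n (r x) - w x\<bar> \<le> 1 / Suc n" for n x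
      using p(2)[of "r x" n] r01[of x] by (simp add: rw abs_minus_commute)
    note Cp = Com_poly[OF p(1)]
    have conv: "hconv (L2 M) (\<lambda>n. mulc M (\<lambda>x. p n (r x)) c) (mulc M w c)" if c: "c \<in> hcarrier (L2 M)" for c
      unfolding hconv_def
    proof (rule Lim_null_comparison)
      have "hnorm (L2 M) (hdiff (L2 M) (mulc M (\<lambda>x. p n (r x)) c) (mulc M w c)) \<le> 1 / Suc n * hnorm (L2 M) c" for n
      proof -
        have "hdiff (L2 M) (mulc M (\<lambda>x. p n (r x)) c) (mulc M w c) = mulc M (\<lambda>x. p n (r x) - w x) c"
          using c ComD[OF Cp] rC by (intro mulc_diff_left[symmetric]) auto
        moreover have [measurable]: "(\<lambda>x. p n (r x)) \<in> borel_measurable M" by (rule ComD[OF Cp])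
        ultimately show ?thesis using c le by (simp only:) (intro mulc_norm_le, auto)
      qed
      then show "\<forall>\<^sub>F n in sequentially. norm (hnorm (L2 M) (hdiff (L2 M) (mulc M (\<lambda>x. p n (r x)) c) (mulc M w c))) \<le> 1 / Suc n * hnorm (L2 M) c"
        using c ComD(4)[OF Cp] rC by (intro always_eventually allI) simp
      show "(\<lambda>n. 1 / Suc n * hnorm (L2 M) c) \<longlonglongrightarrow> 0"
        by (intro tendsto_mult_left_zero LIMSEQ_Suc[OF lim_1_over_n])
    qed
    have "(\<forall>n. mulc M (\<lambda>x. p n (r x)) g \<in> odom B) \<and> mulc M w g \<in> hcarrier (L2 M) \<and> mulc M w (oapp B g) \<in> hcarrier (L2 M) \<and>
      hconv (L2 M) (\<lambda>n. mulc M (\<lambda>x. p n (r x)) g) (mulc M w g) \<and>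
      hconv (L2 M) (\<lambda>n. oapp B (mulc M (\<lambda>x. p n (r x)) g)) (mulc M w (oapp B g))"
      using g ComD[OF Cp] rC conv by simp
    then show ?thesis
      by (rule L2.selfadjoint_closed[OF B(1), unfolded hclosed_def, rule_format])
  qed
  have main: "g \<in> odom (mop M u) \<and> mulc M u g = oapp B g" if g: "g \<in> odom B" for g
  proof -
    let ?y = "hdiff (L2 M) (mulc M w g) (mulc M r (oapp B g))"
    have gC: "g \<in> hcarrier (L2 M)" "oapp B g \<in> hcarrier (L2 M)" using g by auto
    note [simp] = gC rC[OF gC(1)] rC[OF gC(2)]
    have rBg: "mulc M r (oapp B g) = oapp B (mulc M r g)" using ComD(3)[OF Com_r g] by simp
    have y: "?y \<in> odom B" "oapp B ?y = hdiff (L2 M) (mulc M w (oapp B g)) (mulc M (\<lambda>x. h x * r x) g)"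
      using B_diff[of "mulc M w g" "mulc M r (oapp B g)"] Com_w[OF g] rDD[OF gC(1)] by (simp_all add: rBg)
    have yC: "?y \<in> hcarrier (L2 M)" by simp
    \<comment> \<open>By u w = h r and u r = w this is the negative of B y, where B(r B g) = BB(r g)
      = h r g was used.\<close>
    have uy: "mulc M u ?y = hdiff (L2 M) (mulc M (\<lambda>x. h x * r x) g) (mulc M w (oapp B g))"
      by (subst mulc_diff_right) (simp_all add: mulc_mulc ur uw)
    then have uyC: "mulc M u ?y \<in> hcarrier (L2 M)" by simp
    then have yu: "?y \<in> odom (mop M u)" by (simp add: mop_dom)
    have "hinner (L2 M) (mulc M u ?y) ?y + hinner (L2 M) (oapp B ?y) ?y = 0"
      unfolding uy y(2) by simp
    then have "Re (hinner (L2 M) (mulc M u ?y) ?y) + Re (hinner (L2 M) (oapp B ?y) ?y) = 0"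
      by (metis plus_complex.sel(1) zero_complex.sel(1))
    moreover have "0 \<le> Re (hinner (L2 M) (oapp B ?y) ?y)" using B(2) y(1) unfolding hpositive_def by blast
    moreover have "0 \<le> Re (hinner (L2 M) (mulc M u ?y) ?y)"
      using mop_positive[of u M] pos yu by (auto simp: hpositive_def mop_app)
    ultimately have "Re (hinner (L2 M) (mulc M u ?y) ?y) = 0" by linarith
    then have "(\<integral>x. u x * (cmod (l2rep ?y x))\<^sup>2 \<partial>M) = 0" using mulc_Re_inner(1)[OF u yu] by simp
    then have "AE x in M. u x * (cmod (l2rep ?y x))\<^sup>2 = 0"
      using integral_nonneg_eq_0_iff_AE[OF mulc_Re_inner(2)[OF u yu]] pos by simp
    then have "AE x in M. of_real (u x) * l2rep ?y x = 0" by eventually_elim auto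
    then have uy0: "mulc M u ?y = hzero (L2 M)" unfolding mulc_def L2_zero by (rule l2class_cong)
    have By0: "oapp B ?y = hzero (L2 M)"
    proof (rule L2.inner_ext)
      fix z :: "('a \<Rightarrow> complex) set" assume "z \<in> hcarrier (L2 M)"
      then show "hinner (L2 M) (oapp B ?y) z = hinner (L2 M) (hzero (L2 M)) z"
        using arg_cong[OF uy0, of "\<lambda>v. hinner (L2 M) v z"] unfolding uy y(2) by simp
    qed (use y in auto)
    have rgC: "mulc M r g \<in> hcarrier (L2 M)" by simp
    \<comment> \<open>Since w = u r and r B g = B(r g), y is (u - B)(r g). Symmetry moves u and B
      onto the other factor, where both u y and B y vanish.\<close>
    have "hinner (L2 M) ?y ?y = hinner (L2 M) (mulc M u (mulc M r g)) ?y - hinner (L2 M) (oapp B (mulc M r g)) ?y"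
      using yC by (subst L2.inner_diff_left) (simp_all add: mulc_mulc ur rBg[symmetric])
    also have "hinner (L2 M) (mulc M u (mulc M r g)) ?y = hinner (L2 M) (mulc M r g) (mulc M u ?y)"
      using yC uyC by (intro mulc_inner) (simp_all add: mulc_mulc ur)
    also have "hinner (L2 M) (oapp B (mulc M r g)) ?y = hinner (L2 M) (mulc M r g) (oapp B ?y)"
      by (rule L2.selfadjoint_sym[OF B(1) rDD(1)[OF gC(1)] y(1)])
    finally have "hinner (L2 M) ?y ?y = 0" using rgC by (simp only: uy0 By0 diff_self)
    then have "?y = hzero (L2 M)" by (rule L2.inner_eq_0[OF yC])
    then have "mulc M w g = mulc M r (oapp B g)" by (rule L2.diff_eq_zero[rotated 2]) simp_all
    then have "mulc M (\<lambda>x. 1 + h x) (mulc M w g) = mulc M (\<lambda>x. 1 + h x) (mulc M r (oapp B g))" by simp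
    moreover have "(1 + h x) * w x = u x" "(1 + h x) * r x = 1" for x
      using h1[of x] by (auto simp: w_def r_def)
    ultimately have "mulc M u g = oapp B g" by (simp add: mulc_mulc)
    then show ?thesis by (simp add: mop_dom)
  qed
  \<comment> \<open>A selfadjoint operator has no proper symmetric extension: the weak equation for
    f tested on the domain of B puts f into that domain.\<close>
  have sub2: "odom (mop M u) \<subseteq> odom B"
  proof
    fix f assume f: "f \<in> odom (mop M u)"
    have "hinner (L2 M) (oapp B g) f = hinner (L2 M) g (mulc M u f)" if "g \<in> odom B" for g
      using main[OF that] f by (auto simp: mop_dom mulc_inner simp flip: main[OF that, THEN conjunct2])
    then show "f \<in> odom B" using B(1) f unfolding L2.selfadjoint_iff mop_dom by blast
  qed
  have "odom B = odom (mop M u)" using main sub2 by blast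
  moreover have "oapp B = oapp (mop M u)"
  proof
    fix f show "oapp B f = oapp (mop M u) f"
      using main[of f] off[of f] mop_off[of f M u] mop_app[of f M u] \<open>odom B = odom (mop M u)\<close> by (cases "f \<in> odom B") auto
  qed
  ultimately show ?thesis by (simp add: prod_eq_iff)
qed

section \<open>Weighted composition\<close>

text \<open>Tagging by the sign of the real part makes the images of the two components disjoint, so a
  pair of sets of functions is recovered from the union.\<close>
definition encode_pair :: "('b \<Rightarrow> complex) set \<times> ('b \<Rightarrow> complex) set \<Rightarrow> ('b \<Rightarrow> complex) set" where
  "encode_pair cd = (\<lambda>f x. Complex (exp (Re (f x))) (Im (f x))) ` fst cd \<union>
     (\<lambda>f x. Complex (- exp (Re (f x))) (Im (f x))) ` snd cd"

lemma disjoint_image_preimage: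
  assumes "inj p" "\<And>f g. p f \<noteq> m g"
  shows "{f. p f \<in> p ` A \<union> m ` B} = A"
  using assms by (auto dest: injD)

lemma inj_encode_pair: "inj encode_pair"
proof (rule inj_on_inverseI)
  fix cd :: "('b \<Rightarrow> complex) set \<times> ('b \<Rightarrow> complex) set"
  let ?p = "\<lambda>(f :: 'b \<Rightarrow> complex) x. Complex (exp (Re (f x))) (Im (f x))"
  let ?m = "\<lambda>(f :: 'b \<Rightarrow> complex) x. Complex (- exp (Re (f x))) (Im (f x))"
  have inj: "inj ?p" "inj ?m" by (auto simp: inj_def fun_eq_iff complex_eq_iff)
  have pm: "?p f \<noteq> ?m g" for f g
  proof -
    \<comment> \<open>Every type is inhabited, so the signs can be compared at one point.\<close>
    have "Re (?p f undefined) > 0" "Re (?m g undefined) < 0" by simp_all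
    then show ?thesis by (metis less_asym)
  qed
  have "{f. ?p f \<in> encode_pair cd} = fst cd"
    unfolding encode_pair_def by (rule disjoint_image_preimage[OF inj(1) pm])
  moreover have "{f. ?m f \<in> encode_pair cd} = snd cd"
    unfolding encode_pair_def by (subst Un_commute, rule disjoint_image_preimage[OF inj(2) pm[symmetric]])
  ultimately show "(\<lambda>d. ({f. ?p f \<in> d}, {f. ?m f \<in> d})) (encode_pair cd) = cd" by simp
qed

text \<open>The product space is abstracted to a transformation whose pushforward has density k.
  Positivity and invariance hold at every point, so that sqrt k can be divided by and moved past
  \<Phi> without exceptional sets.\<close>

locale weighted_comp =
  fixes R :: "'b measure" and \<Phi> :: "'b \<Rightarrow> 'b" and k :: "'b \<Rightarrow> real"
  assumes \<Phi> [measurable]: "\<Phi> \<in> measurable R R"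
    and k [measurable]: "k \<in> borel_measurable R"
    and k_pos: "\<And>z. 0 < k z" and k_inv: "\<And>z. k (\<Phi> z) = k z"
    and distr_\<Phi>: "distr R R \<Phi> = density R (\<lambda>z. ennreal (k z))"
begin

lemma AE_comp: "AE z in R. Q z \<Longrightarrow> AE z in R. Q (\<Phi> z)"
proof -
  assume "AE z in R. Q z"
  then have "AE z in density R (\<lambda>z. ennreal (k z)). Q z"
    by (subst AE_density) (auto elim: eventually_mono)
  then show ?thesis unfolding distr_\<Phi>[symmetric] by (rule AE_distrD[OF \<Phi>])
qed

lemma nonsingular_\<Phi>: "nonsingular R \<Phi>"
  unfolding nonsingular_def
proof (intro conjI ballI impI)
  fix A assume A: "A \<in> sets R" "emeasure R A = 0"
  have "emeasure R (\<Phi> -` A \<inter> space R) = emeasure (density R (\<lambda>z. ennreal (k z))) A"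
    using A by (simp add: emeasure_distr flip: distr_\<Phi>)
  also have "\<dots> = 0"
    using A by (subst emeasure_density) (auto intro!: nn_integral_null_set)
  finally show "emeasure R (\<Phi> -` A \<inter> space R) = 0" .
qed (rule \<Phi>)

definition "u z = sqrt (k z)"

lemma u [measurable]: "u \<in> borel_measurable R" unfolding u_def[abs_def] by measurable
lemma u_pos: "0 < u z" using k_pos by (simp add: u_def)
lemma u_inv [simp]: "u (\<Phi> z) = u z" by (simp add: u_def k_inv)
lemma u_nonzero [simp]: "u z \<noteq> 0" using u_pos[of z] by simp

lemma nn_integral_comp: "f \<in> borel_measurable R \<Longrightarrow> (\<integral>\<^sup>+ z. f (\<Phi> z) \<partial>R) = (\<integral>\<^sup>+ z. ennreal (k z) * f z \<partial>R)"
  using nn_integral_distr[OF \<Phi>, of f] nn_integral_density[of "\<lambda>z. ennreal (k z)" R f] by (simp add: distr_\<Phi>)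

lemma comp_class: "f \<in> borel_measurable R \<Longrightarrow>
    l2class R (\<lambda>z. l2rep (l2class R f) (\<Phi> z)) = l2class R (\<lambda>z. f (\<Phi> z))"
  by (intro l2class_cong AE_comp[OF l2rep_class(2)])

text \<open>The change of variables turns the integral of |f o \<Phi>|^2 into that of k |f|^2 = |u
  f|^2. This equates the domain of the composition operator with that of multiplication by
  u.\<close>

lemma sqi_comp:
  assumes [measurable]: "f \<in> borel_measurable R"
  shows "sqi R (\<lambda>z. f (\<Phi> z)) \<longleftrightarrow> sqi R (\<lambda>z. of_real (u z) * f z)"
proof -
  have "(\<integral>\<^sup>+ z. ennreal ((cmod (f (\<Phi> z)))\<^sup>2) \<partial>R) = (\<integral>\<^sup>+ z. ennreal (k z) * ennreal ((cmod (f z))\<^sup>2) \<partial>R)"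
    by (rule nn_integral_comp) measurable
  also have "\<dots> = (\<integral>\<^sup>+ z. ennreal ((cmod (of_real (u z) * f z))\<^sup>2) \<partial>R)"
    using k_pos by (intro nn_integral_cong)
      (simp add: norm_mult power_mult_distrib u_def less_imp_le flip: ennreal_mult')
  finally show ?thesis by (simp add: sqi_def)
qed

definition V :: "('b \<Rightarrow> complex) set \<Rightarrow> ('b \<Rightarrow> complex) set" where
  "V c = l2class R (\<lambda>z. l2rep c (\<Phi> z) / of_real (u z))"

lemma V_class: "f \<in> borel_measurable R \<Longrightarrow> V (l2class R f) = l2class R (\<lambda>z. f (\<Phi> z) / of_real (u z))"
  unfolding V_def using AE_comp[OF l2rep_class(2)[of f R]]
  by (intro l2class_cong) (auto elim: eventually_mono)

lemma sqi_V:
  assumes f: "sqi R f" shows "sqi R (\<lambda>z. f (\<Phi> z) / of_real (u z))"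
proof -
  note [measurable] = sqi_measurable[OF f]
  have "sqi R (\<lambda>z. (\<lambda>z. f z / of_real (u z)) (\<Phi> z))"
    using f by (subst sqi_comp) auto
  then show ?thesis by simp
qed

text \<open>By invariance of k the integrand is a function of \<Phi> z, and its factor 1/k cancels
  the density k of the pushforward.\<close>

lemma V_inner:
  assumes f: "sqi R f" and g: "sqi R g"
  shows "hinner (L2 R) (V (l2class R f)) (V (l2class R g)) = hinner (L2 R) (l2class R f) (l2class R g)"
proof -
  note [measurable] = f[THEN sqi_measurable] g[THEN sqi_measurable]
  have kn: "k z \<noteq> 0" "0 \<le> k z" for z using k_pos[of z] by auto
  have uu: "complex_of_real (u z) * complex_of_real (u z) = complex_of_real (k z)" for z
    using kn by (simp add: u_def flip: of_real_mult)
  have "(\<integral>z. f (\<Phi> z) / of_real (u z) * cnj (g (\<Phi> z) / of_real (u z)) \<partial>R)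
      = (\<integral>z. (\<lambda>z. f z * cnj (g z) / of_real (k z)) (\<Phi> z) \<partial>R)"
    by (intro Bochner_Integration.integral_cong) (simp_all add: k_inv uu)
  also have "\<dots> = (\<integral>z. f z * cnj (g z) / of_real (k z) \<partial>(distr R R \<Phi>))"
    by (intro integral_distr[symmetric]) measurable
  also have "\<dots> = (\<integral>z. k z *\<^sub>R (f z * cnj (g z) / of_real (k z)) \<partial>R)"
    unfolding distr_\<Phi> using kn by (intro integral_density) auto
  also have "\<dots> = (\<integral>z. f z * cnj (g z) \<partial>R)"
    using kn by (intro Bochner_Integration.integral_cong) (auto simp: scaleR_conv_of_real)
  finally show ?thesis using f g by (simp add: V_class sqi_V sqi_measurable)
qed

lemma V_hlin: "hlin (L2 R) V"
  unfolding hlin_def carrier_L2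
  by (auto simp: V_class sqi_V sqi_measurable add_divide_distrib intro!: imageI)

lemma V_iso: "x \<in> hcarrier (L2 R) \<Longrightarrow> y \<in> hcarrier (L2 R) \<Longrightarrow>
    hinner (L2 R) (V x) (V y) = hinner (L2 R) x y"
  unfolding carrier_L2 by (elim imageE) (simp only: mem_Collect_eq V_inner)

lemma odom_comp_class:
  assumes "sqi R f"
  shows "l2class R f \<in> odom (comp_op R \<Phi>) \<longleftrightarrow> sqi R (\<lambda>z. f (\<Phi> z))"
    "l2class R f \<in> odom (mop R u) \<longleftrightarrow> sqi R (\<lambda>z. f (\<Phi> z))"
proof -
  note [measurable] = sqi_measurable[OF assms]
  show "l2class R f \<in> odom (comp_op R \<Phi>) \<longleftrightarrow> sqi R (\<lambda>z. f (\<Phi> z))"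
    using assms by (simp add: comp_op_def comp_class class_carrier_iff)
  show "l2class R f \<in> odom (mop R u) \<longleftrightarrow> sqi R (\<lambda>z. f (\<Phi> z))"
    using assms by (simp add: mop_dom mulc_class class_carrier_iff sqi_comp)
qed

lemma odom_comp: "odom (comp_op R \<Phi>) = odom (mop R u)"
proof (rule set_eqI)
  fix c
  have "c \<in> hcarrier (L2 R)" if "c \<in> odom (comp_op R \<Phi>) \<or> c \<in> odom (mop R u)"
    using that by (auto simp: comp_op_def mop_dom)
  moreover have "c \<in> odom (comp_op R \<Phi>) \<longleftrightarrow> c \<in> odom (mop R u)" if "c \<in> hcarrier (L2 R)"
    using that by (auto simp: carrier_L2 odom_comp_class)
  ultimately show "c \<in> odom (comp_op R \<Phi>) \<longleftrightarrow> c \<in> odom (mop R u)" by blast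
qed

text \<open>V divides by u, and u is invariant, so both V (u f) and u (V f) equal f o
  \<Phi>.\<close>

lemma comp_app:
  assumes "c \<in> odom (mop R u)"
  shows "oapp (comp_op R \<Phi>) c = V (oapp (mop R u) c)"
    and "V c \<in> odom (mop R u) \<and> oapp (mop R u) (V c) = V (oapp (mop R u) c)"
proof -
  obtain f where f: "sqi R f" "c = l2class R f" using assms by (auto simp: mop_dom carrier_L2)
  note [measurable] = f(1)[THEN sqi_measurable]
  have fs: "sqi R (\<lambda>z. f (\<Phi> z))" using assms f odom_comp_class by simp
  have VS: "V (oapp (mop R u) c) = l2class R (\<lambda>z. f (\<Phi> z))"
    using assms by (simp add: mop_app f(2) mulc_class V_class)
  then show "oapp (comp_op R \<Phi>) c = V (oapp (mop R u) c)"
    by (simp add: comp_op_def f(2) comp_class)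
  have uV: "mulc R u (V c) = l2class R (\<lambda>z. f (\<Phi> z))"
    by (simp add: f(2) V_class mulc_class)
  have "V c \<in> hcarrier (L2 R)" using sqi_V[OF f(1)] by (simp add: f(2) V_class)
  then have "V c \<in> odom (mop R u)" using fs by (simp add: mop_dom uV)
  then show "V c \<in> odom (mop R u) \<and> oapp (mop R u) (V c) = V (oapp (mop R u) c)"
    by (simp add: mop_app uV VS)
qed

lemma comp_op_quasinormal: "hquasinormal (L2 R) (comp_op R \<Phi>)"
proof (rule L2.quasinormalI[where S = "mop R u" and V = V])
  show "hselfadjoint (L2 R) (mop R u)" by (rule mop_selfadjoint[OF u])
  show "hpositive (L2 R) (mop R u)" using u_pos by (intro mop_positive u) (simp add: less_imp_le)
  show "B = mop R u" if "hselfadjoint (L2 R) B" "hpositive (L2 R) B"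
    "op_eq (op_comp B B) (op_comp (mop R u) (mop R u))" "\<And>f. f \<notin> odom B \<Longrightarrow> oapp B f = hzero (L2 R)" for B
    using u_pos that by (intro mop_sqrt_unique u) (simp_all add: less_imp_le)
  show "f = hzero (L2 R)" if f: "f \<in> odom (mop R u)" "oapp (mop R u) f = hzero (L2 R)" for f
  proof -
    obtain g where g: "sqi R g" "f = l2class R g" using f by (auto simp: mop_dom carrier_L2)
    note [measurable] = g(1)[THEN sqi_measurable]
    have "AE z in R. of_real (u z) * g z = 0"
      using f(2) unfolding mop_app[OF f(1)] L2_zero unfolding g(2) by (simp add: mulc_class l2class_eq_iff)
    then have "AE z in R. g z = 0" by eventually_elim simp
    then show ?thesis unfolding g(2) L2_zero by (rule l2class_cong)
  qed
qed (simp_all add: mop_off V_hlin V_iso comp_app odom_comp)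

text \<open>The extension space has vectors of the same type as L2 R; \<open>encode_pair\<close>
  puts the direct sum there, and f is sent to the code of (f, 0).\<close>

lemma comp_op_normal_extension:
  "\<exists>(K :: ('b \<Rightarrow> complex) set hilbert) W N. is_hilbert K \<and> hiso_embed (L2 R) K W \<and> hnormal K N \<and>
     (\<forall>f\<in>odom (comp_op R \<Phi>). W f \<in> odom N \<and> oapp N (W f) = W (oapp (comp_op R \<Phi>) f))"
proof -
  interpret S: hilb_sum "L2 R" encode_pair
    by unfold_locales (rule inj_on_subset[OF inj_encode_pair subset_UNIV])
  obtain N where N: "hnormal (hsum (L2 R) encode_pair) N"
      "\<forall>f\<in>odom (mop R u). encode_pair (f, hzero (L2 R)) \<in> odom N \<and>
         oapp N (encode_pair (f, hzero (L2 R))) = encode_pair (V (oapp (mop R u) f), hzero (L2 R))"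
    using S.isometry_selfadjoint_normal_extension[OF mop_selfadjoint[OF u] V_hlin V_iso comp_app(2)] by blast
  have z: "hadd (L2 R) (hzero (L2 R)) (hzero (L2 R)) = hzero (L2 R)"
    "hscale (L2 R) a (hzero (L2 R)) = hzero (L2 R)" for a
    by (rule L2.inner_ext[where M = R]; simp)+
  have "hiso_embed (L2 R) (hsum (L2 R) encode_pair) (\<lambda>f. encode_pair (f, hzero (L2 R)))"
    unfolding hiso_embed_def by (simp add: z)
  then show ?thesis
    using N S.sum_hilbert
    by (intro exI[of _ "hsum (L2 R) encode_pair"] exI[of _ "\<lambda>f. encode_pair (f, hzero (L2 R))"] exI[of _ N])
      (simp add: odom_comp comp_app)
qed

end

section \<open>Conditional expectation along a transformation\<close>

text \<open>Composition respects equality almost everywhere, so the representative picked by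
  \<open>l2rep\<close> does not affect the composition operator.\<close>

lemma nonsingular_AE:
  assumes ns: "nonsingular M \<phi>" and ae: "AE x in M. Q x"
  shows "AE x in M. Q (\<phi> x)"
proof -
  have [measurable]: "\<phi> \<in> measurable M M" using ns by (simp add: nonsingular_def)
  from ae obtain N where N: "{x \<in> space M. \<not> Q x} \<subseteq> N" "emeasure M N = 0" "N \<in> sets M" by (rule AE_E)
  show ?thesis
  proof (rule AE_I)
    show "{x \<in> space M. \<not> Q (\<phi> x)} \<subseteq> \<phi> -` N \<inter> space M"
      using N measurable_space[of \<phi> M M] by auto
    show "emeasure M (\<phi> -` N \<inter> space M) = 0" using ns N by (simp add: nonsingular_def)
  qed (use N in measurable)
qed

lemma nonsingular_class:
  assumes "nonsingular M \<phi>" "f \<in> borel_measurable M"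
  shows "l2class M (\<lambda>x. l2rep (l2class M f) (\<phi> x)) = l2class M (\<lambda>x. f (\<phi> x))"
  by (rule l2class_cong[OF nonsingular_AE[OF assms(1) l2rep_class(2)[OF assms(2)]]])

lemma odom_comp_op_class:
  assumes ns: "nonsingular M \<phi>" and f: "sqi M f"
  shows "l2class M f \<in> odom (comp_op M \<phi>) \<longleftrightarrow> sqi M (\<lambda>x. f (\<phi> x))"
proof -
  have [measurable]: "\<phi> \<in> measurable M M" using ns by (simp add: nonsingular_def)
  note [measurable] = sqi_measurable[OF f]
  show ?thesis using f
    by (simp add: comp_op_def nonsingular_class[OF ns] class_carrier_iff)
qed

lemma oapp_comp_op_class:
  "nonsingular M \<phi> \<Longrightarrow> f \<in> borel_measurable M \<Longrightarrow>
    oapp (comp_op M \<phi>) (l2class M f) = l2class M (\<lambda>x. f (\<phi> x))"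
  by (simp add: comp_op_def nonsingular_class)

text \<open>Doob-Dynkin factorisation: indicators factor because the sets are preimages, and
  factoring through \<phi> survives sums, multiples and monotone suprema.\<close>

lemma measurable_vimage_algebra_factor:
  fixes e :: "'a \<Rightarrow> ennreal"
  assumes \<phi>: "\<phi> \<in> X \<rightarrow> space M" and e: "e \<in> borel_measurable (vimage_algebra X \<phi> M)"
  shows "\<exists>g\<in>borel_measurable M. \<forall>x\<in>X. e x = g (\<phi> x)"
  using e
proof (induction rule: borel_measurable_induct)
  case (set A)
  then obtain B where "B \<in> sets M" "A = \<phi> -` B \<inter> X" using \<phi> by (auto simp: sets_vimage_algebra2)
  then show ?case by (intro bexI[of _ "indicator B"]) (auto simp: indicator_def)
next
  case (cong f g)
  then show ?case by auto
next
  case (mult u c)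
  then obtain g where "g \<in> borel_measurable M" "\<forall>x\<in>X. u x = g (\<phi> x)" by blast
  then show ?case by (intro bexI[of _ "\<lambda>y. c * g y"]) auto
next
  case (add u v)
  then obtain g h where "g \<in> borel_measurable M" "\<forall>x\<in>X. u x = g (\<phi> x)"
     "h \<in> borel_measurable M" "\<forall>x\<in>X. v x = h (\<phi> x)" by blast
  then show ?case by (intro bexI[of _ "\<lambda>y. h y + g y"]) auto
next
  case (seq U)
  then obtain g where g: "\<And>i. g i \<in> borel_measurable M" "\<And>i x. x \<in> X \<Longrightarrow> U i x = g i (\<phi> x)" by metis
  \<comment> \<open>The factors g i need not increase off the range of \<phi>; their pointwise
    supremum serves all the same.\<close>
  then show ?case by (intro bexI[of _ "\<lambda>y. SUP i. g i y"]) (auto simp: image_comp)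
qed

section \<open>The Radon-Nikodym density h and conditional expectations\<close>

locale dense_comp_op = sigma_finite_measure M for M :: "'a measure" +
  fixes \<phi> :: "'a \<Rightarrow> 'a"
  assumes nonsingular: "nonsingular M \<phi>"
    and dense: "densely_defined (L2 M) (comp_op M \<phi>)"
begin

abbreviation "h \<equiv> hphi M \<phi>"

lemma \<phi> [measurable]: "\<phi> \<in> measurable M M"
  using nonsingular by (simp add: nonsingular_def)

lemma h [measurable]: "h \<in> borel_measurable M"
  by (simp add: hphi_def)

lemma density_h: "density M h = distr M M \<phi>"
  unfolding hphi_def
proof (rule density_RN_deriv)
  show "absolutely_continuous M (distr M M \<phi>)"
    unfolding absolutely_continuous_def
  proof
    fix N assume "N \<in> null_sets M"
    then show "N \<in> null_sets (distr M M \<phi>)"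
      using nonsingular by (auto simp: null_sets_def emeasure_distr nonsingular_def)
  qed
qed simp

lemma nn_integral_\<phi>: "G \<in> borel_measurable M \<Longrightarrow> (\<integral>\<^sup>+ x. G (\<phi> x) \<partial>M) = (\<integral>\<^sup>+ x. h x * G x \<partial>M)"
  using nn_integral_distr[OF \<phi>, of G] nn_integral_density[OF h, of G] by (simp add: density_h)

text \<open>The law of \<phi> has density h, so its null sets are those negligible on {h > 0}. In
  particular h (\<phi> x) is nonzero for almost every x.\<close>

lemma AE_\<phi>_iff:
  assumes [measurable]: "Measurable.pred M Q"
  shows "(AE x in M. Q (\<phi> x)) \<longleftrightarrow> (AE x in M. 0 < h x \<longrightarrow> Q x)"
  using AE_distr_iff[OF \<phi>, of Q] AE_density[OF h, of Q] unfolding density_h by simp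

text \<open>A function in the domain vanishes almost everywhere where \<^term>\<open>h\<close> is infinite, so it is at
  distance at least $\mu(E)^{1/2}$ from the indicator of a subset \<^term>\<open>E\<close> of that set.\<close>
lemma h_finite: "AE x in M. h x \<noteq> \<infinity>"
proof -
  have null: "emeasure M E = 0" if E [measurable]: "E \<in> sets M" and hE: "\<And>x. x \<in> E \<Longrightarrow> h x = \<infinity>"
    and fin: "emeasure M E \<noteq> \<infinity>" for E
  proof (rule ccontr)
    assume "emeasure M E \<noteq> 0"
    then have pos: "measure M E > 0" using fin
      by (metis emeasure_eq_ennreal_measure ennreal_0 infinity_ennreal_def measure_nonneg order_le_less)
    define f where "f = (\<lambda>x. indicator E x :: complex)"
    have [measurable]: "f \<in> borel_measurable M" unfolding f_def by measurable
    have "(\<integral>\<^sup>+ x. ennreal ((cmod (f x))\<^sup>2) \<partial>M) = (\<integral>\<^sup>+ x. indicator E x \<partial>M)"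
      by (intro nn_integral_cong) (simp add: f_def indicator_def)
    then have f: "sqi M f" using fin by (simp add: sqi_def less_top[symmetric])
    obtain c where c: "c \<in> odom (comp_op M \<phi>)" "hnorm (L2 M) (hdiff (L2 M) (l2class M f) c) < sqrt (measure M E)"
      using dense f pos unfolding densely_defined_def hdense_def by (metis class_carrier real_sqrt_gt_0_iff)
    then have "c \<in> hcarrier (L2 M)" by (simp add: comp_op_def)
    then obtain g where g: "sqi M g" "c = l2class M g" by (auto simp: carrier_L2)
    note [measurable] = sqi_measurable[OF g(1)]
    have "sqi M (\<lambda>x. g (\<phi> x))" using c(1) g odom_comp_op_class[OF nonsingular] by simp
    then have "(\<integral>\<^sup>+ x. h x * ennreal ((cmod (g x))\<^sup>2) \<partial>M) \<noteq> \<infinity>"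
      by (subst nn_integral_\<phi>[symmetric]) (auto simp: sqi_def)
    then have "AE x in M. h x * ennreal ((cmod (g x))\<^sup>2) \<noteq> \<infinity>"
      by (intro nn_integral_PInf_AE) auto
    then have g0: "AE x in M. x \<in> E \<longrightarrow> g x = 0"
    proof eventually_elim
      fix x assume *: "h x * ennreal ((cmod (g x))\<^sup>2) \<noteq> \<infinity>"
      show "x \<in> E \<longrightarrow> g x = 0"
      proof (rule impI, rule ccontr)
        assume "x \<in> E" "g x \<noteq> 0"
        then show False using * hE[of x] by (simp add: ennreal_top_mult)
      qed
    qed
    have "measure M E = (\<integral>x. indicator E x \<partial>M)" using E by simp
    also have "\<dots> \<le> (\<integral>x. (cmod (f x - g x))\<^sup>2 \<partial>M)"
    proof (rule integral_mono_AE)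
      show "integrable M (indicator E :: 'a \<Rightarrow> real)" using fin by (simp add: integrable_indicator_iff less_top[symmetric])
      show "integrable M (\<lambda>x. (cmod (f x - g x))\<^sup>2)" using sqi_diff[OF f g(1)] by (simp add: sqi_iff)
      show "AE x in M. indicator E x \<le> (cmod (f x - g x))\<^sup>2"
        using g0 by eventually_elim (auto simp: f_def indicator_def)
    qed
    also have "\<dots> = (hnorm (L2 M) (hdiff (L2 M) (l2class M f) c))\<^sup>2"
      using f g by (simp add: L2_norm)
    also have "\<dots> < (sqrt (measure M E))\<^sup>2"
      using c(2) f g by (intro power_strict_mono) (auto intro!: L2.norm_ge_0)
    finally show False by simp
  qed
  \<comment> \<open>The indicator argument requires finite measure, so {h = \<infinity>} is cut
    along a sigma-finite exhaustion.\<close>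
  obtain A :: "nat \<Rightarrow> 'a set" where A: "range A \<subseteq> sets M" "(\<Union>i. A i) = space M" "\<And>i. emeasure M (A i) \<noteq> \<infinity>"
    using sigma_finite by blast
  have [measurable]: "A i \<in> sets M" for i using A by auto
  have "AE x in M. \<not> (x \<in> A i \<and> h x = \<infinity>)" for i
  proof -
    have "emeasure M {x \<in> space M. x \<in> A i \<and> h x = \<infinity>} \<le> emeasure M (A i)"
      by (intro emeasure_mono) auto
    then have "emeasure M {x \<in> space M. x \<in> A i \<and> h x = \<infinity>} \<noteq> \<infinity>"
      using A(3)[of i] by (auto simp: top_unique)
    then have "emeasure M {x \<in> space M. x \<in> A i \<and> h x = \<infinity>} = 0"
      by (intro null) auto
    then show ?thesis by (subst AE_iff_measurable[OF _ refl]) auto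
  qed
  then have "AE x in M. \<forall>i. \<not> (x \<in> A i \<and> h x = \<infinity>)" by (subst AE_all_countable) blast
  then show ?thesis
    by (rule AE_mp) (use A(2) in \<open>auto intro!: AE_I2\<close>)
qed

lemma sigma_finite_distr: "sigma_finite_measure (distr M M \<phi>)"
  unfolding density_h[symmetric] using sigma_finite_iff_density_finite[OF h] h_finite by simp

text \<open>The image under \<phi> of f\<mu> is absolutely continuous with respect to the image of
  \<mu>, which is sigma-finite because h is finite a.e. The Radon-Nikodym density g, composed with
  \<phi>, is a conditional expectation of f.\<close>

lemma weighted_density_exists:
  assumes f [measurable]: "f \<in> borel_measurable M"
  shows "\<exists>g\<in>borel_measurable M.
    \<forall>G\<in>borel_measurable M. (\<integral>\<^sup>+ x. G (\<phi> x) * f x \<partial>M) = (\<integral>\<^sup>+ x. G (\<phi> x) * g (\<phi> x) \<partial>M)"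
proof -
  interpret D: sigma_finite_measure "distr M M \<phi>" by (rule sigma_finite_distr)
  define \<nu> where "\<nu> = distr (density M f) M \<phi>"
  have \<phi>f: "\<phi> \<in> measurable (density M f) M" by simp
  have "\<exists>g\<in>borel_measurable (distr M M \<phi>). density (distr M M \<phi>) g = \<nu>"
  proof (rule D.Radon_Nikodym)
    show "absolutely_continuous (distr M M \<phi>) \<nu>"
      unfolding absolutely_continuous_def
    proof
      fix N assume "N \<in> null_sets (distr M M \<phi>)"
      then have N: "N \<in> sets M" "\<phi> -` N \<inter> space M \<in> null_sets M"
        by (auto simp: null_sets_def emeasure_distr)
      then have "emeasure \<nu> N = emeasure (density M f) (\<phi> -` N \<inter> space M)"
        unfolding \<nu>_def by (subst emeasure_distr[OF \<phi>f]) auto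
      also have "\<dots> = 0" using N by (subst emeasure_density) (auto intro!: nn_integral_null_set)
      finally show "N \<in> null_sets \<nu>" using N by (auto simp: null_sets_def \<nu>_def)
    qed
  qed (simp add: \<nu>_def)
  then obtain g where g [measurable]: "g \<in> borel_measurable M" and eq: "density (distr M M \<phi>) g = \<nu>" by auto
  have "(\<integral>\<^sup>+ x. G (\<phi> x) * f x \<partial>M) = (\<integral>\<^sup>+ x. G (\<phi> x) * g (\<phi> x) \<partial>M)"
    if [measurable]: "G \<in> borel_measurable M" for G
  proof -
    have "(\<integral>\<^sup>+ x. G (\<phi> x) * f x \<partial>M) = (\<integral>\<^sup>+ x. G (\<phi> x) \<partial>density M f)"
      by (subst nn_integral_density) (auto simp: mult.commute)
    also have "\<dots> = (\<integral>\<^sup>+ x. G x \<partial>\<nu>)" unfolding \<nu>_def by (subst nn_integral_distr[OF \<phi>f]) auto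
    also have "\<dots> = (\<integral>\<^sup>+ x. g x * G x \<partial>distr M M \<phi>)"
      unfolding eq[symmetric] by (subst nn_integral_density) auto
    also have "\<dots> = (\<integral>\<^sup>+ x. g (\<phi> x) * G (\<phi> x) \<partial>M)" by (subst nn_integral_distr) auto
    finally show ?thesis by (simp add: mult.commute)
  qed
  then show ?thesis using g by blast
qed

text \<open>Existence makes the choice in the definition a genuine conditional expectation.\<close>

lemma cond_exp_phi:
  assumes f: "f \<in> borel_measurable M"
  shows "cond_exp_phi M \<phi> f \<in> borel_measurable (vimage_algebra (space M) \<phi> M)"
    and "\<forall>g\<in>borel_measurable M. (\<integral>\<^sup>+ x. g (\<phi> x) * f x \<partial>M) = (\<integral>\<^sup>+ x. g (\<phi> x) * cond_exp_phi M \<phi> f x \<partial>M)"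
proof -
  obtain g where g: "g \<in> borel_measurable M"
    "\<forall>G\<in>borel_measurable M. (\<integral>\<^sup>+ x. G (\<phi> x) * f x \<partial>M) = (\<integral>\<^sup>+ x. G (\<phi> x) * g (\<phi> x) \<partial>M)"
    using weighted_density_exists[OF f] by blast
  have "\<phi> \<in> space M \<rightarrow> space M" using measurable_space[OF \<phi>] by auto
  then have "(\<lambda>x. g (\<phi> x)) \<in> borel_measurable (vimage_algebra (space M) \<phi> M)"
    by (intro measurable_compose[OF measurable_vimage_algebra1 g(1)])
  with g(2) have "\<exists>e. e \<in> borel_measurable (vimage_algebra (space M) \<phi> M) \<and>
     (\<forall>g\<in>borel_measurable M. (\<integral>\<^sup>+ x. g (\<phi> x) * f x \<partial>M) = (\<integral>\<^sup>+ x. g (\<phi> x) * e x \<partial>M))" by blast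
  from someI_ex[OF this, folded cond_exp_phi_def]
  show "cond_exp_phi M \<phi> f \<in> borel_measurable (vimage_algebra (space M) \<phi> M)"
    and "\<forall>g\<in>borel_measurable M. (\<integral>\<^sup>+ x. g (\<phi> x) * f x \<partial>M) = (\<integral>\<^sup>+ x. g (\<phi> x) * cond_exp_phi M \<phi> f x \<partial>M)"
    by blast+
qed

text \<open>A Doob-Dynkin factor g is reset to 0 on {h = 0}. The identity with E(f) survives because
  \<phi> avoids that set almost everywhere.\<close>

lemma cond_exp_inv:
  assumes f: "f \<in> borel_measurable M"
  shows "cond_exp_inv M \<phi> f \<in> borel_measurable M"
    and "AE x in M. h x = 0 \<longrightarrow> cond_exp_inv M \<phi> f x = 0"
    and "AE x in M. cond_exp_phi M \<phi> f x = cond_exp_inv M \<phi> f (\<phi> x)"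
proof -
  have "\<phi> \<in> space M \<rightarrow> space M" using measurable_space[OF \<phi>] by auto
  from measurable_vimage_algebra_factor[OF this cond_exp_phi(1)[OF f]]
  obtain g where [measurable]: "g \<in> borel_measurable M" and g: "\<And>x. x \<in> space M \<Longrightarrow> cond_exp_phi M \<phi> f x = g (\<phi> x)"
    by blast
  define g' where "g' x = (if h x = 0 then 0 else g x)" for x
  have [measurable]: "g' \<in> borel_measurable M" unfolding g'_def by measurable
  have "AE x in M. h (\<phi> x) \<noteq> 0" by (subst AE_\<phi>_iff) auto
  then have "AE x in M. cond_exp_phi M \<phi> f x = g' (\<phi> x)"
    by (rule AE_mp) (auto intro!: AE_I2 simp: g'_def g)
  moreover have "AE x in M. h x = 0 \<longrightarrow> g' x = 0" by (simp add: g'_def)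
  ultimately have "\<exists>g. g \<in> borel_measurable M \<and> (AE x in M. h x = 0 \<longrightarrow> g x = 0) \<and>
     (AE x in M. cond_exp_phi M \<phi> f x = g (\<phi> x))" by (intro exI[of _ g']) auto
  from someI_ex[OF this, folded cond_exp_inv_def]
  show "cond_exp_inv M \<phi> f \<in> borel_measurable M"
    and "AE x in M. h x = 0 \<longrightarrow> cond_exp_inv M \<phi> f x = 0"
    and "AE x in M. cond_exp_phi M \<phi> f x = cond_exp_inv M \<phi> f (\<phi> x)" by blast+
qed

text \<open>Identifies h times E(f) o \<phi>^(-1) as the density of the image of f\<mu> under
  \<phi>. Condition (i) thereby becomes an identity between integrals.\<close>

lemma nn_integral_cond_exp_inv:
  assumes f: "f \<in> borel_measurable M" and G [measurable]: "G \<in> borel_measurable M"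
  shows "(\<integral>\<^sup>+ x. G (\<phi> x) * f x \<partial>M) = (\<integral>\<^sup>+ x. G x * (h x * cond_exp_inv M \<phi> f x) \<partial>M)"
proof -
  note [measurable] = cond_exp_inv(1)[OF f]
  have "(\<integral>\<^sup>+ x. G (\<phi> x) * f x \<partial>M) = (\<integral>\<^sup>+ x. G (\<phi> x) * cond_exp_phi M \<phi> f x \<partial>M)"
    using cond_exp_phi(2)[OF f] G by blast
  also have "\<dots> = (\<integral>\<^sup>+ x. G (\<phi> x) * cond_exp_inv M \<phi> f (\<phi> x) \<partial>M)"
    using cond_exp_inv(3)[OF f] by (intro nn_integral_cong_AE) (auto elim: eventually_mono)
  also have "\<dots> = (\<integral>\<^sup>+ x. h x * (G x * cond_exp_inv M \<phi> f x) \<partial>M)"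
    by (rule nn_integral_\<phi>) measurable
  finally show ?thesis by (simp add: mult_ac)
qed

text \<open>Composition with \<phi> sees a function only on {h > 0}. Indicators of pieces of {h = 0}
  of finite measure are sent to zero, and nothing else is lost.\<close>

lemma injective_iff: "inj_on (oapp (comp_op M \<phi>)) (odom (comp_op M \<phi>)) \<longleftrightarrow> (AE x in M. h x \<noteq> 0)"
proof
  assume inj: "inj_on (oapp (comp_op M \<phi>)) (odom (comp_op M \<phi>))"
  obtain A :: "nat \<Rightarrow> 'a set" where A: "range A \<subseteq> sets M" "(\<Union>i. A i) = space M" "\<And>i. emeasure M (A i) \<noteq> \<infinity>"
    using sigma_finite by blast
  have [measurable]: "A i \<in> sets M" for i using A by auto
  have "AE x in M. \<not> (x \<in> A i \<and> h x = 0)" for i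
  proof -
    define f where "f x = (if x \<in> A i \<and> h x = 0 then 1 else 0 :: complex)" for x
    have [measurable]: "f \<in> borel_measurable M" unfolding f_def by measurable
    have "(\<integral>\<^sup>+ x. ennreal ((cmod (f x))\<^sup>2) \<partial>M) \<le> (\<integral>\<^sup>+ x. indicator (A i) x \<partial>M)"
      by (intro nn_integral_mono) (simp add: f_def)
    then have f: "sqi M f" using A(3)[of i] by (auto simp: sqi_def less_top[symmetric] top_unique)
    have "AE x in M. h (\<phi> x) \<noteq> 0" by (subst AE_\<phi>_iff) auto
    then have f\<phi>: "AE x in M. f (\<phi> x) = 0" by eventually_elim (simp add: f_def)
    then have "sqi M (\<lambda>x. f (\<phi> x))" by (intro sqi_cong_AE[OF sqi_zero]) auto
    then have "l2class M f \<in> odom (comp_op M \<phi>)" "l2class M (\<lambda>x. 0) \<in> odom (comp_op M \<phi>)"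
      by (simp_all add: odom_comp_op_class[OF nonsingular f] odom_comp_op_class[OF nonsingular sqi_zero])
    moreover have "oapp (comp_op M \<phi>) (l2class M f) = oapp (comp_op M \<phi>) (l2class M (\<lambda>x. 0))"
      using l2class_cong[OF f\<phi>] by (simp add: oapp_comp_op_class[OF nonsingular])
    ultimately have "l2class M f = l2class M (\<lambda>x. 0)" using inj by (simp add: inj_on_eq_iff)
    then have "AE x in M. f x = 0" by (simp add: l2class_eq_iff)
    then show ?thesis by eventually_elim (auto simp: f_def split: if_splits)
  qed
  then have "AE x in M. \<forall>i. \<not> (x \<in> A i \<and> h x = 0)" by (subst AE_all_countable) blast
  then show "AE x in M. h x \<noteq> 0"
    by (rule AE_mp) (use A(2) in \<open>auto intro!: AE_I2\<close>)
next
  assume pos: "AE x in M. h x \<noteq> 0"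
  show "inj_on (oapp (comp_op M \<phi>)) (odom (comp_op M \<phi>))"
  proof (rule inj_onI)
    fix c d assume cd: "c \<in> odom (comp_op M \<phi>)" "d \<in> odom (comp_op M \<phi>)"
      and eq: "oapp (comp_op M \<phi>) c = oapp (comp_op M \<phi>) d"
    then have "c \<in> hcarrier (L2 M)" "d \<in> hcarrier (L2 M)" by (auto simp: comp_op_def)
    then obtain f g where f: "sqi M f" "c = l2class M f" and g: "sqi M g" "d = l2class M g"
      by (auto simp: carrier_L2)
    note [measurable] = sqi_measurable[OF f(1)] sqi_measurable[OF g(1)]
    have "AE x in M. f (\<phi> x) = g (\<phi> x)"
      using eq by (simp add: f g oapp_comp_op_class[OF nonsingular] l2class_eq_iff)
    then have "AE x in M. 0 < h x \<longrightarrow> f x = g x" by (subst (asm) AE_\<phi>_iff) auto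
    with pos have "AE x in M. f x = g x" by eventually_elim (auto simp: zero_less_iff_neq_zero)
    then show "c = d" unfolding f g by (rule l2class_cong)
  qed
qed

end

section \<open>The measure on the product space\<close>

text \<open>Rectangles form an intersection-stable generator; finiteness is asked only on strips
  over an exhaustion of the first factor.\<close>

lemma measure_eqI_rectangles:
  assumes sets: "sets R = sets (M \<Otimes>\<^sub>M T)" "sets R' = sets (M \<Otimes>\<^sub>M T)"
    and eq: "\<And>A B. A \<in> sets M \<Longrightarrow> B \<in> sets T \<Longrightarrow> emeasure R (A \<times> B) = emeasure R' (A \<times> B)"
    and A: "range A \<subseteq> sets M" "(\<Union>i. A i) = space M" "\<And>i::nat. emeasure R (A i \<times> space T) \<noteq> \<infinity>"
  shows "R = R'"
proof (rule measure_eqI_generator_eq[OF Int_stable_pair_measure_generator[of M T]])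
  let ?E = "{a \<times> b |a b. a \<in> sets M \<and> b \<in> sets T}"
  show "?E \<subseteq> Pow (space M \<times> space T)" by (rule pair_measure_closed)
  show "sets R = sigma_sets (space M \<times> space T) ?E" "sets R' = sigma_sets (space M \<times> space T) ?E"
    unfolding sets by (rule sets_pair_measure)+
  show "emeasure R X = emeasure R' X" if "X \<in> ?E" for X using that eq by auto
  show "range (\<lambda>i. A i \<times> space T) \<subseteq> ?E" using A(1) by auto
  show "(\<Union>i. A i \<times> space T) = space M \<times> space T" using A(2) by auto
qed (rule A(3))

section \<open>Conditions (i) and (ii) and their consequences for \<zeta>\<close>

locale kernel_comp_op = dense_comp_op M \<phi> for M :: "'a measure" and \<phi> +
  fixes T :: "'t measure" and P :: "'a \<Rightarrow> 't measure" and \<zeta> :: "'t \<Rightarrow> ennreal"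
  assumes P: "prob_family M T P" and \<zeta> [measurable]: "\<zeta> \<in> borel_measurable T"
begin

lemma sets_P: "x \<in> space M \<Longrightarrow> sets (P x) = sets T"
  and prob_P: "x \<in> space M \<Longrightarrow> prob_space (P x)"
  and measurable_P: "\<sigma> \<in> sets T \<Longrightarrow> (\<lambda>x. emeasure (P x) \<sigma>) \<in> borel_measurable M"
  using P by (auto simp: prob_family_def)

lemma space_P: "x \<in> space M \<Longrightarrow> space (P x) = space T"
  using sets_P sets_eq_imp_space_eq by blast

lemma P_kernel [measurable]: "P \<in> measurable M (subprob_algebra T)"
  by (rule measurable_subprob_algebra) (auto simp: sets_P prob_P measurable_P prob_space_imp_subprob_space)

lemma emeasure_P_space: "x \<in> space M \<Longrightarrow> emeasure (P x) (space T) = 1"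
  using prob_space.emeasure_space_1[OF prob_P] by (simp add: space_P)

definition "Z \<sigma> x = (\<integral>\<^sup>+ t\<in>\<sigma>. \<zeta> t \<partial>P x)"

lemma Z_measurable [measurable (raw)]:
  assumes [measurable]: "\<sigma> \<in> sets T"
  shows "Z \<sigma> \<in> borel_measurable M"
  unfolding Z_def[abs_def]
  by (rule nn_integral_measurable_subprob_algebra2[OF _ P_kernel]) measurable

abbreviation "E \<sigma> \<equiv> cond_exp_inv M \<phi> (\<lambda>y. emeasure (P y) \<sigma>)"

lemma E_measurable [measurable]: "\<sigma> \<in> sets T \<Longrightarrow> E \<sigma> \<in> borel_measurable M"
  by (rule cond_exp_inv(1)[OF measurable_P])

lemma cond_i_iff: "cond_i M \<phi> T P \<zeta> \<longleftrightarrow> (\<forall>\<sigma>\<in>sets T. AE x in M. h x * E \<sigma> x = Z \<sigma> x)"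
  by (simp add: cond_i_def Z_def)

text \<open>After E(f) is replaced by its factor through \<phi>, the equation in (ii) depends on
  \<phi> x only and can be pulled back to {h > 0}; injectivity says that this set is conull.\<close>

lemma cond_ii_iff: "cond_ii M \<phi> T P \<zeta> \<longleftrightarrow>
    (\<forall>\<sigma>\<in>sets T. AE x in M. 0 < h x \<longrightarrow> E \<sigma> x = ediv (Z \<sigma> x) (h x)) \<and> (AE x in M. h x \<noteq> 0)"
proof -
  have "(AE x in M. cond_exp_phi M \<phi> (\<lambda>y. emeasure (P y) \<sigma>) x = ediv (Z \<sigma> (\<phi> x)) (h (\<phi> x))) \<longleftrightarrow>
      (AE x in M. 0 < h x \<longrightarrow> E \<sigma> x = ediv (Z \<sigma> x) (h x))" if \<sigma> [measurable]: "\<sigma> \<in> sets T" for \<sigma>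
  proof -
    have "(AE x in M. cond_exp_phi M \<phi> (\<lambda>y. emeasure (P y) \<sigma>) x = ediv (Z \<sigma> (\<phi> x)) (h (\<phi> x))) \<longleftrightarrow>
      (AE x in M. E \<sigma> (\<phi> x) = ediv (Z \<sigma> (\<phi> x)) (h (\<phi> x)))"
      using cond_exp_inv(3)[OF measurable_P[OF \<sigma>]] by (intro eventually_subst) (auto elim: eventually_mono)
    also have "\<dots> \<longleftrightarrow> (AE x in M. 0 < h x \<longrightarrow> E \<sigma> x = ediv (Z \<sigma> x) (h x))"
      by (rule AE_\<phi>_iff) (unfold ediv_def, measurable)
    finally show ?thesis .
  qed
  then show ?thesis unfolding cond_ii_def Z_def[symmetric] injective_iff by simp
qed

text \<open>Testing (i) on $\{\zeta = 0\}$ shows that $P(x,\cdot)$ does not charge this set, whereas (i) on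
  the whole space forces $\zeta = 0$ a.e. for $P(x,\cdot)$ if $h(x) = 0$.\<close>
lemma cond_i_positive:
  assumes i: "cond_i M \<phi> T P \<zeta>"
  shows "AE x in M. h x \<noteq> 0" "AE x in M. AE t in P x. \<zeta> t \<noteq> 0"
proof -
  define \<sigma> where "\<sigma> = {t \<in> space T. \<zeta> t = 0}"
  have \<sigma> [measurable]: "\<sigma> \<in> sets T" unfolding \<sigma>_def by measurable
  have "Z \<sigma> x = 0" for x
  proof -
    have "Z \<sigma> x = (\<integral>\<^sup>+ t. 0 \<partial>P x)" unfolding Z_def
      by (intro nn_integral_cong) (auto simp: \<sigma>_def indicator_def)
    then show ?thesis by simp
  qed
  moreover have "AE x in M. h x * E \<sigma> x = Z \<sigma> x" using i \<sigma> unfolding cond_i_iff by blast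
  ultimately have "AE x in M. h x * E \<sigma> x = 0" by (simp only:)
  \<comment> \<open>With G = 1, the integral of h * E \<sigma> equals that of P(x,
    \<sigma>).\<close>
  then have "(\<integral>\<^sup>+ x. 1 * (h x * E \<sigma> x) \<partial>M) = 0" by (subst nn_integral_0_iff_AE) auto
  then have "(\<integral>\<^sup>+ x. emeasure (P x) \<sigma> \<partial>M) = 0"
    using nn_integral_cond_exp_inv[OF measurable_P[OF \<sigma>], of "\<lambda>x. 1"] by simp
  then have \<sigma>0: "AE x in M. emeasure (P x) \<sigma> = 0"
    using measurable_P[OF \<sigma>] by (subst (asm) nn_integral_0_iff_AE) auto
  show P0: "AE x in M. AE t in P x. \<zeta> t \<noteq> 0"
  proof (rule AE_mp[OF \<sigma>0], rule AE_I2, rule impI)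
    fix x assume x: "x \<in> space M" and 0: "emeasure (P x) \<sigma> = 0"
    have "AE t in P x. t \<notin> \<sigma>" using 0 \<sigma> sets_P[OF x] by (intro AE_not_in) (auto simp: null_sets_def)
    then show "AE t in P x. \<zeta> t \<noteq> 0"
      by (rule AE_mp) (auto intro!: AE_I2 simp: \<sigma>_def space_P[OF x])
  qed
  have "AE x in M. h x * E (space T) x = Z (space T) x" using i by (simp add: cond_i_iff)
  with P0 have "AE x in M. x \<in> space M \<longrightarrow> h x \<noteq> 0"
  proof eventually_elim
    fix x assume ne: "AE t in P x. \<zeta> t \<noteq> 0" and eq: "h x * E (space T) x = Z (space T) x"
    show "x \<in> space M \<longrightarrow> h x \<noteq> 0"
    proof (intro impI notI)
      assume x: "x \<in> space M" and "h x = 0"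
      then have "Z (space T) x = 0" using eq by simp
      moreover have [measurable]: "\<zeta> \<in> borel_measurable (P x)"
        using \<zeta> measurable_cong_sets[OF sets_P[OF x] refl] by blast
      moreover have "Z (space T) x = (\<integral>\<^sup>+ t. \<zeta> t \<partial>P x)" unfolding Z_def
        by (intro nn_integral_cong) (simp add: space_P[OF x])
      ultimately have "AE t in P x. \<zeta> t = 0" by (simp add: nn_integral_0_iff_AE)
      with ne have "AE t in P x. False" by eventually_elim simp
      then show False using prob_space.AE_False[OF prob_P[OF x]] by simp
    qed
  qed
  then show "AE x in M. h x \<noteq> 0" by (rule AE_mp) (auto intro!: AE_I2)
qed

text \<open>Where 0 < h < \<infinity> the equation can be divided by h. Finiteness comes from the
  dense domain; h is nonzero by injectivity under (ii), and by \<open>cond_i_positive\<close> under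
  (i).\<close>

lemma cond_i_eq_cond_ii: "cond_i M \<phi> T P \<zeta> \<longleftrightarrow> cond_ii M \<phi> T P \<zeta>"
proof -
  have eq: "h * e = z \<longleftrightarrow> e = ediv z h" if "h \<noteq> 0" "h \<noteq> \<infinity>" for h e z :: ennreal
    using that ennreal_mult_divide_eq[of h e] ennreal_times_divide[of h z h] ennreal_mult_divide_eq[of h z]
    by (auto simp: ediv_def mult.commute)
  have "(AE x in M. h x * E \<sigma> x = Z \<sigma> x) \<longleftrightarrow> (AE x in M. 0 < h x \<longrightarrow> E \<sigma> x = ediv (Z \<sigma> x) (h x))"
    if "AE x in M. h x \<noteq> 0" for \<sigma>
  proof (rule eventually_subst)
    show "AE x in M. (h x * E \<sigma> x = Z \<sigma> x) = (0 < h x \<longrightarrow> E \<sigma> x = ediv (Z \<sigma> x) (h x))"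
      using that h_finite by eventually_elim (simp add: eq zero_less_iff_neq_zero)
  qed
  then show ?thesis unfolding cond_ii_iff cond_i_iff using cond_i_positive(1)[unfolded cond_i_iff] by blast
qed

lemma cond_i_integral:
  assumes i: "cond_i M \<phi> T P \<zeta>" and \<sigma> [measurable]: "\<sigma> \<in> sets T" and G [measurable]: "G \<in> borel_measurable M"
  shows "(\<integral>\<^sup>+ x. G (\<phi> x) * emeasure (P x) \<sigma> \<partial>M) = (\<integral>\<^sup>+ x. G x * Z \<sigma> x \<partial>M)"
proof -
  have ae: "AE x in M. h x * E \<sigma> x = Z \<sigma> x" using i \<sigma> by (simp add: cond_i_iff)
  have "(\<integral>\<^sup>+ x. G (\<phi> x) * emeasure (P x) \<sigma> \<partial>M) = (\<integral>\<^sup>+ x. G x * (h x * E \<sigma> x) \<partial>M)"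
    by (rule nn_integral_cond_exp_inv[OF measurable_P[OF \<sigma>] G])
  also have "\<dots> = (\<integral>\<^sup>+ x. G x * Z \<sigma> x \<partial>M)"
    by (intro nn_integral_cong_AE, use ae in eventually_elim) simp
  finally show ?thesis .
qed

text \<open>As each P x has mass one, condition (i) for \<sigma> = T makes both sides densities of
  the law of \<phi>.\<close>

lemma cond_i_total:
  assumes i: "cond_i M \<phi> T P \<zeta>"
  shows "AE x in M. Z (space T) x = h x"
proof (rule density_unique2)
  fix A assume [measurable]: "A \<in> sets M"
  have "(\<integral>\<^sup>+ x\<in>A. Z (space T) x \<partial>M) = (\<integral>\<^sup>+ x. indicator A x * Z (space T) x \<partial>M)"
    by (simp add: mult.commute)
  also have "\<dots> = (\<integral>\<^sup>+ x. indicator A (\<phi> x) * emeasure (P x) (space T) \<partial>M)"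
    by (rule cond_i_integral[OF i, symmetric]) measurable
  also have "\<dots> = (\<integral>\<^sup>+ x. indicator A (\<phi> x) \<partial>M)"
    by (intro nn_integral_cong) (simp add: emeasure_P_space)
  also have "\<dots> = (\<integral>\<^sup>+ x\<in>A. h x \<partial>M)" by (rule nn_integral_\<phi>) measurable
  finally show "(\<integral>\<^sup>+ x\<in>A. Z (space T) x \<partial>M) = (\<integral>\<^sup>+ x\<in>A. h x \<partial>M)" .
qed measurable

text \<open>The integral of \<zeta> against P x equals h x, which is finite for almost every x, so
  \<zeta> is finite a.e. for P x.\<close>

lemma cond_i_zeta:
  assumes i: "cond_i M \<phi> T P \<zeta>"
  shows "AE x in M. AE t in P x. \<zeta> t \<noteq> 0 \<and> \<zeta> t \<noteq> \<infinity>"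
proof -
  have "AE x in M. x \<in> space M \<longrightarrow> (AE t in P x. \<zeta> t \<noteq> 0 \<and> \<zeta> t \<noteq> \<infinity>)"
    using cond_i_positive(2)[OF i] cond_i_total[OF i] h_finite
  proof eventually_elim
    fix x assume ne: "AE t in P x. \<zeta> t \<noteq> 0" and eq: "Z (space T) x = h x" and fin: "h x \<noteq> \<infinity>"
    show "x \<in> space M \<longrightarrow> (AE t in P x. \<zeta> t \<noteq> 0 \<and> \<zeta> t \<noteq> \<infinity>)"
    proof
      assume x: "x \<in> space M"
      have [measurable]: "\<zeta> \<in> borel_measurable (P x)"
        using \<zeta> measurable_cong_sets[OF sets_P[OF x] refl] by blast
      have "Z (space T) x = (\<integral>\<^sup>+ t. \<zeta> t \<partial>P x)" unfolding Z_def
        by (intro nn_integral_cong) (simp add: space_P[OF x])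
      then have "AE t in P x. \<zeta> t \<noteq> \<infinity>" using eq fin by (intro nn_integral_PInf_AE) auto
      with ne show "AE t in P x. \<zeta> t \<noteq> 0 \<and> \<zeta> t \<noteq> \<infinity>" by eventually_elim simp
    qed
  qed
  then show ?thesis by (rule AE_mp) (auto intro!: AE_I2)
qed

section \<open>The measure \<rho> and the transformation \<Phi> of the product\<close>

text \<open>The semidirect product of \<mu> with the kernel P: x is sent to the law of (x, t) with t
  distributed according to P x.\<close>

definition rho :: "('a \<times> 't) measure" where
  "rho = M \<bind> (\<lambda>x. distr (P x) (M \<Otimes>\<^sub>M T) (Pair x))"

lemma sets_rho: "sets rho = sets (M \<Otimes>\<^sub>M T)"
proof (cases "space M = {}")
  \<comment> \<open>Over an empty space \<open>bind\<close> returns the empty counting measure by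
    convention.\<close>
  case True
  then have "space (M \<Otimes>\<^sub>M T) = {}" by (simp add: space_pair_measure)
  then show ?thesis using True by (simp add: rho_def bind_empty space_empty_iff)
qed (simp add: rho_def)

lemma nn_integral_rho:
  assumes F [measurable]: "F \<in> borel_measurable (M \<Otimes>\<^sub>M T)"
  shows "(\<integral>\<^sup>+ z. F z \<partial>rho) = (\<integral>\<^sup>+ x. \<integral>\<^sup>+ t. F (x, t) \<partial>P x \<partial>M)"
proof -
  have "(\<lambda>x. distr (P x) (M \<Otimes>\<^sub>M T) (Pair x)) \<in> measurable M (subprob_algebra (M \<Otimes>\<^sub>M T))"
    by (intro measurable_distr2[OF _ P_kernel]) measurable
  then have "(\<integral>\<^sup>+ z. F z \<partial>rho) = (\<integral>\<^sup>+ x. \<integral>\<^sup>+ z. F z \<partial>distr (P x) (M \<Otimes>\<^sub>M T) (Pair x) \<partial>M)"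
    unfolding rho_def by (rule nn_integral_bind[OF F])
  also have "\<dots> = (\<integral>\<^sup>+ x. \<integral>\<^sup>+ t. F (x, t) \<partial>P x \<partial>M)"
  proof (intro nn_integral_cong nn_integral_distr)
    fix x assume x: "x \<in> space M"
    then show "Pair x \<in> measurable (P x) (M \<Otimes>\<^sub>M T)"
      using measurable_Pair1'[OF x, of T] measurable_cong_sets[OF sets_P[OF x] refl] by blast
  qed (use F in simp)
  finally show ?thesis .
qed

text \<open>The point y is kept apart from x: it is x for \<rho> itself, and \<phi> x for the image
  of \<rho> under \<Phi>.\<close>

lemma rectangle_integral:
  assumes x: "x \<in> space M" and \<sigma>: "\<sigma> \<in> sets T"
  shows "(\<integral>\<^sup>+ t. indicator (A \<times> \<sigma>) (y, t) \<partial>P x) = indicator A y * emeasure (P x) \<sigma>"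
    and "(\<integral>\<^sup>+ t. \<zeta> t * indicator (A \<times> \<sigma>) (y, t) \<partial>P x) = indicator A y * Z \<sigma> x"
proof -
  have [measurable]: "\<sigma> \<in> sets (P x)" using \<sigma> sets_P[OF x] by simp
  have [measurable]: "\<zeta> \<in> borel_measurable (P x)"
    using \<zeta> measurable_cong_sets[OF sets_P[OF x] refl] by blast
  have "(\<integral>\<^sup>+ t. indicator (A \<times> \<sigma>) (y, t) \<partial>P x) = (\<integral>\<^sup>+ t. indicator A y * indicator \<sigma> t \<partial>P x)"
    by (intro nn_integral_cong) (auto simp: indicator_def)
  also have "\<dots> = indicator A y * emeasure (P x) \<sigma>" by (subst nn_integral_cmult) auto
  finally show "(\<integral>\<^sup>+ t. indicator (A \<times> \<sigma>) (y, t) \<partial>P x) = indicator A y * emeasure (P x) \<sigma>" .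
  have "(\<integral>\<^sup>+ t. \<zeta> t * indicator (A \<times> \<sigma>) (y, t) \<partial>P x) = (\<integral>\<^sup>+ t. indicator A y * (\<zeta> t * indicator \<sigma> t) \<partial>P x)"
    by (intro nn_integral_cong) (auto simp: indicator_def)
  also have "\<dots> = indicator A y * Z \<sigma> x" unfolding Z_def by (subst nn_integral_cmult) auto
  finally show "(\<integral>\<^sup>+ t. \<zeta> t * indicator (A \<times> \<sigma>) (y, t) \<partial>P x) = indicator A y * Z \<sigma> x" .
qed

lemma rho_prop_rho: "rho_prop M T P rho"
  unfolding rho_prop_def
proof (intro conjI ballI)
  fix A \<sigma> assume A [measurable]: "A \<in> sets M" and \<sigma> [measurable]: "\<sigma> \<in> sets T"
  have "emeasure rho (A \<times> \<sigma>) = (\<integral>\<^sup>+ z. indicator (A \<times> \<sigma>) z \<partial>rho)"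
    by (rule nn_integral_indicator[symmetric]) (simp add: sets_rho)
  also have "\<dots> = (\<integral>\<^sup>+ x. \<integral>\<^sup>+ t. indicator (A \<times> \<sigma>) (x, t) \<partial>P x \<partial>M)"
    by (rule nn_integral_rho) measurable
  also have "\<dots> = (\<integral>\<^sup>+ x\<in>A. emeasure (P x) \<sigma> \<partial>M)"
    by (intro nn_integral_cong) (simp add: rectangle_integral mult.commute)
  finally show "emeasure rho (A \<times> \<sigma>) = (\<integral>\<^sup>+ x\<in>A. emeasure (P x) \<sigma> \<partial>M)" .
qed (rule sets_rho)

lemma rho_prop_marginal:
  assumes "rho_prop M T P R" "A \<in> sets M"
  shows "emeasure R (A \<times> space T) = emeasure M A"
proof -
  have "emeasure R (A \<times> space T) = (\<integral>\<^sup>+ x\<in>A. emeasure (P x) (space T) \<partial>M)"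
    using assms by (simp add: rho_prop_def)
  also have "\<dots> = (\<integral>\<^sup>+ x. indicator A x \<partial>M)"
    by (intro nn_integral_cong) (simp add: emeasure_P_space)
  finally show ?thesis using assms(2) by simp
qed

text \<open>The first marginal is \<mu>, so strips over sets of finite \<mu>-measure have finite
  measure and the rectangles decide.\<close>

lemma rho_prop_unique:
  assumes R: "rho_prop M T P R"
  shows "R = rho"
proof -
  obtain A :: "nat \<Rightarrow> 'a set" where A: "range A \<subseteq> sets M" "(\<Union>i. A i) = space M" "\<And>i. emeasure M (A i) \<noteq> \<infinity>"
    using sigma_finite by blast
  show ?thesis
  proof (rule measure_eqI_rectangles[OF _ _ _ A(1,2)])
    show "emeasure R (A i \<times> space T) \<noteq> \<infinity>" for i
      using A rho_prop_marginal[OF R, of "A i"] by auto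
  qed (use R rho_prop_rho in \<open>auto simp: rho_prop_def\<close>)
qed

lemma AE_rho:
  assumes Q: "Measurable.pred (M \<Otimes>\<^sub>M T) Q" and ae: "AE x in M. AE t in P x. Q (x, t)"
  shows "AE z in rho. Q z"
proof -
  have "{z \<in> space rho. Q z} \<in> sets rho"
    using Q sets_eq_imp_space_eq[OF sets_rho] by (simp add: sets_rho pred_def)
  then have "(AE z in rho. Q z) \<longleftrightarrow> (\<integral>\<^sup>+ z. indicator {z. \<not> Q z} z \<partial>rho) = 0" by (rule AE_iff_nn_integral)
  also have "(\<integral>\<^sup>+ z. indicator {z. \<not> Q z} z \<partial>rho) = (\<integral>\<^sup>+ x. \<integral>\<^sup>+ t. indicator {z. \<not> Q z} (x, t) \<partial>P x \<partial>M)"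
    using Q by (intro nn_integral_rho borel_measurable_indicator') auto
  also have "\<dots> = (\<integral>\<^sup>+ x. 0 \<partial>M)"
  proof (intro nn_integral_cong_AE, use ae in eventually_elim)
    fix x assume "AE t in P x. Q (x, t)"
    then have "AE t in P x. indicator {z. \<not> Q z} (x, t) = (0::ennreal)" by eventually_elim simp
    then have "(\<integral>\<^sup>+ t. indicator {z. \<not> Q z} (x, t) \<partial>P x) = (\<integral>\<^sup>+ t. 0 \<partial>P x)" by (rule nn_integral_cong_AE)
    then show "(\<integral>\<^sup>+ t. indicator {z. \<not> Q z} (x, t) \<partial>P x) = 0" by simp
  qed
  finally show ?thesis by simp
qed

abbreviation "\<Phi> \<equiv> (\<lambda>(x, t). (\<phi> x, t :: 't))"

lemma \<Phi>_measurable: "\<Phi> \<in> measurable rho rho"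
  unfolding measurable_cong_sets[OF sets_rho sets_rho] by measurable

text \<open>On A x \<sigma> both measures equal the integral of Z \<sigma> over A: for the density
  by definition of \<rho>, for the pushforward by condition (i) tested with the indicator of
  A.\<close>

lemma distr_\<Phi>:
  assumes i: "cond_i M \<phi> T P \<zeta>"
  shows "distr rho rho \<Phi> = density rho (\<lambda>z. \<zeta> (snd z))"
proof -
  have \<zeta>snd: "(\<lambda>z. \<zeta> (snd z)) \<in> borel_measurable rho"
    unfolding measurable_cong_sets[OF sets_rho refl] by measurable
  have distr: "emeasure (distr rho rho \<Phi>) (A \<times> \<sigma>) = (\<integral>\<^sup>+ x. indicator A x * Z \<sigma> x \<partial>M)"
    if A [measurable]: "A \<in> sets M" and \<sigma> [measurable]: "\<sigma> \<in> sets T" for A \<sigma>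
  proof -
    have "A \<times> \<sigma> \<in> sets (distr rho rho \<Phi>)" by (simp add: sets_rho)
    then have "emeasure (distr rho rho \<Phi>) (A \<times> \<sigma>) = (\<integral>\<^sup>+ z. indicator (A \<times> \<sigma>) z \<partial>distr rho rho \<Phi>)"
      by (rule nn_integral_indicator[symmetric])
    also have "\<dots> = (\<integral>\<^sup>+ z. indicator (A \<times> \<sigma>) (\<Phi> z) \<partial>rho)"
      by (rule nn_integral_distr[OF \<Phi>_measurable], rule borel_measurable_indicator) (simp add: sets_rho)
    also have "\<dots> = (\<integral>\<^sup>+ x. \<integral>\<^sup>+ t. indicator (A \<times> \<sigma>) (\<Phi> (x, t)) \<partial>P x \<partial>M)"
      by (rule nn_integral_rho) measurable
    also have "\<dots> = (\<integral>\<^sup>+ x. indicator A (\<phi> x) * emeasure (P x) \<sigma> \<partial>M)"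
      by (intro nn_integral_cong) (simp add: rectangle_integral)
    also have "\<dots> = (\<integral>\<^sup>+ x. indicator A x * Z \<sigma> x \<partial>M)"
      by (rule cond_i_integral[OF i \<sigma>]) measurable
    finally show ?thesis .
  qed
  have dens: "emeasure (density rho (\<lambda>z. \<zeta> (snd z))) (A \<times> \<sigma>) = (\<integral>\<^sup>+ x. indicator A x * Z \<sigma> x \<partial>M)"
    if A [measurable]: "A \<in> sets M" and \<sigma> [measurable]: "\<sigma> \<in> sets T" for A \<sigma>
  proof -
    have "emeasure (density rho (\<lambda>z. \<zeta> (snd z))) (A \<times> \<sigma>) = (\<integral>\<^sup>+ z. \<zeta> (snd z) * indicator (A \<times> \<sigma>) z \<partial>rho)"
      by (rule emeasure_density[OF \<zeta>snd]) (simp add: sets_rho)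
    also have "\<dots> = (\<integral>\<^sup>+ x. \<integral>\<^sup>+ t. \<zeta> (snd (x, t)) * indicator (A \<times> \<sigma>) (x, t) \<partial>P x \<partial>M)"
      by (rule nn_integral_rho) measurable
    also have "\<dots> = (\<integral>\<^sup>+ x. indicator A x * Z \<sigma> x \<partial>M)"
      by (intro nn_integral_cong) (simp add: rectangle_integral)
    finally show ?thesis .
  qed
  obtain A :: "nat \<Rightarrow> 'a set" where A: "range A \<subseteq> sets M" "(\<Union>i. A i) = space M"
      "\<And>i. emeasure M (A i) \<noteq> \<infinity>" "incseq A"
    using sigma_finite_incseq by blast
  have [measurable]: "A i \<in> sets M" for i using A by auto
  \<comment> \<open>The pushforward gives A n x T the integral of h over A n, which may be infinite;
    hence the bound on h. The points with h = \<infinity>, a null set, stay in so that the union is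
    all of X.\<close>
  define B where "B n = {x \<in> space M. x \<in> A n \<and> (h x \<le> of_nat n \<or> h x = \<infinity>)}" for n
  have B [measurable]: "B n \<in> sets M" for n unfolding B_def by measurable
  show ?thesis
  proof (rule measure_eqI_rectangles[where A = B])
    show "sets (distr rho rho \<Phi>) = sets (M \<Otimes>\<^sub>M T)" "sets (density rho (\<lambda>z. \<zeta> (snd z))) = sets (M \<Otimes>\<^sub>M T)"
      by (simp_all add: sets_rho)
    show "range B \<subseteq> sets M" using B by auto
    show "(\<Union>n. B n) = space M"
    proof (rule equalityI)
      show "space M \<subseteq> (\<Union>n. B n)"
      proof
        fix x assume x: "x \<in> space M"
        then obtain n where n: "x \<in> A n" using A(2) by blast
        show "x \<in> (\<Union>n. B n)"
        proof (cases "h x = \<infinity>")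
          case True
          then show ?thesis using n x by (auto simp: B_def)
        next
          case False
          then obtain m where "h x \<le> of_nat m"
            using ennreal_Ex_less_of_nat[of "h x"] by (auto simp: less_top intro: less_imp_le)
          then have "h x \<le> of_nat (max n m)" by (rule order_trans) simp
          moreover have "x \<in> A (max n m)" using n incseqD[OF A(4), of n "max n m"] by auto
          ultimately show ?thesis using x by (auto simp: B_def)
        qed
      qed
    qed (auto simp: B_def)
    show "emeasure (distr rho rho \<Phi>) (B n \<times> space T) \<noteq> \<infinity>" for n
    proof -
      have "emeasure (distr rho rho \<Phi>) (B n \<times> space T) = (\<integral>\<^sup>+ x. indicator (B n) x * Z (space T) x \<partial>M)"
        by (rule distr) auto
      also have "\<dots> \<le> (\<integral>\<^sup>+ x. of_nat n * indicator (A n) x \<partial>M)"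
      proof (rule nn_integral_mono_AE, use cond_i_total[OF i] h_finite in eventually_elim)
        fix x assume "Z (space T) x = h x" "h x \<noteq> \<infinity>"
        then show "indicator (B n) x * Z (space T) x \<le> of_nat n * indicator (A n) x"
          by (auto simp: B_def indicator_def)
      qed
      also have "\<dots> = of_nat n * emeasure M (A n)" by (subst nn_integral_cmult) auto
      also have "\<dots> < \<infinity>" using A(3)[of n] by (auto simp: less_top[symmetric] ennreal_mult_eq_top_iff)
      finally show ?thesis by simp
    qed
  qed (simp add: distr dens)
qed

text \<open>\<zeta> is altered on the \<rho>-null set where it is 0 or \<infinity>. The alteration
  depends on t alone, so invariance under \<Phi> holds at every point.\<close>

definition "kz z = (if \<zeta> (snd z) = 0 \<or> \<zeta> (snd z) = \<infinity> then 1 else enn2real (\<zeta> (snd z)))" for z :: "'a \<times> 't"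

lemma weighted_comp_rho:
  assumes i: "cond_i M \<phi> T P \<zeta>"
  shows "weighted_comp rho \<Phi> kz"
proof (rule weighted_comp.intro)
  show "\<Phi> \<in> measurable rho rho" by (rule \<Phi>_measurable)
  have kz_meas: "kz \<in> borel_measurable (M \<Otimes>\<^sub>M T)" unfolding kz_def[abs_def] by measurable
  then show "kz \<in> borel_measurable rho" unfolding measurable_cong_sets[OF sets_rho refl] .
  show "0 < kz z" for z
    by (auto simp: kz_def enn2real_positive_iff zero_less_iff_neq_zero less_top)
  show "kz (\<Phi> z) = kz z" for z by (simp add: kz_def split_beta)
  have "AE z in rho. \<zeta> (snd z) = ennreal (kz z)"
  proof (rule AE_rho)
    show "Measurable.pred (M \<Otimes>\<^sub>M T) (\<lambda>z. \<zeta> (snd z) = ennreal (kz z))" using kz_meas by measurable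
    show "AE x in M. AE t in P x. \<zeta> (snd (x, t)) = ennreal (kz (x, t))"
    proof (rule AE_mp[OF cond_i_zeta[OF i]], rule AE_I2, rule impI)
      fix x assume "AE t in P x. \<zeta> t \<noteq> 0 \<and> \<zeta> t \<noteq> \<infinity>"
      then show "AE t in P x. \<zeta> (snd (x, t)) = ennreal (kz (x, t))"
        by eventually_elim (simp add: kz_def less_top)
    qed
  qed
  then have "density rho (\<lambda>z. \<zeta> (snd z)) = density rho (\<lambda>z. ennreal (kz z))"
    using kz_meas by (intro density_cong) (auto simp: measurable_cong_sets[OF sets_rho refl])
  then show "distr rho rho \<Phi> = density rho (\<lambda>z. ennreal (kz z))" using distr_\<Phi>[OF i] by simp
qed

section \<open>The embedding of L2(\<mu>) and subnormality\<close>

lemma fst_measurable: "fst \<in> measurable rho M"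
  unfolding measurable_cong_sets[OF sets_rho refl] by measurable

text \<open>The projection preserves measure, which makes the embedding isometric and lets square
  integrability be tested on either space.\<close>

lemma distr_fst: "distr rho M fst = M"
proof (rule measure_eqI)
  fix A assume "A \<in> sets (distr rho M fst)"
  then have A: "A \<in> sets M" by simp
  then have "fst -` A \<inter> space rho = A \<times> space T"
    using sets.sets_into_space[OF A] sets_eq_imp_space_eq[OF sets_rho] by (auto simp: space_pair_measure)
  then show "emeasure (distr rho M fst) A = emeasure M A"
    using A rho_prop_marginal[OF rho_prop_rho A] by (simp add: emeasure_distr[OF fst_measurable])
qed simp

lemma AE_fst: "AE x in M. Q x \<Longrightarrow> AE z in rho. Q (fst z)"
  using AE_distrD[OF fst_measurable, of Q] unfolding distr_fst .

lemma sqi_fst: "f \<in> borel_measurable M \<Longrightarrow> sqi rho (\<lambda>z. f (fst z)) \<longleftrightarrow> sqi M f"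
proof -
  assume [measurable]: "f \<in> borel_measurable M"
  have "(\<integral>\<^sup>+ x. ennreal ((cmod (f x))\<^sup>2) \<partial>distr rho M fst) = (\<integral>\<^sup>+ z. ennreal ((cmod (f (fst z)))\<^sup>2) \<partial>rho)"
    by (rule nn_integral_distr[OF fst_measurable]) measurable
  moreover have "(\<lambda>z. f (fst z)) \<in> borel_measurable rho"
    by (rule measurable_compose[OF fst_measurable]) measurable
  ultimately show ?thesis by (simp add: sqi_def distr_fst)
qed

lemma embedU_class: "f \<in> borel_measurable M \<Longrightarrow> embedU rho (l2class M f) = l2class rho (\<lambda>z. f (fst z))"
  unfolding embedU_def using AE_fst[OF l2rep_class(2)[of f M]]
  by (intro l2class_cong) (auto simp: split_beta elim: eventually_mono)

lemma embedU_iso: "hiso_embed (L2 M) (L2 rho) (embedU rho)"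
proof -
  have inner: "(\<integral>z. f (fst z) * cnj (g (fst z)) \<partial>rho) = (\<integral>x. f x * cnj (g x) \<partial>M)"
    if f: "sqi M f" and g: "sqi M g" for f g
  proof -
    note [measurable] = sqi_measurable[OF f] sqi_measurable[OF g]
    have "(\<integral>x. f x * cnj (g x) \<partial>distr rho M fst) = (\<integral>z. f (fst z) * cnj (g (fst z)) \<partial>rho)"
      by (rule integral_distr[OF fst_measurable]) measurable
    then show ?thesis by (simp add: distr_fst)
  qed
  show ?thesis
    unfolding hiso_embed_def carrier_L2
    by (auto simp: inner embedU_class sqi_fst sqi_measurable intro!: imageI)
qed

text \<open>The projection intertwines \<Phi> with \<phi> and preserves measure, so g o \<phi> is
  square integrable exactly if its lift is, and the lift of g o \<phi> is the lift of g composed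
  with \<Phi>.\<close>

lemma embedU_odom:
  assumes i: "cond_i M \<phi> T P \<zeta>" and f: "f \<in> hcarrier (L2 M)"
  shows "embedU rho f \<in> odom (comp_op rho \<Phi>) \<longleftrightarrow> f \<in> odom (comp_op M \<phi>)"
    and "oapp (comp_op rho \<Phi>) (embedU rho f) = embedU rho (oapp (comp_op M \<phi>) f)"
proof -
  have ns: "nonsingular rho \<Phi>" by (rule weighted_comp.nonsingular_\<Phi>[OF weighted_comp_rho[OF i]])
  obtain g where g: "sqi M g" "f = l2class M g" using f by (auto simp: carrier_L2)
  note [measurable] = sqi_measurable[OF g(1)]
  have gf: "sqi rho (\<lambda>z. g (fst z))" using g by (simp add: sqi_fst)
  have fst\<Phi>: "fst (\<Phi> z) = \<phi> (fst z)" for z :: "'a \<times> 't" by (simp add: split_beta)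
  show "embedU rho f \<in> odom (comp_op rho \<Phi>) \<longleftrightarrow> f \<in> odom (comp_op M \<phi>)"
    using g sqi_fst[of "\<lambda>x. g (\<phi> x)"]
    by (simp add: embedU_class odom_comp_op_class[OF ns gf] odom_comp_op_class[OF nonsingular g(1)] fst\<Phi>)
  show "oapp (comp_op rho \<Phi>) (embedU rho f) = embedU rho (oapp (comp_op M \<phi>) f)"
    using g sqi_measurable[OF gf]
    by (simp add: embedU_class oapp_comp_op_class[OF ns] oapp_comp_op_class[OF nonsingular] fst\<Phi>)
qed

text \<open>The normal extension of the composition operator on L2(\<rho>) also extends the one on
  L2(\<mu>), along the composite of the two isometric embeddings.\<close>

lemma hsubnormal_comp_op:
  assumes i: "cond_i M \<phi> T P \<zeta>"
  shows "hsubnormal TYPE(('a \<times> 't \<Rightarrow> complex) set) (L2 M) (comp_op M \<phi>)"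
proof -
  obtain K :: "('a \<times> 't \<Rightarrow> complex) set hilbert" and W N where K: "is_hilbert K" "hiso_embed (L2 rho) K W" "hnormal K N"
     and N: "\<And>f. f \<in> odom (comp_op rho \<Phi>) \<Longrightarrow> W f \<in> odom N \<and> oapp N (W f) = W (oapp (comp_op rho \<Phi>) f)"
    using weighted_comp.comp_op_normal_extension[OF weighted_comp_rho[OF i]] by blast
  have iso: "hiso_embed (L2 M) K (\<lambda>f. W (embedU rho f))"
    using embedU_iso K(2) unfolding hiso_embed_def by simp
  have sub: "f \<in> hcarrier (L2 M)" if "f \<in> odom (comp_op M \<phi>)" for f using that by (simp add: comp_op_def)
  have "W (embedU rho f) \<in> odom N \<and> oapp N (W (embedU rho f)) = W (embedU rho (oapp (comp_op M \<phi>) f))"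
    if "f \<in> odom (comp_op M \<phi>)" for f
    using N[of "embedU rho f"] embedU_odom[OF i sub[OF that]] that by simp
  then show ?thesis
    unfolding hsubnormal_def using dense K iso
    by (intro conjI exI[of _ K] exI[of _ "\<lambda>f. W (embedU rho f)"] exI[of _ N]) auto
qed

end

theorem theorem9:
  fixes M :: "'a measure" and \<phi> :: "'a \<Rightarrow> 'a" and T :: "'t measure"
    and P :: "'a \<Rightarrow> 't measure" and \<zeta> :: "'t \<Rightarrow> ennreal"
  assumes "sigma_finite_measure M"
    and "nonsingular M \<phi>"
    and "densely_defined (L2 M) (comp_op M \<phi>)"
    and "prob_family M T P"
    and "\<zeta> \<in> borel_measurable T"
  shows "(cond_i M \<phi> T P \<zeta> \<longleftrightarrow> cond_ii M \<phi> T P \<zeta>) \<and>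
    ((cond_i M \<phi> T P \<zeta> \<or> cond_ii M \<phi> T P \<zeta>) \<longrightarrow>
       hsubnormal TYPE(('a \<times> 't \<Rightarrow> complex) set) (L2 M) (comp_op M \<phi>) \<and>
       (\<exists>!\<rho>. rho_prop M T P \<rho>) \<and>
       (\<forall>\<rho>. rho_prop M T P \<rho> \<longrightarrow>
          nonsingular \<rho> (\<lambda>(x, t). (\<phi> x, t)) \<and>
          hiso_embed (L2 M) (L2 \<rho>) (embedU \<rho>) \<and>
          hquasinormal (L2 \<rho>) (comp_op \<rho> (\<lambda>(x, t). (\<phi> x, t))) \<and>
          (\<forall>f\<in>hcarrier (L2 M). embedU \<rho> f \<in> odom (comp_op \<rho> (\<lambda>(x, t). (\<phi> x, t)))
              \<longleftrightarrow> f \<in> odom (comp_op M \<phi>)) \<and>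
          (\<forall>f\<in>odom (comp_op M \<phi>).
              oapp (comp_op \<rho> (\<lambda>(x, t). (\<phi> x, t))) (embedU \<rho> f) = embedU \<rho> (oapp (comp_op M \<phi>) f))))"
proof -
  interpret kernel_comp_op M \<phi> T P \<zeta>
    using assms by (intro kernel_comp_op.intro dense_comp_op.intro dense_comp_op_axioms.intro kernel_comp_op_axioms.intro)
  have main: "hsubnormal TYPE(('a \<times> 't \<Rightarrow> complex) set) (L2 M) (comp_op M \<phi>) \<and>
       (\<exists>!\<rho>. rho_prop M T P \<rho>) \<and>
       (\<forall>\<rho>. rho_prop M T P \<rho> \<longrightarrow>
          nonsingular \<rho> \<Phi> \<and> hiso_embed (L2 M) (L2 \<rho>) (embedU \<rho>) \<and>
          hquasinormal (L2 \<rho>) (comp_op \<rho> \<Phi>) \<and>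
          (\<forall>f\<in>hcarrier (L2 M). embedU \<rho> f \<in> odom (comp_op \<rho> \<Phi>) \<longleftrightarrow> f \<in> odom (comp_op M \<phi>)) \<and>
          (\<forall>f\<in>odom (comp_op M \<phi>).
              oapp (comp_op \<rho> \<Phi>) (embedU \<rho> f) = embedU \<rho> (oapp (comp_op M \<phi>) f)))"
    if i: "cond_i M \<phi> T P \<zeta>"
  proof (intro conjI allI impI ballI)
    interpret W: weighted_comp rho \<Phi> kz by (rule weighted_comp_rho[OF i])
    show "hsubnormal TYPE(('a \<times> 't \<Rightarrow> complex) set) (L2 M) (comp_op M \<phi>)" by (rule hsubnormal_comp_op[OF i])
    show "\<exists>!\<rho>. rho_prop M T P \<rho>" using rho_prop_rho rho_prop_unique by blast
    fix R assume "rho_prop M T P R"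
    then have R: "R = rho" by (rule rho_prop_unique)
    show "nonsingular R \<Phi>" unfolding R by (rule W.nonsingular_\<Phi>)
    show "hiso_embed (L2 M) (L2 R) (embedU R)" unfolding R by (rule embedU_iso)
    show "hquasinormal (L2 R) (comp_op R \<Phi>)" unfolding R by (rule W.comp_op_quasinormal)
    show "embedU R f \<in> odom (comp_op R \<Phi>) \<longleftrightarrow> f \<in> odom (comp_op M \<phi>)" if "f \<in> hcarrier (L2 M)" for f
      unfolding R by (rule embedU_odom(1)[OF i that])
    show "oapp (comp_op R \<Phi>) (embedU R f) = embedU R (oapp (comp_op M \<phi>) f)" if "f \<in> odom (comp_op M \<phi>)" for f
      unfolding R using that by (intro embedU_odom(2)[OF i]) (simp add: comp_op_def)
  qed
  then show ?thesis using cond_i_eq_cond_ii by blast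
qed

end
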